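(* Let $\Sigma$ be the normal fan of a full-dimensional simple polytope $P\subset\mathbb{R}^d$ and let $U\in\mathbb{R}^{n\times d}$ be its ray matrix. If $\dim{\rm Sing}(\mathcal{A}_\Sigma)<n-d-1$, then Warren's adjoint hypersurface $\{y\in\mathbb{C}^d:{\rm adj}_{P_z}(y)=0\}$ is smooth for generic $z\in{\rm int}({\rm Def}(\Sigma))=\{z\in\mathbb{R}^n:\Sigma_{P_z}=\Sigma\}$.
   Context: $\Sigma=\Sigma_P$ is the inner normal fan of $P$ (simplicial, with $n$ rays corresponding to the facets of $P$). $\Sigma(k)$ is the set of $k$-dimensional cones, $\sigma(1)$ the set of rays of $\sigma$. A ray matrix $U\in\mathbb{R}^{n\times d}$ has rows $u_\rho$, $\rho\in\Sigma(1)$, with $u_\rho$ a nonzero generator of the ray $\rho$. For $\sigma\in\Sigma(d)$, $U_\sigma$ is the submatrix with rows indexed by $\sigma(1)$. The universal adjoint is ${\rm Adj}_\Sigma(x)=\sum_{\sigma\in\Sigma(d)}|\det U_\sigma|\prod_{\rho\notin\sigma(1)}x_\rho$. $\mathbb{P}^{n-1}$ is complex projective space with homogeneous coordinates $x_\rho$, $\rho\in\Sigma(1)$; $\mathcal{A}_\Sigma=\{x\in\mathbb{P}^{n-1}:{\rm Adj}_\Sigma(x)=0\}$ and ${\rm Sing}(\mathcal{A}_\Sigma)=\{x\in\mathbb{P}^{n-1}:\partial{\rm Adj}_\Sigma/\partial x_\rho(x)=0\text{ for all }\rho\in\Sigma(1)\}$. The empty set has dimension $-1$. For $z\in\mathbb{R}^n$,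 $P_z=\{y\in\mathbb{R}^d:Uy+z\ge 0\}$ and $\Sigma_{P_z}$ is its inner normal fan. The deformation cone ${\rm Def}(\Sigma)\subset\mathbb{R}^n$ is the $n$-dimensional closed cone of those $z$ such that the piecewise linear function $\phi:\mathbb{R}^d\to\mathbb{R}$ which is linear on each cone of $\Sigma$ and satisfies $\phi(u_\rho)=z_\rho$ is convex; its interior is $\{z\in\mathbb{R}^n:\Sigma_{P_z}=\Sigma\}$. Warren's adjoint: for $z\in{\rm int}({\rm Def}(\Sigma))$, ${\rm adj}_{P_z}(y)$ is the polynomial in $y_1,\dots,y_d$ determined by $${\rm Vol}\big((P_z-y)^\circ\big)=\frac{{\rm adj}_{P_z}(y)}{\prod_{\rho\in\Sigma(1)}(u_\rho\cdot y+z_\rho)}\qquad\text{for all }y\in{\rm int}(P_z),$$ where $P_z-y$ is the translate, $K^\circ=\{u\in(\mathbb{R}^d)^\vee:u\cdot y'\ge -1\ \text{for all }y'\in K\}$ is the polar dual, and ${\rm Vol}$ is $d!$ times Lebesgue measure. "Generic $z$" means $z$ outside a proper Zariski-closed subset of $\mathbb{R}^n$. Smooth means that ${\rm adj}_{P_z}$ and all its first partial derivatives have no common zero in $\mathbb{C}^d$. *)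

theory Defs
  imports "HOL-Analysis.Analysis" "HOL-Library.Poly_Mapping"
begin

section \<open>Polynomials\<close>

text \<open>
  A polynomial in finitely many variables indexed by \<open>'n\<close> with coefficients in \<open>'a\<close> is a
  finitely supported map from exponent vectors to coefficients.
\<close>

type_synonym ('n, 'a) mpoly = "('n \<Rightarrow>\<^sub>0 nat) \<Rightarrow>\<^sub>0 'a"

definition poly_eval :: "('n::finite, 'a::comm_semiring_1) mpoly \<Rightarrow> 'a ^ 'n \<Rightarrow> 'a" where
  "poly_eval p x =
     (\<Sum>m\<in>Poly_Mapping.keys p. Poly_Mapping.lookup p m * (\<Prod>i\<in>UNIV. x $ i ^ Poly_Mapping.lookup m i))"

definition homogeneous :: "('n::finite, 'a::zero) mpoly \<Rightarrow> bool" where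
  "homogeneous p \<longleftrightarrow>
     (\<exists>k. \<forall>m\<in>Poly_Mapping.keys p. (\<Sum>i\<in>UNIV. Poly_Mapping.lookup m i) = k)"

definition complexify :: "('n, real) mpoly \<Rightarrow> ('n, complex) mpoly" where
  "complexify p = Poly_Mapping.map complex_of_real p"

definition zariski_closed :: "(('a::comm_semiring_1) ^ ('n::finite)) set \<Rightarrow> bool" where
  "zariski_closed Z \<longleftrightarrow>
     (\<exists>S :: ('n, 'a) mpoly set. Z = {z. \<forall>p\<in>S. poly_eval p z = 0})"

definition partial_deriv :: "'n \<Rightarrow> (complex ^ 'n \<Rightarrow> complex) \<Rightarrow> complex ^ ('n::finite) \<Rightarrow> complex" where
  "partial_deriv i F x = deriv (\<lambda>t. F (\<chi> j. if j = i then t else x $ j)) (x $ i)"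

definition smooth_hypersurface :: "(complex ^ ('n::finite) \<Rightarrow> complex) \<Rightarrow> bool" where
  "smooth_hypersurface F \<longleftrightarrow> \<not> (\<exists>y. F y = 0 \<and> (\<forall>i. partial_deriv i F y = 0))"

section \<open>Complex projective space\<close>

text \<open>
  Points of projective space with homogeneous coordinates indexed by \<open>'n\<close> are represented as
  the one-dimensional subspaces of \<open>complex ^ 'n\<close>.
\<close>

definition proj_point :: "complex ^ 'n \<Rightarrow> (complex ^ ('n::finite)) set" where
  "proj_point x = range (\<lambda>c. c *s x)"

definition proj_closed :: "(complex ^ ('n::finite)) set set \<Rightarrow> bool" where
  "proj_closed Z \<longleftrightarrow>
     (\<exists>S :: ('n, complex) mpoly set. (\<forall>p\<in>S. homogeneous p) \<and>
        Z = {proj_point x | x. x \<noteq> 0 \<and> (\<forall>p\<in>S. poly_eval p x = 0)})"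

definition proj_irreducible :: "(complex ^ ('n::finite)) set set \<Rightarrow> bool" where
  "proj_irreducible Z \<longleftrightarrow> proj_closed Z \<and> Z \<noteq> {} \<and>
     (\<forall>A B. proj_closed A \<and> proj_closed B \<and> Z = A \<union> B \<longrightarrow> Z = A \<or> Z = B)"

text \<open>
  Krull dimension of a Zariski closed set \<open>Z\<close>: the supremum of the lengths \<open>k\<close> of chains of
  \<open>k + 1\<close> irreducible closed subsets.  The element \<open>- 1\<close> only matters for the empty set.
\<close>

definition proj_dim :: "(complex ^ ('n::finite)) set set \<Rightarrow> ereal" where
  "proj_dim Z = Sup (insert (- 1) {ereal (real k) | k.
     \<exists>C :: nat \<Rightarrow> (complex ^ 'n) set set.
       (\<forall>i\<le>k. proj_irreducible (C i) \<and> C i \<subseteq> Z) \<and> (\<forall>i<k. C i \<subset> C (Suc i))})"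

section \<open>Polytopes, normal fans and ray matrices\<close>

text \<open>The dual space is identified with the space itself by means of the inner product.\<close>

definition simple_polytope :: "'a::euclidean_space set \<Rightarrow> bool" where
  "simple_polytope P \<longleftrightarrow> polytope P \<and>
     (\<forall>v. v extreme_point_of P \<longrightarrow> int (card {F. F facet_of P \<and> v \<in> F}) = aff_dim P)"

definition normal_cone :: "'a::euclidean_space set \<Rightarrow> 'a set \<Rightarrow> 'a set" where
  "normal_cone P F = {u. \<forall>x\<in>F. \<forall>y\<in>P. u \<bullet> x \<le> u \<bullet> y}"

definition normal_fan :: "'a::euclidean_space set \<Rightarrow> 'a set set" where
  "normal_fan P = {normal_cone P F | F. F face_of P \<and> F \<noteq> {}}"

definition cones_of_dim :: "'a::euclidean_space set set \<Rightarrow> nat \<Rightarrow> 'a set set" where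
  "cones_of_dim \<Sigma> k = {\<sigma> \<in> \<Sigma>. aff_dim \<sigma> = int k}"

text \<open>
  The rays are indexed by the type \<open>'n\<close>, so that the number of rays is \<open>CARD('n)\<close>.
\<close>

definition ray :: "real ^ ('d::finite) ^ ('n::finite) \<Rightarrow> 'n \<Rightarrow> (real ^ 'd) set" where
  "ray U i = cone hull {U $ i}"

definition ray_matrix :: "(real ^ ('d::finite)) set set \<Rightarrow> real ^ 'd ^ ('n::finite) \<Rightarrow> bool" where
  "ray_matrix \<Sigma> U \<longleftrightarrow> (\<forall>i. U $ i \<noteq> 0) \<and> bij_betw (ray U) UNIV (cones_of_dim \<Sigma> 1)"

definition rays_of :: "real ^ ('d::finite) ^ ('n::finite) \<Rightarrow> (real ^ 'd) set \<Rightarrow> 'n set" where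
  "rays_of U \<sigma> = {i. ray U i face_of \<sigma>}"

text \<open>
  The determinant of the square submatrix of \<open>U\<close> with rows \<open>rays_of U \<sigma>\<close>, in absolute value;
  the order in which the rows are enumerated does not affect the absolute value.
\<close>

definition abs_det_sub :: "real ^ ('d::finite) ^ ('n::finite) \<Rightarrow> (real ^ 'd) set \<Rightarrow> real" where
  "abs_det_sub U \<sigma> =
     (let e = (SOME e :: 'd \<Rightarrow> 'n. bij_betw e UNIV (rays_of U \<sigma>))
      in \<bar>det ((\<chi> j. U $ e j) :: real ^ 'd ^ 'd)\<bar>)"

section \<open>The universal adjoint\<close>

definition universal_adjoint ::
  "(real ^ ('d::finite)) set set \<Rightarrow> real ^ 'd ^ ('n::finite) \<Rightarrow> complex ^ 'n \<Rightarrow> complex" where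
  "universal_adjoint \<Sigma> U x =
     (\<Sum>\<sigma>\<in>cones_of_dim \<Sigma> CARD('d). complex_of_real (abs_det_sub U \<sigma>) * (\<Prod>i\<in>- rays_of U \<sigma>. x $ i))"

definition sing_locus ::
  "(real ^ ('d::finite)) set set \<Rightarrow> real ^ 'd ^ ('n::finite) \<Rightarrow> (complex ^ 'n) set set" where
  "sing_locus \<Sigma> U =
     {proj_point x | x. x \<noteq> 0 \<and> (\<forall>i. partial_deriv i (universal_adjoint \<Sigma> U) x = 0)}"

section \<open>Deformations and Warren's adjoint\<close>

definition deformed_polytope :: "real ^ ('d::finite) ^ ('n::finite) \<Rightarrow> real ^ 'n \<Rightarrow> (real ^ 'd) set" where
  "deformed_polytope U z = {y. \<forall>i. (U *v y + z) $ i \<ge> 0}"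

definition deformation_cone ::
  "(real ^ ('d::finite)) set set \<Rightarrow> real ^ 'd ^ ('n::finite) \<Rightarrow> (real ^ 'n) set" where
  "deformation_cone \<Sigma> U = {z. \<exists>\<phi> :: real ^ 'd \<Rightarrow> real.
     (\<forall>\<sigma>\<in>\<Sigma>. \<exists>f. linear f \<and> (\<forall>x\<in>\<sigma>. \<phi> x = f x)) \<and>
     (\<forall>i. \<phi> (U $ i) = z $ i) \<and> convex_on UNIV \<phi>}"

definition polar_dual :: "'a::euclidean_space set \<Rightarrow> 'a set" where
  "polar_dual K = {u. \<forall>x\<in>K. u \<bullet> x \<ge> - 1}"

definition norm_vol :: "'a::euclidean_space set \<Rightarrow> real" where
  "norm_vol K = fact DIM('a) * measure lebesgue K"

definition warren_adjoint :: "real ^ ('d::finite) ^ ('n::finite) \<Rightarrow> real ^ 'n \<Rightarrow> ('d, real) mpoly" where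
  "warren_adjoint U z = (THE p. \<forall>y\<in>interior (deformed_polytope U z).
     norm_vol (polar_dual ((\<lambda>w. w - y) ` deformed_polytope U z)) =
       poly_eval p y / (\<Prod>i\<in>UNIV. U $ i \<bullet> y + z $ i))"

end

theory Submission
  imports Defs "HOL-Computational_Algebra.Fundamental_Theorem_Algebra"
begin

text \<open>
  The polar dual of \<open>P\<^sub>z - y\<close> is cut by the maximal cones of the fan into simplices, which gives
  \<open>adj(y) = Adj(U y + z)\<close>; so one has to bound the parameters \<open>z\<close> for which the system
  \<open>Adj(U y + z) = 0\<close>, \<open>U\<^sup>T \<nabla>Adj(U y + z) = 0\<close> has a solution \<open>y\<close>.

  By the Nullstellensatz and Gaussian elimination over the field of rational functions in \<open>z\<close>, either
  these \<open>z\<close> lie on a hypersurface, or every \<open>z\<close> outside some countable union of hypersurfaces admits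
  a solution. In the second case \<open>z\<close> can be taken with coordinates algebraically independent over
  the field generated by \<open>U\<close> and the coefficients of \<open>Adj\<close>. A derivation of the complex numbers
  with value 1 at \<open>z\<^sub>j\<close> that kills this field and the other coordinates, applied to \<open>Adj(U y + z) = 0\<close>,
  yields \<open>\<partial>\<^sub>j Adj(U y + z) = 0\<close>: the solutions come from the singular locus. On the other hand, generic
  linear sections through the column space of \<open>U\<close> cut any chain of irreducible closed subsets of
  the singular locus down by one each, so the dimension hypothesis produces a generic \<open>z\<close> for which
  \<open>z + im U\<close> misses the singular locus.
\<close>

section \<open>Polynomials and polynomial functions\<close>

text \<open>The exceptional set must be a single proper closed set, whereas algebraic independence
  of \<open>z\<close> excludes countably many hypersurfaces. The bridge: a Nullstellensatz
  certificate with prescribed monomials solves a linear system whose coefficients are polynomial in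
  \<open>z\<close>. Such a system is generically solvable or generically unsolvable, so a
  certificate at one very general point gives certificates off one hypersurface. Uncountability of
  the complex numbers enters twice, in the Nullstellensatz and in the choice of that point.

  The constant n - d - 1 counts sections: the image of \<open>U\<close> has codimension n - d, and
  one coordinate of the quotient serves as denominator for ratios prescribed on the others. Fixing n
  - d - 1 ratios exhausts all chains in the singular locus that start off the zero set of the
  denominator, and the parameter is taken with nonzero denominator.

  The hypersurface is found in complex parameter space; it stays proper over the reals because real
  points are Zariski dense.\<close>

abbreviation mconst :: "'a \<Rightarrow> ('n, 'a::comm_ring_1) mpoly" where
  "mconst \<equiv> Poly_Mapping.single 0"

abbreviation mvar :: "'n \<Rightarrow> ('n, 'a::comm_ring_1) mpoly" where
  "mvar i \<equiv> Poly_Mapping.single (Poly_Mapping.single i 1) 1"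

definition mono_eval :: "('n \<Rightarrow>\<^sub>0 nat) \<Rightarrow> 'a::comm_semiring_1 ^ ('n::finite) \<Rightarrow> 'a" where
  "mono_eval m x = (\<Prod>i\<in>UNIV. x $ i ^ Poly_Mapping.lookup m i)"

lemma mono_eval_add: "mono_eval (m + m') x = mono_eval m x * mono_eval m' x"
  by (simp add: mono_eval_def lookup_add power_add prod.distrib)

lemma mono_eval_0 [simp]: "mono_eval 0 x = 1"
  by (simp add: mono_eval_def)

lemma mono_eval_single [simp]: "mono_eval (Poly_Mapping.single i 1) x = x $ i"
proof -
  have "mono_eval (Poly_Mapping.single i 1) x = (\<Prod>j\<in>UNIV. if j = i then x $ j else 1)"
    unfolding mono_eval_def by (intro prod.cong) (auto simp: lookup_single when_def)
  then show ?thesis by simp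
qed

lemmas mono_eval_single_Suc [simp] = mono_eval_single[unfolded One_nat_def]

lemma poly_eval_superset:
  assumes "finite K" "Poly_Mapping.keys p \<subseteq> K"
  shows "poly_eval p x = (\<Sum>m\<in>K. Poly_Mapping.lookup p m * mono_eval m x)"
  unfolding poly_eval_def mono_eval_def
  by (rule sum.mono_neutral_left) (use assms in \<open>auto simp: in_keys_iff\<close>)

lemma poly_eval_0 [simp]: "poly_eval 0 x = 0"
  by (simp add: poly_eval_def)

lemma poly_eval_add: "poly_eval (p + q) x = poly_eval p x + poly_eval q x"
proof -
  let ?K = "Poly_Mapping.keys p \<union> Poly_Mapping.keys q"
  have fin: "finite ?K" by simp
  have sub: "Poly_Mapping.keys (p + q) \<subseteq> ?K" by (rule keys_add)
  show ?thesis
    using poly_eval_superset[OF fin sub, of x]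
      poly_eval_superset[OF fin, of p x] poly_eval_superset[OF fin, of q x]
    by (simp add: lookup_add algebra_simps sum.distrib)
qed

lemma poly_eval_sum: "poly_eval (sum f A) x = (\<Sum>a\<in>A. poly_eval (f a) x)"
  by (induction A rule: infinite_finite_induct) (auto simp: poly_eval_add)

lemma poly_eval_single: "poly_eval (Poly_Mapping.single m c) x = c * mono_eval m x"
  using poly_eval_superset[of "{m}" "Poly_Mapping.single m c" x] by simp

lemma mpoly_expand: "p = (\<Sum>m\<in>Poly_Mapping.keys p. Poly_Mapping.single m (Poly_Mapping.lookup p m))"
proof (rule poly_mapping_eqI)
  fix k
  show "Poly_Mapping.lookup p k =
      Poly_Mapping.lookup (\<Sum>m\<in>Poly_Mapping.keys p. Poly_Mapping.single m (Poly_Mapping.lookup p m)) k"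
    by (auto simp: lookup_sum lookup_single when_def in_keys_iff)
qed

lemma poly_eval_mult:
  fixes p :: "('n::finite, 'a::comm_ring_1) mpoly"
  shows "poly_eval (p * q) x = poly_eval p x * poly_eval q x"
proof -
  let ?s = "\<lambda>p. (\<Sum>m\<in>Poly_Mapping.keys p. Poly_Mapping.single m (Poly_Mapping.lookup p m)) :: ('n, 'a) mpoly"
  have "poly_eval (p * q) x = poly_eval (?s p * ?s q) x"
    using mpoly_expand[of p] mpoly_expand[of q] by simp
  also have "\<dots> = poly_eval (?s p) x * poly_eval (?s q) x"
    by (simp add: sum_product poly_eval_sum poly_eval_single mult_single mono_eval_add ac_simps)
  finally show ?thesis
    using mpoly_expand[of p] mpoly_expand[of q] by simp
qed

lemma poly_eval_mconst [simp]: "poly_eval (mconst c) x = c"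
  by (simp add: poly_eval_single)

lemma poly_eval_1 [simp]: "poly_eval 1 (x :: 'a::comm_ring_1 ^ 'n::finite) = 1"
  by (metis poly_eval_mconst single_one)

lemma poly_eval_mvar [simp]: "poly_eval (mvar i) x = x $ i"
  by (simp add: poly_eval_single)

lemmas poly_eval_mvar_Suc [simp] = poly_eval_mvar[unfolded One_nat_def]

lemma poly_eval_uminus: "poly_eval (- p) x = - poly_eval (p :: ('n::finite, 'a::comm_ring_1) mpoly) x"
  using poly_eval_add[of p "- p" x] by (simp add: add_eq_0_iff2 minus_equation_iff)

lemma poly_eval_diff:
  "poly_eval (p - q) x = poly_eval p x - poly_eval (q :: ('n::finite, 'a::comm_ring_1) mpoly) x"
  using poly_eval_add[of p "- q" x] by (simp add: poly_eval_uminus)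

text \<open>Constants and variables generate the ring: powers, monomials, terms and finite sums are
  built from them in this order.\<close>

lemma mpoly_induct [case_names const var add mult]:
  fixes p :: "('n::finite, 'a::comm_ring_1) mpoly"
  assumes const: "\<And>c. Q (mconst c)" and var: "\<And>i. Q (mvar i)"
    and add: "\<And>p q. Q p \<Longrightarrow> Q q \<Longrightarrow> Q (p + q)" and mult: "\<And>p q. Q p \<Longrightarrow> Q q \<Longrightarrow> Q (p * q)"
  shows "Q p"
proof -
  have pow: "Q (Poly_Mapping.single (Poly_Mapping.single i k) 1)" for i k
  proof (induction k)
    case 0
    then show ?case using const[of 1] by simp
  next
    case (Suc k)
    have "Poly_Mapping.single (Poly_Mapping.single i (Suc k)) (1::'a) =
        Poly_Mapping.single (Poly_Mapping.single i k) 1 * mvar i"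
      by (simp add: mult_single flip: single_add)
    then show ?case using mult[OF Suc var] by simp
  qed
  have mon: "Q (Poly_Mapping.single m 1)" if "finite K" "Poly_Mapping.keys m \<subseteq> K" for m and K :: "'n set"
    using that
  proof (induction K arbitrary: m rule: finite_induct)
    case empty
    then have "m = 0" by simp
    then show ?case using const[of 1] by simp
  next
    case (insert i K)
    define m' where "m' = Poly_Mapping.update i 0 m"
    have m: "m = Poly_Mapping.single i (Poly_Mapping.lookup m i) + m'"
      by (rule poly_mapping_eqI) (auto simp: m'_def lookup_update lookup_add lookup_single when_def)
    have "Poly_Mapping.keys m' \<subseteq> K"
      using insert.prems unfolding m'_def
      by (auto simp: keys_update)
    then have "Q (Poly_Mapping.single m' 1)" by (rule insert.IH)
    then have "Q (Poly_Mapping.single (Poly_Mapping.single i (Poly_Mapping.lookup m i)) 1 * Poly_Mapping.single m' 1)"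
      by (intro mult pow)
    then show ?case using m by (simp add: mult_single)
  qed
  have mon': "Q (Poly_Mapping.single m c)" for m c
    using mult[OF const[of c] mon[of "Poly_Mapping.keys m" m]] by (simp add: mult_single)
  have "Q (\<Sum>m\<in>K. Poly_Mapping.single m (Poly_Mapping.lookup p m))" if "finite K" for K
    using that by (induction K rule: finite_induct) (use const[of 0] add mon' in \<open>auto\<close>)
  then show ?thesis by (subst mpoly_expand) simp
qed

text \<open>Polynomial maps are kept as functions, so that substitution and restriction to a line
  are plain compositions, handled by induction.\<close>

inductive polyfun :: "('a::comm_ring_1 ^ ('n::finite) \<Rightarrow> 'a) \<Rightarrow> bool" where
  const: "polyfun (\<lambda>x. c)"
| var: "polyfun (\<lambda>x. x $ i)"
| add: "polyfun f \<Longrightarrow> polyfun g \<Longrightarrow> polyfun (\<lambda>x. f x + g x)"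
| mult: "polyfun f \<Longrightarrow> polyfun g \<Longrightarrow> polyfun (\<lambda>x. f x * g x)"

lemma polyfun_iff:
  fixes f :: "'a::comm_ring_1 ^ 'n::finite \<Rightarrow> 'a"
  shows "polyfun f \<longleftrightarrow> (\<exists>p. f = poly_eval p)"
proof
  assume "polyfun f"
  then show "\<exists>p. f = poly_eval p"
  proof induction
    case (const c)
    then show ?case by (intro exI[of _ "mconst c"]) auto
  next
    case (var i)
    show ?case by (intro exI[of _ "mvar i"] ext) (simp only: poly_eval_mvar)
  next
    case (add f g)
    then obtain p q where "f = poly_eval p" "g = poly_eval q" by auto
    then show ?case by (intro exI[of _ "p + q"]) (auto simp: poly_eval_add)
  next
    case (mult f g)
    then obtain p q where "f = poly_eval p" "g = poly_eval q" by auto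
    then show ?case by (intro exI[of _ "p * q"]) (auto simp: poly_eval_mult)
  qed
next
  have "polyfun (poly_eval p)" for p :: "('n, 'a) mpoly"
  proof (induction p rule: mpoly_induct)
    case (const c)
    have "poly_eval (mconst c) = (\<lambda>x :: 'a ^ 'n. c)" by (simp add: fun_eq_iff)
    then show ?case using polyfun.const[of c] by simp
  next
    case (var i)
    have "poly_eval (mvar i) = (\<lambda>x :: 'a ^ 'n. x $ i)" by (simp add: fun_eq_iff)
    then show ?case using polyfun.var[of i] by simp
  next
    case (add p q)
    have "poly_eval (p + q) = (\<lambda>x. poly_eval p x + poly_eval q x)"
      by (simp add: fun_eq_iff poly_eval_add)
    then show ?case using polyfun.add[OF add] by simp
  next
    case (mult p q)
    have "poly_eval (p * q) = (\<lambda>x. poly_eval p x * poly_eval q x)"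
      by (simp add: fun_eq_iff poly_eval_mult)
    then show ?case using polyfun.mult[OF mult] by simp
  qed
  then show "\<exists>p. f = poly_eval p \<Longrightarrow> polyfun f" by auto
qed

lemma polyfun_sum:
  "(\<And>i. i \<in> A \<Longrightarrow> polyfun (f i)) \<Longrightarrow> polyfun (\<lambda>x. \<Sum>i\<in>A. f i x)"
  by (induction A rule: infinite_finite_induct) (auto intro: polyfun.intros)

lemma polyfun_prod:
  "(\<And>i. i \<in> A \<Longrightarrow> polyfun (f i)) \<Longrightarrow> polyfun (\<lambda>x. \<Prod>i\<in>A. f i x)"
  by (induction A rule: infinite_finite_induct) (auto intro: polyfun.intros)

lemma polyfun_diff:
  assumes "polyfun f" "polyfun g" shows "polyfun (\<lambda>x. f x - g x)"
  using polyfun.add[OF assms(1) polyfun.mult[OF polyfun.const[of "-1"] assms(2)]] by simp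

lemma polyfun_compose:
  fixes f :: "'a::comm_ring_1 ^ 'n::finite \<Rightarrow> 'a" and h :: "'a ^ 'm::finite \<Rightarrow> 'a ^ 'n"
  assumes "polyfun f" and "\<And>i. polyfun (\<lambda>x. h x $ i)"
  shows "polyfun (\<lambda>x. f (h x))"
  using assms(1) by induction (auto intro: assms(2) polyfun.intros)

lemma polyfun_matrix_vector:
  "(\<And>i. polyfun (\<lambda>x. h x $ i)) \<Longrightarrow> polyfun (\<lambda>x. (A *v h x) $ i)"
  unfolding matrix_vector_mult_def by (simp, intro polyfun_sum polyfun.mult polyfun.const)

lemma polyfun_line:
  fixes f :: "'a::comm_ring_1 ^ 'n::finite \<Rightarrow> 'a"
  assumes "polyfun f"
  shows "\<exists>p. \<forall>t. f (x + t *s v) = poly p t"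
  using assms
proof induction
  case (const c)
  then show ?case by (intro exI[of _ "[:c:]"]) auto
next
  case (var i)
  then show ?case by (intro exI[of _ "[:x $ i, v $ i:]"]) (auto simp: algebra_simps)
next
  case (add f g)
  then obtain p q where "\<forall>t. f (x + t *s v) = poly p t" "\<forall>t. g (x + t *s v) = poly q t" by auto
  then show ?case by (intro exI[of _ "p + q"]) auto
next
  case (mult f g)
  then obtain p q where "\<forall>t. f (x + t *s v) = poly p t" "\<forall>t. g (x + t *s v) = poly q t" by auto
  then show ?case by (intro exI[of _ "p * q"]) auto
qed

text \<open>On a line a polynomial function is a univariate polynomial, nonzero by its value at
  \<open>s\<close>. Most arguments that pick a generic point go back to this finiteness.\<close>

lemma polyfun_line_finite:
  fixes f :: "'a::{comm_ring_1,ring_no_zero_divisors} ^ 'n::finite \<Rightarrow> 'a"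
  assumes "polyfun f" "f (x + s *s v) \<noteq> 0"
  shows "finite {t. f (x + t *s v) = 0}"
proof -
  obtain p where p: "\<forall>t. f (x + t *s v) = poly p t" using polyfun_line[OF assms(1)] by blast
  then have "p \<noteq> 0" using assms(2) by auto
  then show ?thesis using poly_roots_finite[of p] p by simp
qed

text \<open>On the line from \<open>a\<close> to \<open>b\<close> the first factor is nonzero at
  parameter 0 and the second at parameter 1, so each has finitely many roots there, and an infinite
  field contains a parameter that avoids both.\<close>

lemma polyfun_mult_nonzero:
  fixes f g :: "'a::field_char_0 ^ 'n::finite \<Rightarrow> 'a"
  assumes "polyfun f" "polyfun g" "f a \<noteq> 0" "g b \<noteq> 0"
  shows "\<exists>t. f (a + t *s (b - a)) * g (a + t *s (b - a)) \<noteq> 0"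
proof -
  have "finite {t. f (a + t *s (b - a)) = 0}"
    by (rule polyfun_line_finite[where s = 0]) (use assms in auto)
  moreover have "finite {t. g (a + t *s (b - a)) = 0}"
    by (rule polyfun_line_finite[where s = 1]) (use assms in auto)
  ultimately have "finite ({t. f (a + t *s (b - a)) = 0} \<union> {t. g (a + t *s (b - a)) = 0})" by simp
  then obtain t where "t \<notin> {t. f (a + t *s (b - a)) = 0} \<union> {t. g (a + t *s (b - a)) = 0}"
    using ex_new_if_finite[OF infinite_UNIV_char_0] by blast
  then show ?thesis by auto
qed

text \<open>Coordinates are released from the grid one at a time: in direction \<open>k\<close> the
  function vanishes for infinitely many parameters, hence on the whole line.\<close>

lemma polyfun_zero_grid:
  fixes f :: "'a::{comm_ring_1,ring_no_zero_divisors} ^ 'n::finite \<Rightarrow> 'a"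
  assumes "polyfun f" "infinite A" "\<And>x. (\<forall>i. x $ i \<in> A) \<Longrightarrow> f x = 0"
  shows "f x = 0"
proof -
  have "\<forall>x. (\<forall>i. i \<notin> K \<longrightarrow> x $ i \<in> A) \<longrightarrow> f x = 0" if "finite K" for K :: "'n set"
    using that
  proof (induction K rule: finite_induct)
    case empty
    then show ?case using assms(3) by auto
  next
    case (insert k K)
    show ?case
    proof (intro allI impI)
      fix x :: "'a ^ 'n"
      assume x: "\<forall>i. i \<notin> insert k K \<longrightarrow> x $ i \<in> A"
      show "f x = 0"
      proof (rule ccontr)
        assume "f x \<noteq> 0"
        then have "finite {t. f (x + t *s axis k 1) = 0}"
          by (intro polyfun_line_finite[where s = 0, OF assms(1)]) auto
        moreover have "f (x + t *s axis k 1) = 0" if "x $ k + t \<in> A" for t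
          using insert.IH x that by (auto simp: axis_def)
        from this[of "a - x $ k" for a] have "(\<lambda>a. a - x $ k) ` A \<subseteq> {t. f (x + t *s axis k 1) = 0}"
          by (auto simp del: vector_sub_rdistrib)
        ultimately have "finite ((\<lambda>a. a - x $ k) ` A)" by (rule rev_finite_subset)
        then show False using assms(2) by (auto dest!: finite_imageD simp: inj_on_def)
      qed
    qed
  qed
  from this[of UNIV] show ?thesis by simp
qed

lemma poly_eval_inj:
  fixes p q :: "('n::finite, real) mpoly"
  assumes "\<And>x. poly_eval p x = poly_eval q x"
  shows "p = q"
proof -
  text \<open>Distinct monomials are linearly independent by Dedekind's argument: doubling one coordinate
    yields a second linear relation, which shortens the first.\<close>
  have *: "\<forall>m\<in>K. c m = 0"
    if "finite K" "\<forall>x :: real ^ 'n. (\<Sum>m\<in>K. c m * mono_eval m x) = 0" for K c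
    using that
  proof (induction K arbitrary: c rule: finite_induct)
    case empty
    then show ?case by simp
  next
    case (insert m1 K)
    have "c m = 0" if "m \<in> K" for m
    proof -
      have "m \<noteq> m1" using that insert.hyps by auto
      then obtain i where i: "Poly_Mapping.lookup m i \<noteq> Poly_Mapping.lookup m1 i"
        by (metis poly_mapping_eqI)
      have dbl: "mono_eval m' (\<chi> j. if j = i then 2 * x $ j else x $ j) =
          2 ^ Poly_Mapping.lookup m' i * mono_eval m' x" for m' and x :: "real ^ 'n"
      proof -
        have "mono_eval m' (\<chi> j. if j = i then 2 * x $ j else x $ j) =
          (\<Prod>j\<in>UNIV. (if j = i then 2 ^ Poly_Mapping.lookup m' j else 1) * x $ j ^ Poly_Mapping.lookup m' j)"
          unfolding mono_eval_def by (intro prod.cong) (auto simp: power_mult_distrib)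
        then show ?thesis by (simp add: prod.distrib mono_eval_def)
      qed
      have "(\<Sum>m\<in>K. (c m * (2 ^ Poly_Mapping.lookup m i - 2 ^ Poly_Mapping.lookup m1 i)) * mono_eval m x) = 0" for x
      proof -
        have "(\<Sum>m\<in>insert m1 K. c m * (2 ^ Poly_Mapping.lookup m i * mono_eval m x)) = 0"
          using insert.prems[rule_format, of "\<chi> j. if j = i then 2 * x $ j else x $ j"]
          unfolding dbl .
        moreover have "2 ^ Poly_Mapping.lookup m1 i * (\<Sum>m\<in>insert m1 K. c m * mono_eval m x) = 0"
          using insert.prems by simp
        ultimately have "(\<Sum>m\<in>insert m1 K. c m * (2 ^ Poly_Mapping.lookup m i * mono_eval m x)) -
            2 ^ Poly_Mapping.lookup m1 i * (\<Sum>m\<in>insert m1 K. c m * mono_eval m x) = 0" by simp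
        then show ?thesis using insert.hyps
          by (simp add: algebra_simps sum_distrib_left sum_subtractf)
      qed
      then have "c m * (2 ^ Poly_Mapping.lookup m i - 2 ^ Poly_Mapping.lookup m1 i) = 0"
        using insert.IH[of "\<lambda>m. c m * (2 ^ Poly_Mapping.lookup m i - 2 ^ Poly_Mapping.lookup m1 i)"] that
        by blast
      then show ?thesis using i by simp
    qed
    \<comment> \<open>With the other coefficients gone, the all-ones vector, where every monomial
      equals 1, isolates \<open>c m1\<close>.\<close>
    moreover from this have "c m1 * mono_eval m1 ((\<chi> j. 1) :: real ^ 'n) = 0"
      using insert.prems[rule_format, of "\<chi> j. 1"] insert.hyps by simp
    then have "c m1 = 0" by (simp add: mono_eval_def)
    ultimately show ?case by auto
  qed
  have "poly_eval (p - q) x = 0" for x using assms by (simp add: poly_eval_diff)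
  then have "\<forall>x :: real ^ 'n. (\<Sum>m\<in>Poly_Mapping.keys (p - q). Poly_Mapping.lookup (p - q) m * mono_eval m x) = 0"
    using poly_eval_superset[of "Poly_Mapping.keys (p - q)" "p - q"] by simp
  then have "\<forall>m\<in>Poly_Mapping.keys (p - q). Poly_Mapping.lookup (p - q) m = 0"
    by (intro *) auto
  then have "Poly_Mapping.lookup (p - q) m = 0" for m by (auto simp: in_keys_iff)
  then have "p - q = 0" by (intro poly_mapping_eqI) simp
  then show ?thesis by simp
qed

section \<open>Hilbert's basis theorem\<close>

text \<open>Rings are subsets of one ambient ring. Adjoining an element then does not change the
  type, which makes Hilbert's basis theorem an induction on the variables.\<close>

definition subring_set :: "'r::comm_ring_1 set \<Rightarrow> bool" where
  "subring_set A \<longleftrightarrow> 1 \<in> A \<and> (\<forall>x\<in>A. \<forall>y\<in>A. x - y \<in> A \<and> x * y \<in> A)"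

lemma subring_setD:
  assumes "subring_set A"
  shows subring_set_1: "1 \<in> A" and subring_set_0: "0 \<in> A"
    and subring_set_diff: "x \<in> A \<Longrightarrow> y \<in> A \<Longrightarrow> x - y \<in> A"
    and subring_set_mult: "x \<in> A \<Longrightarrow> y \<in> A \<Longrightarrow> x * y \<in> A"
    and subring_set_add: "x \<in> A \<Longrightarrow> y \<in> A \<Longrightarrow> x + y \<in> A"
    and subring_set_uminus: "x \<in> A \<Longrightarrow> - x \<in> A"
proof -
  have d: "x \<in> A \<Longrightarrow> y \<in> A \<Longrightarrow> x - y \<in> A" for x y using assms by (simp add: subring_set_def)
  show "1 \<in> A" using assms by (simp add: subring_set_def)
  then show z: "0 \<in> A" using d[of 1 1] by simp
  show m: "x \<in> A \<Longrightarrow> - x \<in> A" for x using d[OF z, of x] by simp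
  show "x \<in> A \<Longrightarrow> y \<in> A \<Longrightarrow> x + y \<in> A" using d[of x "- y"] m[of y] by simp
  show "x \<in> A \<Longrightarrow> y \<in> A \<Longrightarrow> x * y \<in> A" using assms by (simp add: subring_set_def)
  show "x \<in> A \<Longrightarrow> y \<in> A \<Longrightarrow> x - y \<in> A" by (rule d)
qed

lemma subring_set_sum:
  assumes "subring_set A" "\<And>i. i \<in> I \<Longrightarrow> f i \<in> A" shows "sum f I \<in> A"
  using assms(2)
  by (induction I rule: infinite_finite_induct) (auto intro: subring_setD[OF assms(1)])

lemma subring_set_prod:
  assumes "subring_set A" "\<And>i. i \<in> I \<Longrightarrow> f i \<in> A" shows "prod f I \<in> A"
  using assms(2)
  by (induction I rule: infinite_finite_induct) (auto intro: subring_setD[OF assms(1)])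

definition ideal_of :: "'r::comm_ring_1 set \<Rightarrow> 'r set \<Rightarrow> bool" where
  "ideal_of A I \<longleftrightarrow> I \<subseteq> A \<and> 0 \<in> I \<and> (\<forall>x\<in>I. \<forall>y\<in>I. x + y \<in> I) \<and> (\<forall>a\<in>A. \<forall>x\<in>I. a * x \<in> I)"

lemma ideal_ofD:
  assumes "ideal_of A I"
  shows "x \<in> I \<Longrightarrow> x \<in> A" "0 \<in> I" "x \<in> I \<Longrightarrow> y \<in> I \<Longrightarrow> x + y \<in> I" "a \<in> A \<Longrightarrow> x \<in> I \<Longrightarrow> a * x \<in> I"
  using assms by (auto simp: ideal_of_def)

lemma ideal_of_sum:
  assumes "ideal_of A I" "\<And>i. i \<in> J \<Longrightarrow> f i \<in> I" shows "sum f J \<in> I"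
  using assms(2)
  by (induction J rule: infinite_finite_induct) (auto intro: ideal_ofD[OF assms(1)])

lemma ideal_of_diff:
  assumes "subring_set A" "ideal_of A I" "x \<in> I" "y \<in> I" shows "x - y \<in> I"
proof -
  have "-1 \<in> A" using subring_set_uminus[OF assms(1) subring_set_1[OF assms(1)]] .
  then have "x + (-1) * y \<in> I" using assms(3,4) by (intro ideal_ofD(3,4)[OF assms(2)])
  then show ?thesis by simp
qed

text \<open>That \<open>S\<close> generates \<open>I\<close> is expressed by comparing
  \<open>I\<close> with all ideals above \<open>S\<close>, without naming the generated
  ideal.\<close>

definition noetherian :: "'r::comm_ring_1 set \<Rightarrow> bool" where
  "noetherian A \<longleftrightarrow> subring_set A \<and> (\<forall>I. ideal_of A I \<longrightarrow>
     (\<exists>S\<subseteq>I. finite S \<and> (\<forall>J. ideal_of A J \<and> S \<subseteq> J \<longrightarrow> I \<subseteq> J)))"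

text \<open>The ascending chain condition in the form applied to leading coefficients: the union of
  the ideals \<open>L N\<close> spanned by the first \<open>N\<close> terms is finitely generated,
  so it equals some \<open>L N\<close>, which then contains \<open>a N\<close>.\<close>

lemma noetherian_seq:
  fixes a :: "nat \<Rightarrow> 'r::comm_ring_1"
  assumes "noetherian A" "\<And>n. a n \<in> A"
  shows "\<exists>N r. (\<forall>i<N. r i \<in> A) \<and> a N = (\<Sum>i<N. r i * a i)"
proof -
  have sub: "subring_set A" using assms(1) by (simp add: noetherian_def)
  define L where "L N = {\<Sum>i<N. r i * a i | r. \<forall>i<N. r i \<in> A}" for N
  have LI: "ideal_of A (L N)" for N
    unfolding ideal_of_def
  proof (intro conjI ballI)
    show "L N \<subseteq> A"
      using assms(2) by (auto simp: L_def intro!: subring_set_sum[OF sub] subring_set_mult[OF sub])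
    show "0 \<in> L N"
      unfolding L_def by (intro CollectI exI[of _ "\<lambda>_. 0"]) (auto simp: subring_set_0[OF sub])
  next
    fix x y assume "x \<in> L N" "y \<in> L N"
    then obtain r s where "\<forall>i<N. r i \<in> A" "x = (\<Sum>i<N. r i * a i)" "\<forall>i<N. s i \<in> A" "y = (\<Sum>i<N. s i * a i)"
      unfolding L_def by auto
    then show "x + y \<in> L N" unfolding L_def
      by (intro CollectI exI[of _ "\<lambda>i. r i + s i"])
        (auto simp: algebra_simps sum.distrib intro: subring_set_add[OF sub])
  next
    fix b x assume "b \<in> A" "x \<in> L N"
    then obtain r where "\<forall>i<N. r i \<in> A" "x = (\<Sum>i<N. r i * a i)" unfolding L_def by auto
    then show "b * x \<in> L N" unfolding L_def using \<open>b \<in> A\<close>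
      by (intro CollectI exI[of _ "\<lambda>i. b * r i"])
        (auto simp: sum_distrib_left mult.assoc intro: subring_set_mult[OF sub])
  qed
  have mono: "L N \<subseteq> L M" if "N \<le> M" for N M
  proof
    fix x assume "x \<in> L N"
    then obtain r where r: "\<forall>i<N. r i \<in> A" "x = (\<Sum>i<N. r i * a i)" unfolding L_def by auto
    have "x = (\<Sum>i<M. (if i < N then r i else 0) * a i)"
      unfolding r(2) using that by (intro sum.mono_neutral_cong_left) auto
    then show "x \<in> L M" unfolding L_def using r(1) subring_set_0[OF sub]
      by (intro CollectI exI[of _ "\<lambda>i. if i < N then r i else 0"]) auto
  qed
  have UI: "ideal_of A (\<Union>N. L N)"
    unfolding ideal_of_def
  proof (intro conjI ballI)
    show "(\<Union>N. L N) \<subseteq> A" using ideal_ofD(1)[OF LI] by blast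
    show "0 \<in> (\<Union>N. L N)" using ideal_ofD(2)[OF LI] by blast
  next
    fix x y assume "x \<in> (\<Union>N. L N)" "y \<in> (\<Union>N. L N)"
    then obtain N M where "x \<in> L N" "y \<in> L M" by auto
    then have "x \<in> L (max N M)" "y \<in> L (max N M)" using mono[of N "max N M"] mono[of M "max N M"] by auto
    then show "x + y \<in> (\<Union>N. L N)" using ideal_ofD(3)[OF LI] by blast
  next
    fix b x assume "b \<in> A" "x \<in> (\<Union>N. L N)"
    then show "b * x \<in> (\<Union>N. L N)" using ideal_ofD(4)[OF LI] by blast
  qed
  then obtain S where S: "S \<subseteq> (\<Union>N. L N)" "finite S" "\<forall>J. ideal_of A J \<and> S \<subseteq> J \<longrightarrow> (\<Union>N. L N) \<subseteq> J"
    using assms(1) unfolding noetherian_def by meson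
  have "\<exists>N. S \<subseteq> L N"
    using S(2,1)
  proof (induction S rule: finite_induct)
    case (insert s S)
    then obtain N M where "s \<in> L N" "S \<subseteq> L M" by auto
    then show ?case using mono[of N "max N M"] mono[of M "max N M"] by (intro exI[of _ "max N M"]) auto
  qed auto
  then obtain N where "S \<subseteq> L N" by blast
  then have "L (Suc N) \<subseteq> L N" using S(3) LI[of N] by blast
  moreover have "a N \<in> L (Suc N)" unfolding L_def
    using subring_set_0[OF sub] subring_set_1[OF sub]
    by (intro CollectI exI[of _ "\<lambda>i. if i = N then 1 else 0"]) auto
  ultimately have "a N \<in> L N" by blast
  then show ?thesis unfolding L_def by blast
qed

text \<open>Hilbert's basis theorem for A[x] with an arbitrary element \<open>x\<close>: polynomials
  over \<open>A\<close> represent elements, and only their values at \<open>x\<close> are tested for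
  membership. If \<open>I\<close> is not finitely generated, pick again and again a representative
  of least degree whose value lies in \<open>I\<close> but not in the ideal of the earlier values.
  Once a leading coefficient is a combination of earlier ones, subtraction contradicts
  minimality.\<close>

lemma noetherian_adjoin:
  fixes A :: "'r::comm_ring_1 set" and x :: 'r
  assumes noeth: "noetherian A"
  defines "B \<equiv> {poly p x | p. \<forall>i. coeff p i \<in> A}"
  shows "noetherian B" "A \<subseteq> B" "x \<in> B"
proof -
  have sub: "subring_set A" using noeth by (simp add: noetherian_def)
  note AD = subring_setD[OF sub]
  show "A \<subseteq> B"
  proof
    fix a assume "a \<in> A"
    then have "\<forall>i. coeff [:a:] i \<in> A" using AD by (auto simp: coeff_pCons split: nat.split)
    then show "a \<in> B" unfolding B_def by (intro CollectI exI[of _ "[:a:]"]) auto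
  qed
  have "\<forall>i. coeff [:0, 1 :: 'r:] i \<in> A" using AD by (auto simp: coeff_pCons split: nat.split)
  then show "x \<in> B" unfolding B_def by (intro CollectI exI[of _ "[:0, 1:]"]) auto
  have mul: "\<forall>i. coeff (p * q) i \<in> A" if "\<forall>i. coeff p i \<in> A" "\<forall>i. coeff q i \<in> A" for p q :: "'r poly"
    using that by (auto simp: coeff_mult intro!: subring_set_sum[OF sub] AD)
  have subB: "subring_set B" unfolding subring_set_def
  proof (intro conjI ballI)
    show "1 \<in> B" using \<open>A \<subseteq> B\<close> AD(1) by auto
    fix a b assume "a \<in> B" "b \<in> B"
    then obtain p q where pq: "\<forall>i. coeff p i \<in> A" "a = poly p x" "\<forall>i. coeff q i \<in> A" "b = poly q x"
      unfolding B_def by auto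
    show "a - b \<in> B" unfolding B_def using pq AD by (intro CollectI exI[of _ "p - q"]) auto
    show "a * b \<in> B" unfolding B_def using pq mul[OF pq(1,3)] by (intro CollectI exI[of _ "p * q"]) auto
  qed
  show "noetherian B" unfolding noetherian_def
  proof (intro conjI allI impI subB, rule ccontr)
    fix I assume I: "ideal_of B I"
      and no: "\<not> (\<exists>S\<subseteq>I. finite S \<and> (\<forall>J. ideal_of B J \<and> S \<subseteq> J \<longrightarrow> I \<subseteq> J))"
    define gen where "gen S = \<Inter> {J. ideal_of B J \<and> S \<subseteq> J}" for S
    have genI: "ideal_of B J \<Longrightarrow> S \<subseteq> J \<Longrightarrow> gen S \<subseteq> J" for S J unfolding gen_def by auto
    have gen_sub: "gen S \<subseteq> gen T" if "S \<subseteq> T" for S T using that unfolding gen_def by auto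
    define K where "K h n p \<longleftrightarrow> (\<forall>i. coeff p i \<in> A) \<and> poly p x \<in> I \<and> poly p x \<notin> gen ((\<lambda>i. poly (h i) x) ` {..<n})"
      for h :: "nat \<Rightarrow> 'r poly" and n :: nat and p
    have "\<exists>h. \<forall>n. K h n (h n) \<and> (\<forall>q. K h n q \<longrightarrow> degree (h n) \<le> degree q)"
    proof (rule dependent_wellorder_choice)
      fix r :: "'r poly" and f g :: "nat \<Rightarrow> 'r poly" and n :: nat
      assume "\<And>y. y < n \<Longrightarrow> f y = g y"
      then have "(\<lambda>i. poly (f i) x) ` {..<n} = (\<lambda>i. poly (g i) x) ` {..<n}" by (intro image_cong) auto
      then have "K f n = K g n" unfolding K_def by (auto simp: fun_eq_iff)
      then show "(K f n r \<and> (\<forall>q. K f n q \<longrightarrow> degree r \<le> degree q)) =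
                 (K g n r \<and> (\<forall>q. K g n q \<longrightarrow> degree r \<le> degree q))" by simp
    next
      fix n :: nat and f :: "nat \<Rightarrow> 'r poly"
      assume h: "\<And>y. y < n \<Longrightarrow> K f y (f y) \<and> (\<forall>q. K f y q \<longrightarrow> degree (f y) \<le> degree q)"
      define S where "S = (\<lambda>i. poly (f i) x) ` {..<n}"
      have "S \<subseteq> I" "finite S" unfolding S_def using h by (auto simp: K_def)
      then obtain J where "ideal_of B J" "S \<subseteq> J" "\<not> I \<subseteq> J" using no by blast
      then obtain b where b: "b \<in> I" "b \<notin> gen S" using genI[of J S] by auto
      then obtain p where "\<forall>i. coeff p i \<in> A" "b = poly p x" using ideal_ofD(1)[OF I] unfolding B_def by blast
      then have "K f n p" using b unfolding K_def S_def by auto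
      then show "\<exists>r. K f n r \<and> (\<forall>q. K f n q \<longrightarrow> degree r \<le> degree q)"
        by (rule ex_has_least_nat)
    qed
    then obtain h where h: "\<And>n. K h n (h n)" "\<And>n q. K h n q \<Longrightarrow> degree (h n) \<le> degree q" by blast
    define G where "G n = gen ((\<lambda>i. poly (h i) x) ` {..<n})" for n
    have hA: "coeff (h n) i \<in> A" and hI: "poly (h n) x \<in> I" and hG: "poly (h n) x \<notin> G n" for n i
      using h(1) unfolding K_def G_def by auto
    have Gid: "ideal_of B (G n)" for n
    proof -
      have "ideal_of B B" using subB by (auto simp: ideal_of_def intro: subring_setD)
      moreover have "(\<lambda>i. poly (h i) x) ` {..<n} \<subseteq> B" using hA unfolding B_def by auto
      ultimately have ex: "gen ((\<lambda>i. poly (h i) x) ` {..<n}) \<subseteq> B" by (intro genI)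
      show ?thesis unfolding ideal_of_def
      proof (intro conjI ballI)
        show "G n \<subseteq> B" unfolding G_def by (rule ex)
        show "0 \<in> G n" unfolding G_def gen_def by (auto dest: ideal_ofD(2))
        show "a + b \<in> G n" if "a \<in> G n" "b \<in> G n" for a b
          using that unfolding G_def gen_def by (auto dest: ideal_ofD(3))
        show "a * b \<in> G n" if "a \<in> B" "b \<in> G n" for a b
          using that unfolding G_def gen_def by (auto dest: ideal_ofD(4))
      qed
    qed
    have GIn: "poly (h i) x \<in> G n" if "i < n" for i n
      using that unfolding G_def gen_def by auto
    \<comment> \<open>\<open>h n\<close> was already a candidate at stage \<open>i\<close>, so
      minimality there makes the degrees weakly increasing. This justifies the exponents in
      \<open>s\<close>.\<close>
    have deg: "degree (h i) \<le> degree (h n)" if "i \<le> n" for i n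
    proof (rule h(2))
      have "G i \<subseteq> G n" unfolding G_def using that by (intro gen_sub) auto
      then show "K h i (h n)" using hA hI hG[of n] unfolding K_def G_def by auto
    qed
    obtain N r where r: "\<forall>i<N. r i \<in> A" "lead_coeff (h N) = (\<Sum>i<N. r i * lead_coeff (h i))"
      using noetherian_seq[OF noeth, of "\<lambda>n. lead_coeff (h n)"] hA by auto
    \<comment> \<open>Each earlier polynomial is shifted up to the degree of \<open>h N\<close>, so
      that \<open>s\<close> matches \<open>h N\<close> in that degree while its value lies in the
      ideal of the earlier values.\<close>
    define s where "s = (\<Sum>i<N. monom (r i) (degree (h N) - degree (h i)) * h i)"
    define q where "q = h N - s"
    have monA: "coeff (monom (r i) k) j \<in> A" if "i < N" for i k j
      using r(1) that AD(2) by auto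
    have sA: "\<forall>j. coeff s j \<in> A"
      unfolding s_def coeff_sum
    proof (intro allI subring_set_sum[OF sub])
      fix j i assume "i \<in> {..<N}"
      then show "coeff (monom (r i) (degree (h N) - degree (h i)) * h i) j \<in> A"
        using mul[of "monom (r i) (degree (h N) - degree (h i))" "h i"] monA[of i] hA by auto
    qed
    then have qA: "\<forall>j. coeff q j \<in> A" unfolding q_def using hA AD by auto
    have sG: "poly s x \<in> G N" unfolding s_def poly_sum
    proof (intro ideal_of_sum[OF Gid])
      fix i assume i: "i \<in> {..<N}"
      have "poly (monom (r i) (degree (h N) - degree (h i))) x \<in> B"
        unfolding B_def using monA[of i] i by blast
      then show "poly (monom (r i) (degree (h N) - degree (h i)) * h i) x \<in> G N"
        unfolding poly_mult using GIn[of i N] i by (intro ideal_ofD(4)[OF Gid]) auto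
    qed
    have sI: "poly s x \<in> I" 
    proof -
      have "G N \<subseteq> I" unfolding G_def by (rule genI[OF I]) (use hI in auto)
      then show ?thesis using sG by auto
    qed
    have qG: "poly q x \<notin> G N"
    proof
      assume "poly q x \<in> G N"
      then have "poly q x + poly s x \<in> G N" using sG ideal_ofD(3)[OF Gid] by blast
      then show False using hG[of N] by (simp add: q_def)
    qed
    have "poly q x \<in> I" unfolding q_def poly_diff by (rule ideal_of_diff[OF subB I hI sI])
    then have "K h N q" using qA qG unfolding K_def G_def by auto
    then have dq: "degree (h N) \<le> degree q" by (rule h(2))
    have "degree q \<le> degree (h N)" unfolding q_def
    proof (rule degree_diff_le)
      show "degree s \<le> degree (h N)" unfolding s_def
      proof (rule degree_sum_le)
        fix i assume "i \<in> {..<N}"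
        then have "degree (h i) \<le> degree (h N)" using deg by auto
        moreover have "degree (monom (r i) (degree (h N) - degree (h i)) * h i) \<le> degree (h N) - degree (h i) + degree (h i)"
          by (rule order_trans[OF degree_mult_le]) (auto intro: degree_monom_le)
        ultimately show "degree (monom (r i) (degree (h N) - degree (h i)) * h i) \<le> degree (h N)" by simp
      qed auto
    qed auto
    moreover have "coeff q (degree (h N)) = 0"
    proof -
      have "coeff s (degree (h N)) = (\<Sum>i<N. r i * lead_coeff (h i))"
        unfolding s_def coeff_sum by (intro sum.cong refl) (use deg in \<open>auto simp: coeff_monom_mult\<close>)
      then show ?thesis using r(2) by (simp add: q_def)
    qed
    \<comment> \<open>\<open>q\<close> is a candidate at stage \<open>N\<close>, hence of degree at
      least that of \<open>h N\<close>, but its coefficient there cancels. So \<open>q\<close> is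
      zero, and its value 0 lies in \<open>G N\<close> after all.\<close>
    ultimately have "q = 0" using dq by (metis le_antisym leading_coeff_0_iff)
    then show False using qG ideal_ofD(2)[OF Gid] by simp
  qed
qed

text \<open>The constants form a field, in which any nonzero element generates the unit ideal; the
  variables are then adjoined one by one.\<close>

lemma noetherian_mpoly: "noetherian (UNIV :: ('n::finite, complex) mpoly set)"
proof -
  have "\<exists>A :: ('n, complex) mpoly set. noetherian A \<and> (\<forall>c. mconst c \<in> A) \<and> (\<forall>i\<in>K. mvar i \<in> A)"
    if "finite K" for K :: "'n set"
    using that
  proof (induction K rule: finite_induct)
    case empty
    let ?A = "range mconst :: ('n, complex) mpoly set"
    have "noetherian ?A" unfolding noetherian_def
    proof (intro conjI allI impI)
      show "subring_set ?A" unfolding subring_set_def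
        by (auto simp: mult_single image_iff simp flip: single_diff single_one)
      fix I assume I: "ideal_of ?A I"
      show "\<exists>S\<subseteq>I. finite S \<and> (\<forall>J. ideal_of ?A J \<and> S \<subseteq> J \<longrightarrow> I \<subseteq> J)"
      proof (cases "I \<subseteq> {0}")
        case True
        then show ?thesis by (intro exI[of _ "{}"]) (auto simp: ideal_of_def)
      next
        case False
        then obtain a where a: "a \<in> I" "a \<noteq> 0" by auto
        then obtain c where c: "a = mconst c" using ideal_ofD(1)[OF I] by auto
        have "I \<subseteq> J" if J: "ideal_of ?A J" "{a} \<subseteq> J" for J
        proof
          fix b assume "b \<in> I"
          then obtain e where e: "b = mconst e" using ideal_ofD(1)[OF I] by auto
          have "mconst (e / c) * a \<in> J" using J by (auto simp: ideal_of_def)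
          moreover have "c \<noteq> 0" using a c by auto
          ultimately show "b \<in> J" using c e by (simp add: mult_single)
        qed
        then show ?thesis using a by (intro exI[of _ "{a}"]) auto
      qed
    qed
    then show ?case by blast
  next
    case (insert k K)
    then obtain A :: "('n, complex) mpoly set" where A: "noetherian A" "\<forall>c. mconst c \<in> A" "\<forall>i\<in>K. mvar i \<in> A" by blast
    show ?case
      using noetherian_adjoin[OF A(1), of "mvar k"] A(2,3)
      by (intro exI[of _ "{poly p (mvar k) |p. \<forall>i. coeff p i \<in> A}"]) auto
  qed
  from this[of UNIV] obtain A :: "('n, complex) mpoly set"
    where A: "noetherian A" "\<forall>c. mconst c \<in> A" "\<forall>i. mvar i \<in> A" by auto
  then have sub: "subring_set A" by (simp add: noetherian_def)
  have "p \<in> A" for p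
    by (induction p rule: mpoly_induct) (use A subring_setD[OF sub] in auto)
  then have "A = UNIV" by auto
  then show ?thesis using A(1) by simp
qed

section \<open>Hilbert's Nullstellensatz\<close>

text \<open>Zorn's lemma: the union of a chain of ideals that omit 1 again omits 1.\<close>

lemma noetherian_maximal_ideal:
  assumes noeth: "noetherian A" and I: "ideal_of A I" "1 \<notin> I"
  shows "\<exists>M. ideal_of A M \<and> I \<subseteq> M \<and> 1 \<notin> M \<and> (\<forall>J. ideal_of A J \<and> M \<subseteq> J \<and> 1 \<notin> J \<longrightarrow> J = M)"
proof -
  define F where "F = {J. ideal_of A J \<and> I \<subseteq> J \<and> 1 \<notin> J}"
  have "\<exists>M\<in>F. \<forall>X\<in>F. M \<subseteq> X \<longrightarrow> X = M"
  proof (rule subset_Zorn_nonempty)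
    show "F \<noteq> {}" using I by (auto simp: F_def)
    fix C assume C: "C \<noteq> {}" "subset.chain F C"
    have mem: "J \<in> C \<Longrightarrow> ideal_of A J" for J using C(2) by (auto simp: subset.chain_def F_def)
    have "ideal_of A (\<Union>C)"
      unfolding ideal_of_def
    proof (intro conjI ballI)
      show "\<Union>C \<subseteq> A" "0 \<in> \<Union>C" using mem C(1) unfolding ideal_of_def by blast+
      fix x y assume "x \<in> \<Union>C" "y \<in> \<Union>C"
      then obtain J K where "J \<in> C" "x \<in> J" "K \<in> C" "y \<in> K" by auto
      moreover from this have "J \<subseteq> K \<or> K \<subseteq> J" using C(2) by (auto simp: subset.chain_def)
      ultimately show "x + y \<in> \<Union>C" using mem ideal_ofD(3) by blast
    next
      fix a x assume "a \<in> A" "x \<in> \<Union>C"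
      then show "a * x \<in> \<Union>C" using mem ideal_ofD(4) by blast
    qed
    then show "\<Union>C \<in> F" using C by (auto simp: F_def subset.chain_def)
  qed
  then show ?thesis unfolding F_def by (smt (verit) mem_Collect_eq order_trans)
qed

lemma mconst_simps:
  "mconst (a + b) = mconst a + mconst b" "mconst (a * b) = mconst a * mconst b"
  "mconst (a - b) = mconst a - mconst b"
  by (simp_all add: single_add mult_single single_diff)

lemma countable_mpoly_monomials:
  "countable (range (\<lambda>m. Poly_Mapping.single m 1) :: ('n::finite, 'a::comm_ring_1) mpoly set)"
proof -
  have "inj (Poly_Mapping.lookup :: ('n \<Rightarrow>\<^sub>0 nat) \<Rightarrow> _)" by (simp add: inj_on_def poly_mapping_eqI fun_eq_iff)
  then have "countable (UNIV :: ('n \<Rightarrow>\<^sub>0 nat) set)"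
    by (rule countableI'[OF inj_compose[OF inj_to_nat]])
  then show ?thesis by (rule countable_image)
qed

text \<open>Complex scalars act through \<open>mconst\<close>; the Nullstellensatz argument plays
  the countable dimension of this space against the uncountable field.\<close>

interpretation mpoly_vs: vector_space "\<lambda>(c::complex) (p :: ('n::finite, complex) mpoly). mconst c * p"
  by unfold_locales (simp_all only: mconst_simps distrib_left distrib_right mult.assoc single_one mult_1_left)

lemma mpoly_span_monomials:
  "p \<in> mpoly_vs.span (range (\<lambda>m. Poly_Mapping.single m 1) :: ('n::finite, complex) mpoly set)"
proof -
  have "(\<Sum>m\<in>Poly_Mapping.keys p. mconst (Poly_Mapping.lookup p m) * Poly_Mapping.single m 1) \<in>
      mpoly_vs.span (range (\<lambda>m. Poly_Mapping.single m 1))"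
    by (intro mpoly_vs.span_sum mpoly_vs.span_scale mpoly_vs.span_base) auto
  then show ?thesis using mpoly_expand[of p] by (simp add: mult_single)
qed

lemma prod_complex_nonzero: "finite C \<Longrightarrow> (\<Prod>c'\<in>C - {c}. c - c') \<noteq> (0::complex)"
  by auto

text \<open>If no \<open>X - c\<close> were in a maximal ideal \<open>M\<close>, the inverses of the \<open>X - c\<close> modulo \<open>M\<close> would be
  uncountably many linearly independent elements of a space of countable dimension.\<close>

lemma maximal_ideal_contains_linear:
  fixes M :: "('n::finite, complex) mpoly set"
  assumes M: "ideal_of UNIV M" "1 \<notin> M" and max: "\<And>J. ideal_of UNIV J \<Longrightarrow> M \<subseteq> J \<Longrightarrow> 1 \<notin> J \<Longrightarrow> J = M"
  shows "\<exists>c. X - mconst c \<in> M"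
proof (rule ccontr)
  assume no: "\<nexists>c. X - mconst c \<in> M"
  have subU: "subring_set (UNIV :: ('n, complex) mpoly set)" by (simp add: subring_set_def)
  note MD = ideal_ofD[OF M(1)]
  have Mdiff: "x \<in> M \<Longrightarrow> y \<in> M \<Longrightarrow> x - y \<in> M" for x y by (rule ideal_of_diff[OF subU M(1)])
  \<comment> \<open>By maximality the ideal generated by \<open>M\<close> and
    \<open>X - mconst c\<close> contains 1, which makes \<open>X - mconst c\<close> invertible
    modulo \<open>M\<close>.\<close>
  have "\<exists>q. q * (X - mconst c) - 1 \<in> M" for c
  proof -
    let ?J = "{q * (X - mconst c) + m | q m. m \<in> M}"
    have JI: "q * (X - mconst c) + m \<in> ?J" if "m \<in> M" for q m using that by blast
    have J: "ideal_of UNIV ?J" unfolding ideal_of_def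
    proof (intro conjI ballI)
      show "0 \<in> ?J" using JI[OF MD(2), of 0] by simp
      fix x y assume "x \<in> ?J" "y \<in> ?J"
      then obtain q m q' m' where m: "m \<in> M" "m' \<in> M" and xy: "x = q * (X - mconst c) + m" "y = q' * (X - mconst c) + m'"
        by blast
      have "x + y = (q + q') * (X - mconst c) + (m + m')" unfolding xy by (simp add: algebra_simps)
      with m show "x + y \<in> ?J" using JI[of "m + m'" "q + q'"] MD(3)[of m m'] by simp
    next
      fix a x assume "x \<in> ?J"
      then obtain q m where m: "m \<in> M" and x: "x = q * (X - mconst c) + m" by blast
      have "a * x = (a * q) * (X - mconst c) + a * m" unfolding x by (simp add: algebra_simps)
      with m show "a * x \<in> ?J" using JI[of "a * m" "a * q"] MD(4)[of a m] by simp
    qed auto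
    have "M \<subseteq> ?J" using JI[of _ 0] by auto
    moreover have "X - mconst c \<in> ?J" using JI[OF MD(2), of 1] by simp
    ultimately have "1 \<in> ?J" using max[OF J] no by blast
    then obtain q m where "m \<in> M" "1 = q * (X - mconst c) + m" by blast
    then have "q * (X - mconst c) - 1 = 0 - m" by (simp add: algebra_simps)
    then show ?thesis using Mdiff[OF MD(2) \<open>m \<in> M\<close>] by metis
  qed
  then obtain q where q: "\<And>c. q c * (X - mconst c) - 1 \<in> M" by metis
  \<comment> \<open>Multiplying by the inverse \<open>q c\<close> cancels the linear factor modulo
    \<open>M\<close>.\<close>
  have inv: "r \<in> M" if "(X - mconst c) * r \<in> M" for c r
  proof -
    have "q c * ((X - mconst c) * r) - r * (q c * (X - mconst c) - 1) \<in> M"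
      by (rule Mdiff[OF MD(4)[OF UNIV_I that] MD(4)[OF UNIV_I q]])
    then show ?thesis by (simp add: algebra_simps)
  qed
  let ?mc = "mconst :: complex \<Rightarrow> ('n, complex) mpoly"
  let ?ev = "\<lambda>p. poly (map_poly ?mc p) X"
  have ev_add: "?ev (p + r) = ?ev p + ?ev r" for p r
  proof -
    have "map_poly ?mc (p + r) = map_poly ?mc p + map_poly ?mc r"
      by (rule poly_eqI) (simp add: coeff_map_poly mconst_simps)
    then show ?thesis by simp
  qed
  have ev_smult: "?ev (smult c p) = mconst c * ?ev p" for c p
  proof -
    have "map_poly ?mc (smult c p) = smult (mconst c) (map_poly ?mc p)"
      by (rule poly_eqI) (simp add: coeff_map_poly mconst_simps)
    then show ?thesis by simp
  qed
  have ev_mult: "?ev ([:- c, 1:] * p) = (X - mconst c) * ?ev p" for c p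
  proof -
    have "[:- c, 1:] * p = smult (- c) p + pCons 0 p" by simp
    moreover have "?ev (pCons 0 p) = X * ?ev p" by (simp add: map_poly_pCons)
    ultimately have "?ev ([:- c, 1:] * p) = mconst (- c) * ?ev p + X * ?ev p"
      by (simp only: ev_add ev_smult)
    then show ?thesis by (simp only: single_uminus left_diff_distrib) simp
  qed
  have ev_one: "?ev 1 = 1" by simp
  \<comment> \<open>A nonzero univariate polynomial splits into linear factors over the complex
    numbers, each invertible modulo \<open>M\<close>: the residue of \<open>X\<close> is
    transcendental over the constants.\<close>
  have ev_notin: "?ev p \<notin> M" if "p \<noteq> 0" for p
    using that
  proof (induction "degree p" arbitrary: p)
    case 0
    then obtain c where c: "p = [:c:]" "c \<noteq> 0" by (metis degree_eq_zeroE pCons_0_0)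
    show ?case
    proof
      assume "?ev p \<in> M"
      then have "mconst c \<in> M" using c by (simp add: map_poly_pCons)
      then have "mconst (1 / c) * mconst c \<in> M" by (intro MD(4)) auto
      then show False using M(2) c by (simp add: mult_single)
    qed
  next
    case (Suc n)
    then have "\<not> constant (poly p)" by (simp add: constant_degree)
    then obtain r where "poly p r = 0" using fundamental_theorem_of_algebra by blast
    then obtain s where s: "p = [:- r, 1:] * s" by (metis poly_eq_0_iff_dvd dvd_def)
    then have "s \<noteq> 0" "degree s = n" using Suc by (auto simp del: mult_pCons_left simp: degree_mult_eq)
    then have "?ev s \<notin> M" using Suc.hyps(1)[of s] by simp
    then show ?case unfolding s ev_mult using inv by blast
  qed
  define b where "b = from_nat_into (range (\<lambda>m. Poly_Mapping.single m 1) :: ('n, complex) mpoly set)"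
  have bran: "range b = range (\<lambda>m. Poly_Mapping.single m 1)"
    unfolding b_def by (rule range_from_nat_into[OF _ countable_mpoly_monomials]) auto
  have "\<exists>N. p \<in> mpoly_vs.span (b ` {..<N})" for p
  proof -
    obtain t r where t: "finite t" "t \<subseteq> range b" "p = (\<Sum>a\<in>t. mconst (r a) * a)"
      using mpoly_span_monomials[of p] unfolding bran[symmetric] mpoly_vs.span_explicit by blast
    obtain K where K: "finite K" "t = b ` K" using t(1,2) by (meson finite_subset_image)
    then obtain N where "K \<subseteq> {..<N}" using finite_nat_bounded by auto
    then have "t \<subseteq> b ` {..<N}" using K by auto
    then have "p \<in> mpoly_vs.span (b ` {..<N})"
      unfolding t(3) by (intro mpoly_vs.span_sum mpoly_vs.span_scale mpoly_vs.span_base) auto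
    then show ?thesis by blast
  qed
  then have "(\<Union>N. {c. q c \<in> mpoly_vs.span (b ` {..<N})}) = UNIV" by auto
  moreover have "uncountable (UNIV :: complex set)" by (rule uncountable_UNIV_complex)
  ultimately have "\<not> (\<forall>N. countable {c. q c \<in> mpoly_vs.span (b ` {..<N})})"
    using countable_UN[of UNIV "\<lambda>N. {c. q c \<in> mpoly_vs.span (b ` {..<N})}"] by auto
  then obtain N where N: "uncountable {c. q c \<in> mpoly_vs.span (b ` {..<N})}" by blast
  define C where "C = {c. q c \<in> mpoly_vs.span (b ` {..<N})}"
  have infC: "infinite C" using N countable_finite unfolding C_def by blast
  have injq: "inj q"
  proof (rule injI, rule ccontr)
    fix c c' assume "q c = q c'" "c \<noteq> c'"
    then have "(q c * (X - mconst c) - 1) - (q c * (X - mconst c') - 1) \<in> M"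
      using Mdiff[OF q[of c] q[of c']] by simp
    then have "q c * mconst (c' - c) \<in> M" by (simp add: algebra_simps mconst_simps)
    then have "mconst (1 / (c' - c)) * (q c * mconst (c' - c)) \<in> M" by (rule MD(4)[OF UNIV_I])
    moreover have "mconst (1 / (c' - c)) * (q c * mconst (c' - c)) = q c * mconst (1 / (c' - c) * (c' - c))"
      unfolding mconst_simps by (simp only: ac_simps)
    ultimately have "q c \<in> M" using \<open>c \<noteq> c'\<close> by simp
    then have "(X - mconst c) * q c - (q c * (X - mconst c) - 1) \<in> M" by (intro Mdiff[OF MD(4) q]) auto
    then show False using M(2) by (simp add: algebra_simps)
  qed
  have "infinite (q ` C)" using infC injq finite_imageD[of q C] inj_on_subset[of q UNIV C] by auto
  moreover have "q ` C \<subseteq> mpoly_vs.span (b ` {..<N})" by (auto simp: C_def)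
  ultimately have "mpoly_vs.dependent (q ` C)"
    using mpoly_vs.independent_span_bound[of "b ` {..<N}" "q ` C"] by auto
  then obtain t u where t: "finite t" "t \<subseteq> q ` C" "(\<Sum>v\<in>t. mconst (u v) * v) = 0" "\<exists>v\<in>t. u v \<noteq> 0"
    unfolding mpoly_vs.dependent_explicit by auto
  obtain K where K: "K \<subseteq> C" "finite K" "t = q ` K" using t(1,2) by (meson finite_subset_image)
  \<comment> \<open>\<open>P\<close> arises by clearing denominators in a linear relation between
    the inverses \<open>q c\<close> of \<open>X - mconst c\<close>. At \<open>c0\<close> all
    summands but one vanish, so \<open>P\<close> is nonzero, yet \<open>X\<close> satisfies it
    modulo \<open>M\<close>.\<close>
  define P where "P = (\<Sum>c\<in>K. smult (u (q c)) (\<Prod>c'\<in>K - {c}. [:- c', 1:]))"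
  have ev_sum: "?ev (sum g J) = (\<Sum>j\<in>J. ?ev (g j))" for g :: "complex \<Rightarrow> complex poly" and J
    by (induction J rule: infinite_finite_induct) (auto simp: ev_add)
  have ev_prod: "?ev (\<Prod>c'\<in>J. [:- c', 1:]) = (\<Prod>c'\<in>J. X - mconst c')" for J
    by (induction J rule: infinite_finite_induct) (simp_all del: mult_pCons_left add: ev_mult)
  obtain c0 where c0: "c0 \<in> K" "u (q c0) \<noteq> 0" using t(4) K by auto
  have "poly P c0 = (\<Sum>c\<in>K. u (q c) * (\<Prod>c'\<in>K - {c}. c0 - c'))"
    by (simp add: P_def poly_sum poly_prod)
  also have "\<dots> = (\<Sum>c\<in>K. if c = c0 then u (q c0) * (\<Prod>c'\<in>K - {c0}. c0 - c') else 0)"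
    using c0 K(2) by (intro sum.cong) auto
  also have "\<dots> = u (q c0) * (\<Prod>c'\<in>K - {c0}. c0 - c')" using c0 K by simp
  finally have "P \<noteq> 0" using c0 prod_complex_nonzero[OF K(2)] by (metis mult_eq_0_iff poly_0)
  moreover have "?ev P \<in> M"
  proof -
    let ?Pi = "\<Prod>c'\<in>K. X - mconst c'"
    have alg: "((X - v) * r) * (w * p) - w * r = (w * r) * (p * (X - v) - 1)" for v r w p
      by (simp add: algebra_simps)
    have "(\<Sum>c\<in>K. mconst (u (q c)) * q c) = 0"
      using t(3) unfolding K(3) by (subst (asm) sum.reindex) (use injq in \<open>auto intro: inj_on_subset\<close>)
    then have z: "(\<Sum>c\<in>K. ?Pi * (mconst (u (q c)) * q c)) = 0" by (simp flip: sum_distrib_left)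
    have "(\<Sum>c\<in>K. ?Pi * (mconst (u (q c)) * q c) - mconst (u (q c)) * (\<Prod>c'\<in>K - {c}. X - mconst c')) \<in> M"
    proof (rule ideal_of_sum[OF M(1)])
      fix c assume "c \<in> K"
      then have "?Pi = (X - mconst c) * (\<Prod>c'\<in>K - {c}. X - mconst c')"
        using K(2) by (simp add: prod.remove)
      then have "?Pi * (mconst (u (q c)) * q c) - mconst (u (q c)) * (\<Prod>c'\<in>K - {c}. X - mconst c') =
          (mconst (u (q c)) * (\<Prod>c'\<in>K - {c}. X - mconst c')) * (q c * (X - mconst c) - 1)"
        by (simp only: alg)
      then show "?Pi * (mconst (u (q c)) * q c) - mconst (u (q c)) * (\<Prod>c'\<in>K - {c}. X - mconst c') \<in> M"
        using q MD(4) by simp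
    qed
    then have "0 - (\<Sum>c\<in>K. mconst (u (q c)) * (\<Prod>c'\<in>K - {c}. X - mconst c')) \<in> M"
      by (simp add: sum_subtractf z)
    then have "0 - (0 - (\<Sum>c\<in>K. mconst (u (q c)) * (\<Prod>c'\<in>K - {c}. X - mconst c'))) \<in> M"
      using MD(2) Mdiff by blast
    then show ?thesis by (simp add: P_def ev_sum ev_smult ev_prod)
  qed
  ultimately show False using ev_notin by blast
qed

text \<open>If 1 is not a combination of the \<open>F i\<close>, a maximal ideal above them contains
  \<open>mvar i - mconst (a i)\<close> for every \<open>i\<close>. Modulo it a polynomial is
  congruent to its value at \<open>a\<close>, so \<open>a\<close> is a common zero.\<close>

lemma weak_nullstellensatz:
  fixes F :: "'i \<Rightarrow> ('n::finite, complex) mpoly"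
  assumes "finite I" and nz: "\<nexists>x. \<forall>i\<in>I. poly_eval (F i) x = 0"
  shows "\<exists>q. (\<Sum>i\<in>I. q i * F i) = 1"
proof (rule ccontr)
  assume no: "\<nexists>q. (\<Sum>i\<in>I. q i * F i) = 1"
  define J where "J = {\<Sum>i\<in>I. q i * F i | q. True}"
  have J: "ideal_of UNIV J" unfolding ideal_of_def
  proof (intro conjI ballI)
    show "0 \<in> J" unfolding J_def by (intro CollectI exI[of _ "\<lambda>_. 0"]) auto
    fix x y assume "x \<in> J" "y \<in> J"
    then obtain q r where "x = (\<Sum>i\<in>I. q i * F i)" "y = (\<Sum>i\<in>I. r i * F i)" unfolding J_def by blast
    then show "x + y \<in> J" unfolding J_def
      by (intro CollectI exI[of _ "\<lambda>i. q i + r i"]) (auto simp: algebra_simps sum.distrib)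
  next
    fix a x assume "x \<in> J"
    then obtain q where "x = (\<Sum>i\<in>I. q i * F i)" unfolding J_def by blast
    then show "a * x \<in> J" unfolding J_def
      by (intro CollectI exI[of _ "\<lambda>i. a * q i"]) (auto simp: sum_distrib_left mult.assoc)
  qed auto
  have FJ: "F i \<in> J" if "i \<in> I" for i unfolding J_def
    using that assms(1)
    by (intro CollectI exI[of _ "\<lambda>j. if j = i then 1 else 0"])
      (simp add: if_distrib[of "\<lambda>x. x * _"] cong: if_cong)
  have "1 \<notin> J" using no unfolding J_def by fastforce
  then obtain M where M: "ideal_of UNIV M" "J \<subseteq> M" "1 \<notin> M" "\<forall>J. ideal_of UNIV J \<and> M \<subseteq> J \<and> 1 \<notin> J \<longrightarrow> J = M"
    using noetherian_maximal_ideal[OF noetherian_mpoly J] by blast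
  have max: "J = M" if "ideal_of UNIV J" "M \<subseteq> J" "1 \<notin> J" for J using M(4) that by blast
  have "\<forall>i. \<exists>c. mvar i - mconst c \<in> M"
    by (intro allI maximal_ideal_contains_linear[OF M(1,3) max])
  from choice[OF this] obtain a where a: "\<And>i. mvar i - mconst (a i) \<in> M" by blast
  note MD = ideal_ofD[OF M(1)]
  define x where "x = vec_lambda a"
  have cong: "p - mconst (poly_eval p x) \<in> M" for p
  proof (induction p rule: mpoly_induct)
    case (const c)
    then show ?case using MD(2) by simp
  next
    case (var i)
    then show ?case using a[of i] by (simp add: x_def)
  next
    case (add p q)
    then have "(p - mconst (poly_eval p x)) + (q - mconst (poly_eval q x)) \<in> M" by (rule MD(3))
    then show ?case by (simp add: poly_eval_add mconst_simps algebra_simps)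
  next
    case (mult p q)
    have "q * (p - mconst (poly_eval p x)) + mconst (poly_eval p x) * (q - mconst (poly_eval q x)) \<in> M"
      using mult by (intro MD(3) MD(4)) auto
    then show ?case by (simp add: poly_eval_mult mconst_simps algebra_simps)
  qed
  have "poly_eval (F i) x = 0" if "i \<in> I" for i
  proof (rule ccontr)
    assume nz: "poly_eval (F i) x \<noteq> 0"
    have "F i \<in> M" using FJ that M(2) by auto
    moreover have "- 1 * (F i - mconst (poly_eval (F i) x)) \<in> M" using cong by (intro MD(4)) auto
    ultimately have "F i + - 1 * (F i - mconst (poly_eval (F i) x)) \<in> M" by (rule MD(3))
    then have "mconst (1 / poly_eval (F i) x) * mconst (poly_eval (F i) x) \<in> M"
      by (intro MD(4)) auto
    then show False using nz M(3) by (simp add: mult_single)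
  qed
  then show False using nz by blast
qed

section \<open>Generic unsolvability\<close>

text \<open>Each induction step is one step of Gaussian elimination.\<close>

lemma polyfun_span_dichotomy:
  fixes a :: "'l \<Rightarrow> 'v \<Rightarrow> complex ^ 'n::finite \<Rightarrow> complex"
  assumes "finite L" "\<And>l v. l \<in> L \<Longrightarrow> polyfun (a l v)" "\<And>v. polyfun (b v)"
  shows "\<exists>g. polyfun g \<and> (\<exists>z. g z \<noteq> 0) \<and>
    ((\<forall>z. g z \<noteq> 0 \<longrightarrow> (\<exists>c. \<forall>v. b v z = (\<Sum>l\<in>L. c l * a l v z))) \<or>
     (\<forall>z. g z \<noteq> 0 \<longrightarrow> (\<nexists>c. \<forall>v. b v z = (\<Sum>l\<in>L. c l * a l v z))))"
  using assms
proof (induction L arbitrary: a b rule: finite_induct)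
  case empty
  show ?case
  proof (cases "\<exists>v z. b v z \<noteq> 0")
    case True
    then obtain v z where "b v z \<noteq> 0" by blast
    then show ?thesis using empty(2)[of v] by (intro exI[of _ "b v"]) auto
  next
    case False
    then show ?thesis by (intro exI[of _ "\<lambda>_. 1"]) (auto intro: polyfun.intros)
  qed
next
  case (insert k L)
  have sum_insert: "(\<Sum>l\<in>insert k L. c l * a l v z) = c k * a k v z + (\<Sum>l\<in>L. c l * a l v z)" for c v z
    using insert.hyps by simp
  show ?case
  proof (cases "\<exists>v z. a k v z \<noteq> 0")
    case False
    then have "(\<Sum>l\<in>insert k L. c l * a l v z) = (\<Sum>l\<in>L. c l * a l v z)" for c v z
      by (simp add: sum_insert)
    then show ?thesis using insert.IH[of a b] insert.prems by simp
  next
    case True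
    then obtain w z0 where w: "a k w z0 \<noteq> 0" by blast
    define h where "h = a k w"
    \<comment> \<open>Equations are indexed by \<open>v\<close>, unknowns by \<open>l\<close>.
      Equation \<open>w\<close> eliminates unknown \<open>k\<close>; multiplying through by the
      pivot \<open>h\<close> instead of dividing keeps the coefficients polynomial. Only the set of
      unknowns has to be finite.\<close>
    define a' where "a' l v z = h z * a l v z - a l w z * a k v z" for l v z
    define b' where "b' v z = h z * b v z - b w z * a k v z" for v z
    have "polyfun h" using insert.prems by (auto simp: h_def)
    have "polyfun (a' l v)" if "l \<in> L" for l v
      using insert.prems(1)[of l v] insert.prems(1)[of l w] insert.prems(1)[of k v] that \<open>polyfun h\<close>
      unfolding a'_def by (intro polyfun_diff polyfun.mult) auto
    moreover have "polyfun (b' v)" for v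
      using insert.prems(2)[of v] insert.prems(2)[of w] insert.prems(1)[of k v] \<open>polyfun h\<close>
      unfolding b'_def by (intro polyfun_diff polyfun.mult) auto
    ultimately obtain g where g: "polyfun g" "\<exists>z. g z \<noteq> 0"
      "(\<forall>z. g z \<noteq> 0 \<longrightarrow> (\<exists>c. \<forall>v. b' v z = (\<Sum>l\<in>L. c l * a' l v z))) \<or>
       (\<forall>z. g z \<noteq> 0 \<longrightarrow> (\<nexists>c. \<forall>v. b' v z = (\<Sum>l\<in>L. c l * a' l v z)))"
      using insert.IH[of a' b'] by blast
    have eqv: "(\<exists>c. \<forall>v. b' v z = (\<Sum>l\<in>L. c l * a' l v z)) \<longleftrightarrow>
        (\<exists>c. \<forall>v. b v z = (\<Sum>l\<in>insert k L. c l * a l v z))" if "h z \<noteq> 0" for z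
    proof
      assume "\<exists>c. \<forall>v. b' v z = (\<Sum>l\<in>L. c l * a' l v z)"
      then obtain c where c: "\<And>v. b' v z = (\<Sum>l\<in>L. c l * a' l v z)" by blast
      define c' where "c' l = (if l = k then (b w z - (\<Sum>l\<in>L. c l * a l w z)) / h z else c l)" for l
      have "b v z = (\<Sum>l\<in>insert k L. c' l * a l v z)" for v
      proof -
        have "h z * b v z = b w z * a k v z + (\<Sum>l\<in>L. c l * a' l v z)"
          using c[of v] by (simp add: b'_def algebra_simps)
        also have "(\<Sum>l\<in>L. c l * a' l v z) = h z * (\<Sum>l\<in>L. c l * a l v z) - (\<Sum>l\<in>L. c l * a l w z) * a k v z"
          by (simp add: a'_def sum_distrib_left sum_distrib_right sum_subtractf algebra_simps)
        finally have 1: "h z * b v z = b w z * a k v z +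
            (h z * (\<Sum>l\<in>L. c l * a l v z) - (\<Sum>l\<in>L. c l * a l w z) * a k v z)" .
        have "h z * c' k = b w z - (\<Sum>l\<in>L. c l * a l w z)" using that by (simp add: c'_def)
        then have 2: "h z * (c' k * a k v z + (\<Sum>l\<in>L. c l * a l v z)) =
            (b w z - (\<Sum>l\<in>L. c l * a l w z)) * a k v z + h z * (\<Sum>l\<in>L. c l * a l v z)"
          by (simp only: distrib_left flip: mult.assoc)
        have "h z * b v z = h z * (c' k * a k v z + (\<Sum>l\<in>L. c l * a l v z))"
          unfolding 1 2 by (simp add: left_diff_distrib)
        then have "b v z = c' k * a k v z + (\<Sum>l\<in>L. c l * a l v z)" using that by simp
        also have "(\<Sum>l\<in>L. c l * a l v z) = (\<Sum>l\<in>L. c' l * a l v z)"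
          using insert.hyps by (intro sum.cong) (auto simp: c'_def)
        finally show ?thesis by (simp add: sum_insert)
      qed
      then show "\<exists>c. \<forall>v. b v z = (\<Sum>l\<in>insert k L. c l * a l v z)" by blast
    next
      assume "\<exists>c. \<forall>v. b v z = (\<Sum>l\<in>insert k L. c l * a l v z)"
      then obtain c where c: "\<And>v. b v z = c k * a k v z + (\<Sum>l\<in>L. c l * a l v z)"
        unfolding sum_insert by blast
      have "b' v z = (\<Sum>l\<in>L. c l * a' l v z)" for v
        unfolding b'_def a'_def c[of v] c[of w]
        by (simp add: h_def sum_distrib_left sum_distrib_right sum_subtractf algebra_simps)
      then show "\<exists>c. \<forall>v. b' v z = (\<Sum>l\<in>L. c l * a' l v z)" by blast
    qed
    obtain z1 where "g z1 \<noteq> 0" using g(2) by blast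
    then obtain t where "g (z1 + t *s (z0 - z1)) * h (z1 + t *s (z0 - z1)) \<noteq> 0"
      using polyfun_mult_nonzero[OF g(1) \<open>polyfun h\<close>] w h_def by blast
    moreover have "(\<forall>z. g z * h z \<noteq> 0 \<longrightarrow> (\<exists>c. \<forall>v. b v z = (\<Sum>l\<in>insert k L. c l * a l v z))) \<or>
        (\<forall>z. g z * h z \<noteq> 0 \<longrightarrow> (\<nexists>c. \<forall>v. b v z = (\<Sum>l\<in>insert k L. c l * a l v z)))"
      using g(3)
    proof (rule disj_forward; intro allI impI)
      fix z assume "\<forall>z. g z \<noteq> 0 \<longrightarrow> (\<exists>c. \<forall>v. b' v z = (\<Sum>l\<in>L. c l * a' l v z))" "g z * h z \<noteq> 0"
      then show "\<exists>c. \<forall>v. b v z = (\<Sum>l\<in>insert k L. c l * a l v z)" by (subst eqv[symmetric]) auto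
    next
      fix z assume "\<forall>z. g z \<noteq> 0 \<longrightarrow> (\<nexists>c. \<forall>v. b' v z = (\<Sum>l\<in>L. c l * a' l v z))" "g z * h z \<noteq> 0"
      then show "\<nexists>c. \<forall>v. b v z = (\<Sum>l\<in>insert k L. c l * a l v z)" by (subst eqv[symmetric]) auto
    qed
    ultimately show ?thesis using polyfun.mult[OF g(1) \<open>polyfun h\<close>] by blast
  qed
qed

text \<open>A fibre without solutions has a Nullstellensatz certificate. Ordering the certificates by
  their support gives countably many conditions on the parameter; each holds generically or fails
  generically, so a single solution-free parameter outside the exceptional hypersurfaces suffices.\<close>

lemma generic_unsolvability:
  fixes F :: "'i::finite \<Rightarrow> complex ^ 'n::finite \<Rightarrow> complex ^ 'd::finite \<Rightarrow> complex"
  assumes poly_y: "\<And>i z. polyfun (F i z)" and poly_z: "\<And>i y. polyfun (\<lambda>z. F i z y)"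
    and avoid: "\<And>H. countable H \<Longrightarrow> (\<And>p. p \<in> H \<Longrightarrow> polyfun p \<and> (\<exists>z. p z \<noteq> 0)) \<Longrightarrow>
      \<exists>z. (\<forall>p\<in>H. p z \<noteq> 0) \<and> (\<nexists>y. \<forall>i. F i z y = 0)"
  shows "\<exists>g. polyfun g \<and> (\<exists>z. g z \<noteq> 0) \<and> (\<forall>z y. (\<forall>i. F i z y = 0) \<longrightarrow> g z = 0)"
proof -
  have "inj (Poly_Mapping.lookup :: ('d \<Rightarrow>\<^sub>0 nat) \<Rightarrow> _)" by (simp add: inj_on_def poly_mapping_eqI fun_eq_iff)
  then have cnt: "countable (UNIV :: ('d \<Rightarrow>\<^sub>0 nat) set)"
    by (rule countableI'[OF inj_compose[OF inj_to_nat]])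
  define Ms where "Ms N = from_nat_into (UNIV :: ('d \<Rightarrow>\<^sub>0 nat) set) ` {..<N::nat}" for N
  define T where "T N z \<longleftrightarrow> (\<exists>c. \<forall>y. 1 = (\<Sum>l\<in>UNIV \<times> Ms N. c l * (mono_eval (snd l) y * F (fst l) z y)))" for N z
  \<comment> \<open>The identity of polynomials is tested pointwise: there is one equation for each
    point \<open>y\<close>, and the unknowns are the finitely many coefficients of a
    certificate.\<close>
  have "\<exists>g. polyfun g \<and> (\<exists>z. g z \<noteq> 0) \<and> ((\<forall>z. g z \<noteq> 0 \<longrightarrow> T N z) \<or> (\<forall>z. g z \<noteq> 0 \<longrightarrow> \<not> T N z))" for N
    unfolding T_def
  proof (rule polyfun_span_dichotomy[where b = "\<lambda>y z. 1" and a = "\<lambda>l y z. mono_eval (snd l) y * F (fst l) z y"])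
    show "finite ((UNIV :: 'i set) \<times> Ms N)" by (intro finite_cartesian_product) (simp_all add: Ms_def)
    show "polyfun (\<lambda>z. mono_eval (snd l) y * F (fst l) z y)" for l y
      by (rule polyfun.mult[OF polyfun.const poly_z])
    show "polyfun (\<lambda>z. 1)" by (rule polyfun.const)
  qed
  then have "\<forall>N. \<exists>g. polyfun g \<and> (\<exists>z. g z \<noteq> 0) \<and> ((\<forall>z. g z \<noteq> 0 \<longrightarrow> T N z) \<or> (\<forall>z. g z \<noteq> 0 \<longrightarrow> \<not> T N z))" ..
  from choice[OF this] obtain g where G: "\<forall>N. polyfun (g N) \<and> (\<exists>z. g N z \<noteq> 0) \<and>
      ((\<forall>z. g N z \<noteq> 0 \<longrightarrow> T N z) \<or> (\<forall>z. g N z \<noteq> 0 \<longrightarrow> \<not> T N z))" ..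
  have g: "polyfun (g N)" "\<exists>z. g N z \<noteq> 0"
    "(\<forall>z. g N z \<noteq> 0 \<longrightarrow> T N z) \<or> (\<forall>z. g N z \<noteq> 0 \<longrightarrow> \<not> T N z)" for N
    by (rule G[rule_format, THEN conjunct1] G[rule_format, THEN conjunct2, THEN conjunct1]
      G[rule_format, THEN conjunct2, THEN conjunct2])+
  have "\<exists>z. (\<forall>p\<in>range g. p z \<noteq> 0) \<and> (\<nexists>y. \<forall>i. F i z y = 0)"
    by (rule avoid) (use g(1,2) in \<open>auto simp only: countableI_type[THEN countable_image] rangeI elim!: rangeE\<close>)
  then obtain z where z: "\<And>N. g N z \<noteq> 0" "\<nexists>y. \<forall>i. F i z y = 0" by auto
  have "\<forall>i. \<exists>p. F i z = poly_eval p" using poly_y by (simp add: polyfun_iff)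
  from choice[OF this] obtain G where G: "\<And>i. F i z = poly_eval (G i)" by (elim exE) simp
  have "\<exists>q. (\<Sum>i\<in>UNIV. q i * G i) = 1"
    by (rule weak_nullstellensatz) (use z(2) G in auto)
  then obtain q where q: "(\<Sum>i\<in>UNIV. q i * G i) = 1" by blast
  define K where "K = (\<Union>i. Poly_Mapping.keys (q i))"
  have "finite K" by (simp add: K_def)
  moreover have "K \<subseteq> range (from_nat_into (UNIV :: ('d \<Rightarrow>\<^sub>0 nat) set))"
    using range_from_nat_into[OF _ cnt] by auto
  ultimately obtain J where J: "finite J" "K = from_nat_into UNIV ` J" by (meson finite_subset_image)
  then obtain N where "J \<subseteq> {..<N}" using finite_nat_bounded by auto
  then have N: "K \<subseteq> Ms N" unfolding J(2) Ms_def by auto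
  have "1 = (\<Sum>l\<in>UNIV \<times> Ms N. Poly_Mapping.lookup (q (fst l)) (snd l) * (mono_eval (snd l) y * F (fst l) z y))" for y
  proof -
    have "1 = poly_eval (\<Sum>i\<in>UNIV. q i * G i) y" by (simp add: q)
    also have "\<dots> = (\<Sum>i\<in>UNIV. poly_eval (q i) y * F i z y)" by (simp add: poly_eval_sum poly_eval_mult G)
    also have "\<dots> = (\<Sum>i\<in>UNIV. \<Sum>m\<in>Ms N. Poly_Mapping.lookup (q i) m * (mono_eval m y * F i z y))"
    proof (rule sum.cong[OF refl])
      fix i
      have "poly_eval (q i) y = (\<Sum>m\<in>Ms N. Poly_Mapping.lookup (q i) m * mono_eval m y)"
        by (rule poly_eval_superset) (use N in \<open>auto simp: Ms_def K_def\<close>)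
      then show "poly_eval (q i) y * F i z y = (\<Sum>m\<in>Ms N. Poly_Mapping.lookup (q i) m * (mono_eval m y * F i z y))"
        by (simp add: sum_distrib_right mult.assoc)
    qed
    finally show ?thesis by (simp add: sum.cartesian_product case_prod_unfold)
  qed
  then have "T N z" unfolding T_def by (intro exI[of _ "\<lambda>l. Poly_Mapping.lookup (q (fst l)) (snd l)"]) blast
  \<comment> \<open>The chosen point satisfies \<open>T N\<close> and lies off
    \<open>g N = 0\<close>, which rules out generic failure. At a common zero \<open>y\<close> a
    certificate would read 1 = 0.\<close>
  then have T: "g N z \<noteq> 0 \<Longrightarrow> T N z" for z using g(3)[of N] z(1)[of N] by blast
  have "g N z = 0" if "\<forall>i. F i z y = 0" for z y
  proof (rule ccontr)
    assume "g N z \<noteq> 0"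
    then obtain c where c: "\<And>y. 1 = (\<Sum>l\<in>UNIV \<times> Ms N. c l * (mono_eval (snd l) y * F (fst l) z y))"
      using T unfolding T_def by blast
    show False using c[of y] that by simp
  qed
  then show ?thesis using g(1,2) by blast
qed

section \<open>Derivations\<close>

definition derivation_on :: "complex set \<Rightarrow> (complex \<Rightarrow> complex) \<Rightarrow> bool" where
  "derivation_on R D \<longleftrightarrow> subring_set R \<and>
     (\<forall>x\<in>R. \<forall>y\<in>R. D (x + y) = D x + D y \<and> D (x * y) = D x * y + x * D y)"

lemma derivation_onD:
  assumes "derivation_on R D"
  shows "subring_set R" "x \<in> R \<Longrightarrow> y \<in> R \<Longrightarrow> D (x + y) = D x + D y"
    "x \<in> R \<Longrightarrow> y \<in> R \<Longrightarrow> D (x * y) = D x * y + x * D y"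
    "D 0 = 0"
proof -
  show sub: "subring_set R" using assms by (simp add: derivation_on_def)
  show add: "x \<in> R \<Longrightarrow> y \<in> R \<Longrightarrow> D (x + y) = D x + D y" for x y
    using assms by (simp add: derivation_on_def)
  show "x \<in> R \<Longrightarrow> y \<in> R \<Longrightarrow> D (x * y) = D x * y + x * D y"
    using assms by (simp add: derivation_on_def)
  show "D 0 = 0" using add[of 0 0] subring_set_0[OF sub] by simp
qed

lemma derivation_sum:
  assumes "derivation_on R D" "\<And>i. i \<in> I \<Longrightarrow> f i \<in> R"
  shows "D (sum f I) = (\<Sum>i\<in>I. D (f i))"
  using assms(2)
proof (induction I rule: infinite_finite_induct)
  case (insert i I)
  then show ?case
    using derivation_onD(2)[OF assms(1), of "f i" "sum f I"] subring_set_sum[OF derivation_onD(1)[OF assms(1)], of I f]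
    by simp
qed (auto simp: derivation_onD(4)[OF assms(1)])

text \<open>The term with \<open>D 1\<close> makes the empty product obey the same formula, so the
  induction starts without knowing the value \<open>D 1\<close>.\<close>

lemma derivation_prod:
  assumes "derivation_on R D" "\<And>i. i \<in> I \<Longrightarrow> f i \<in> R" "finite I"
  shows "D (prod f I) = D 1 * prod f I + (\<Sum>i\<in>I. D (f i) * prod f (I - {i}))"
  using assms(3,2)
proof (induction I rule: finite_induct)
  case (insert k I)
  have "prod f (insert k I - {i}) = f k * prod f (I - {i})" if "i \<in> I" for i
  proof -
    have "insert k I - {i} = insert k (I - {i})" using insert.hyps that by auto
    then show ?thesis using insert.hyps by simp
  qed
  then have "(\<Sum>i\<in>I. D (f i) * prod f (insert k I - {i})) = (\<Sum>i\<in>I. f k * (D (f i) * prod f (I - {i})))"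
    by (intro sum.cong) auto
  moreover have "insert k I - {k} = I" using insert.hyps by auto
  moreover have "D (f k * prod f I) = D (f k) * prod f I + f k * D (prod f I)"
    using insert.prems subring_set_prod[OF derivation_onD(1)[OF assms(1)], of I f]
    by (intro derivation_onD(3)[OF assms(1)]) auto
  ultimately show ?case using insert by (simp add: algebra_simps sum_distrib_left)
qed simp

lemma derivation_one: "derivation_on R D \<Longrightarrow> D 1 = 0"
  using derivation_onD(3)[of R D 1 1] subring_set_1[OF derivation_onD(1)[of R D]] by simp

text \<open>The derivation extends to \<open>R[a]\<close> as soon as the prescribed value at \<open>a\<close> is consistent with all
  polynomial relations over \<open>R\<close> satisfied by \<open>a\<close>; if there is a relation, one of minimal degree
  determines that value and implies consistency with all others by pseudo-division.\<close>

lemma derivation_extend_consistent: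
  assumes D: "derivation_on R D"
    and cons: "\<And>p. (\<forall>i. coeff p i \<in> R) \<Longrightarrow> poly p a = 0 \<Longrightarrow>
      poly (map_poly D p) a + poly (pderiv p) a * \<eta> = 0"
  shows "\<exists>R' D'. derivation_on R' D' \<and> R \<subseteq> R' \<and> a \<in> R' \<and> (\<forall>x\<in>R. D' x = D x) \<and> D' a = \<eta>"
proof -
  note sub = derivation_onD(1)[OF D]
  note RD = subring_setD[OF sub]
  define E where "E p = poly (map_poly D p) a + poly (pderiv p) a * \<eta>" for p
  define P where "P p \<longleftrightarrow> (\<forall>i. coeff p i \<in> R)" for p :: "complex poly"
  have coeffD: "coeff (map_poly D p) i = D (coeff p i)" for p i
    by (rule coeff_map_poly) (rule derivation_onD(4)[OF D])
  have Padd: "P (p + q)" and Pdiff: "P (p - q)" and Pmult: "P (p * q)" if "P p" "P q" for p q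
    using that by (auto simp: P_def coeff_mult RD intro!: subring_set_sum[OF sub])
  have Eadd: "E (p + q) = E p + E q" if "P p" "P q" for p q
  proof -
    have "map_poly D (p + q) = map_poly D p + map_poly D q"
      by (rule poly_eqI) (use that in \<open>simp add: coeffD P_def derivation_onD(2)[OF D]\<close>)
    then show ?thesis by (simp add: E_def pderiv_add algebra_simps)
  qed
  have Emult: "E (p * q) = E p * poly q a + poly p a * E q" if "P p" "P q" for p q
  proof -
    have "map_poly D (p * q) = map_poly D p * q + p * map_poly D q"
    proof (rule poly_eqI)
      fix n
      have "D (\<Sum>i\<le>n. coeff p i * coeff q (n - i)) = (\<Sum>i\<le>n. D (coeff p i * coeff q (n - i)))"
        by (rule derivation_sum[OF D]) (use that in \<open>auto simp: P_def RD\<close>)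
      also have "\<dots> = (\<Sum>i\<le>n. D (coeff p i) * coeff q (n - i) + coeff p i * D (coeff q (n - i)))"
        by (intro sum.cong refl derivation_onD(3)[OF D]) (use that in \<open>auto simp: P_def\<close>)
      finally show "coeff (map_poly D (p * q)) n = coeff (map_poly D p * q + p * map_poly D q) n"
        by (simp add: coeffD coeff_mult sum.distrib)
    qed
    then show ?thesis by (simp add: E_def pderiv_mult algebra_simps)
  qed
  \<comment> \<open>Consistency for the difference of two representatives makes \<open>E\<close>
    depend only on the value at \<open>a\<close>, so \<open>D'\<close> may choose any
    representative.\<close>
  have well: "E p = E q" if "P p" "P q" "poly p a = poly q a" for p q
  proof -
    have "E (p - q) = 0" using cons[of "p - q"] Pdiff[OF that(1,2)] that(3) by (simp add: E_def P_def)
    then show ?thesis using Eadd[of "p - q" q] Pdiff[OF that(1,2)] that by simp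
  qed
  define R' where "R' = {poly p a | p. P p}"
  define D' where "D' x = E (SOME p. P p \<and> poly p a = x)" for x
  have D': "D' (poly p a) = E p" if "P p" for p
  proof -
    have "P (SOME q. P q \<and> poly q a = poly p a) \<and> poly (SOME q. P q \<and> poly q a = poly p a) a = poly p a"
      by (rule someI[of _ p]) (use that in auto)
    then show ?thesis unfolding D'_def using that by (intro well) auto
  qed
  have Pc: "P [:c:]" if "c \<in> R" for c using that RD(2) by (auto simp: P_def coeff_pCons split: nat.split)
  have PX: "P [:0, 1:]" using RD(1,2) by (auto simp: P_def coeff_pCons split: nat.split)
  have "derivation_on R' D'"
    unfolding derivation_on_def subring_set_def
  proof (intro conjI ballI)
    show "1 \<in> R'" unfolding R'_def using Pc[OF RD(1)] by force
    fix x y assume "x \<in> R'" "y \<in> R'"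
    then obtain p q where pq: "P p" "P q" "x = poly p a" "y = poly q a" unfolding R'_def by auto
    show "x - y \<in> R'" unfolding R'_def using pq Pdiff[of p q] by (intro CollectI exI[of _ "p - q"]) auto
    show "x * y \<in> R'" unfolding R'_def using pq Pmult[of p q] by (intro CollectI exI[of _ "p * q"]) auto
    show "D' (x + y) = D' x + D' y"
      using D'[OF Padd[OF pq(1,2)]] D'[OF pq(1)] D'[OF pq(2)] Eadd[OF pq(1,2)] pq by simp
    show "D' (x * y) = D' x * y + x * D' y"
      using D'[OF Pmult[OF pq(1,2)]] D'[OF pq(1)] D'[OF pq(2)] Emult[OF pq(1,2)] pq by simp
  qed
  moreover have "R \<subseteq> R'" unfolding R'_def
  proof
    fix c assume "c \<in> R"
    then show "c \<in> {poly p a |p. P p}" using Pc[of c] by (intro CollectI exI[of _ "[:c:]"]) auto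
  qed
  moreover have "a \<in> R'" unfolding R'_def using PX by (intro CollectI exI[of _ "[:0, 1:]"]) auto
  moreover have "D' c = D c" if "c \<in> R" for c
    using D'[OF Pc[OF that]] by (simp add: E_def map_poly_pCons derivation_onD(4)[OF D])
  moreover have "D' a = \<eta>"
  proof -
    have "map_poly D [:0, 1:] = 0"
      using derivation_one[OF D] by (simp add: map_poly_pCons derivation_onD(4)[OF D])
    then show ?thesis using D'[OF PX] by (simp add: E_def pderiv_pCons)
  qed
  ultimately show ?thesis by blast
qed

lemma derivation_extend:
  assumes D: "derivation_on R D"
  shows "\<exists>R' D'. derivation_on R' D' \<and> R \<subseteq> R' \<and> a \<in> R' \<and> (\<forall>x\<in>R. D' x = D x)"
proof -
  note sub = derivation_onD(1)[OF D]
  note RD = subring_setD[OF sub]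
  define P where "P p \<longleftrightarrow> (\<forall>i. coeff p i \<in> R)" for p :: "complex poly"
  show ?thesis
  proof (cases "\<exists>p. P p \<and> p \<noteq> 0 \<and> poly p a = 0")
    case False
    have "\<exists>R' D'. derivation_on R' D' \<and> R \<subseteq> R' \<and> a \<in> R' \<and> (\<forall>x\<in>R. D' x = D x) \<and> D' a = 0"
      by (rule derivation_extend_consistent[OF D]) (use False in \<open>auto simp: P_def\<close>)
    then show ?thesis by blast
  next
    case True
    then obtain p where p: "P p \<and> p \<noteq> 0 \<and> poly p a = 0"
      and min: "\<And>q. P q \<and> q \<noteq> 0 \<and> poly q a = 0 \<Longrightarrow> degree p \<le> degree q"
      using ex_has_least_nat[of "\<lambda>p. P p \<and> p \<noteq> 0 \<and> poly p a = 0" _ degree] by blast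
    define dp where "dp = poly (pderiv p) a"
    have "degree p \<noteq> 0"
    proof
      assume "degree p = 0"
      then obtain c where "p = [:c:]" by (metis degree_eq_zeroE)
      then show False using p by auto
    qed
    have "P (pderiv p)" unfolding P_def
    proof
      fix i
      have of_nat_mem: "of_nat n \<in> R" for n
        by (induction n) (auto intro: RD)
      have "of_nat (Suc i) \<in> R" by (rule of_nat_mem)
      then show "coeff (pderiv p) i \<in> R" using p by (auto simp: coeff_pderiv P_def intro!: RD)
    qed
    moreover have "pderiv p \<noteq> 0" using \<open>degree p \<noteq> 0\<close> by (simp add: pderiv_eq_0_iff)
    \<comment> \<open>In characteristic zero the derivative is a nonzero polynomial over
      \<open>R\<close> of smaller degree, so by minimality of \<open>p\<close> it cannot vanish at
      \<open>a\<close>. Hence the equation \<open>E p = 0\<close> can be solved for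
      \<open>\<eta>\<close>.\<close>
    ultimately have "dp \<noteq> 0"
      using min[of "pderiv p"] \<open>degree p \<noteq> 0\<close> by (auto simp: dp_def degree_pderiv)
    define \<eta> where "\<eta> = - poly (map_poly D p) a / dp"
    define E where "E q = poly (map_poly D q) a + poly (pderiv q) a * \<eta>" for q
    have coeffD: "coeff (map_poly D q) i = D (coeff q i)" for q i
      by (rule coeff_map_poly) (rule derivation_onD(4)[OF D])
    have Ep: "E p = 0" using \<open>dp \<noteq> 0\<close> by (simp add: E_def \<eta>_def dp_def)
    have "E q = 0" if "P q" "poly q a = 0" for q
      using that
    proof (induction "degree q" arbitrary: q rule: less_induct)
      case less
      show ?case
      proof (cases "q = 0")
        case True
        then show ?thesis by (simp add: E_def)
      next
        case False
        then have le: "degree p \<le> degree q" using min less.prems by blast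
        define k where "k = degree q - degree p"
        \<comment> \<open>Pseudo-division: \<open>R\<close> is only a ring, so \<open>q\<close> is
          scaled by the leading coefficient of \<open>p\<close> instead of dividing by it. That
          nonzero factor reappears in front of \<open>E q\<close> and is cancelled.\<close>
        define r where "r = smult (lead_coeff p) q - monom (lead_coeff q) k * p"
        have Pr: "P r" unfolding P_def r_def
        proof
          fix i
          show "coeff (smult (lead_coeff p) q - monom (lead_coeff q) k * p) i \<in> R"
            using p less.prems by (auto simp: coeff_monom_mult P_def RD intro!: RD)
        qed
        have r0: "poly r a = 0" using p less.prems by (simp add: r_def)
        have "degree r < degree q"
        proof -
          have "degree r \<le> degree q" unfolding r_def
          proof (rule degree_diff_le)
            show "degree (monom (lead_coeff q) k * p) \<le> degree q"
              by (rule order_trans[OF degree_mult_le])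
                (use le degree_monom_le[of "lead_coeff q" k] in \<open>auto simp: k_def\<close>)
          qed (rule degree_smult_le)
          moreover have "coeff r (degree q) = 0" using le by (simp add: r_def k_def coeff_monom_mult)
          moreover have "degree q \<noteq> 0" using le \<open>degree p \<noteq> 0\<close> by simp
          ultimately show ?thesis by (metis le_neq_implies_less leading_coeff_0_iff degree_0)
        qed
        then have Er: "E r = 0" using less.hyps Pr r0 by blast
        have mapr: "map_poly D r = smult (D (lead_coeff p)) q + smult (lead_coeff p) (map_poly D q)
            - monom (D (lead_coeff q)) k * p - monom (lead_coeff q) k * map_poly D p"
        proof (rule poly_eqI)
          fix i
          have Ddiff: "D (x - y) = D x - D y" if "x \<in> R" "y \<in> R" for x y
            using derivation_onD(2)[OF D, of "x - y" y] that RD by simp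
          have mem: "coeff p j \<in> R" "coeff q j \<in> R" for j using p less.prems by (auto simp: P_def)
          have "coeff (map_poly D r) i = D (lead_coeff p * coeff q i) -
              D (if i < k then 0 else lead_coeff q * coeff p (i - k))"
            unfolding coeffD r_def coeff_diff coeff_smult coeff_monom_mult using mem
            by (subst Ddiff) (auto intro: RD)
          then show "coeff (map_poly D r) i = coeff (smult (D (lead_coeff p)) q + smult (lead_coeff p) (map_poly D q)
            - monom (D (lead_coeff q)) k * p - monom (lead_coeff q) k * map_poly D p) i"
            using mem by (auto simp: coeff_monom_mult coeffD derivation_onD(3,4)[OF D])
        qed
        have pdr: "pderiv r = smult (lead_coeff p) (pderiv q) - pderiv (monom (lead_coeff q) k) * p
            - monom (lead_coeff q) k * pderiv p"
          by (simp add: r_def pderiv_diff pderiv_smult pderiv_mult algebra_simps)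
        have "E r = lead_coeff p * E q - poly (monom (lead_coeff q) k) a * E p"
          unfolding E_def mapr pdr using p less.prems by (simp add: algebra_simps)
        then show ?thesis using Er Ep p by simp
      qed
    qed
    then have "\<exists>R' D'. derivation_on R' D' \<and> R \<subseteq> R' \<and> a \<in> R' \<and> (\<forall>x\<in>R. D' x = D x) \<and> D' a = \<eta>"
      by (intro derivation_extend_consistent[OF D]) (auto simp: P_def E_def)
    then show ?thesis by blast
  qed
qed

lemma derivation_extend_finite:
  assumes "finite K" "derivation_on R D"
  shows "\<exists>R' D'. derivation_on R' D' \<and> R \<subseteq> R' \<and> K \<subseteq> R' \<and> (\<forall>x\<in>R. D' x = D x)"
  using assms(1)
proof (induction K rule: finite_induct)
  case empty
  then show ?case using assms(2) by auto
next
  case (insert a K)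
  then obtain R' D' where R': "derivation_on R' D'" "R \<subseteq> R'" "K \<subseteq> R'" "\<forall>x\<in>R. D' x = D x" by blast
  obtain R'' D'' where "derivation_on R'' D''" "R' \<subseteq> R''" "a \<in> R''" "\<forall>x\<in>R'. D'' x = D' x"
    using derivation_extend[OF R'(1), of a] by blast
  then show ?case using R' by (intro exI[of _ R''] exI[of _ D'']) auto
qed

text \<open>Over \<open>k\<close> the element \<open>s\<close> satisfies no relation, so any value
  is consistent with the zero derivation. The derivation is built only on a subring containing
  \<open>k\<close>, \<open>s\<close> and a finite set \<open>K\<close>; later \<open>K\<close> holds
  the coordinates of a solution, whose derivatives stay unspecified.\<close>

lemma transcendental_derivation:
  assumes "subring_set k" "finite K"
    and trans: "\<And>p. (\<forall>i. coeff p i \<in> k) \<Longrightarrow> poly p s = 0 \<Longrightarrow> p = 0"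
  shows "\<exists>R D. derivation_on R D \<and> k \<subseteq> R \<and> s \<in> R \<and> K \<subseteq> R \<and> (\<forall>x\<in>k. D x = 0) \<and> D s = 1"
proof -
  have "derivation_on k (\<lambda>_. 0)" using assms(1) by (simp add: derivation_on_def)
  then have "\<exists>R D. derivation_on R D \<and> k \<subseteq> R \<and> s \<in> R \<and> (\<forall>x\<in>k. D x = 0) \<and> D s = 1"
    by (rule derivation_extend_consistent) (use trans in fastforce)
  then obtain R D where R: "derivation_on R D" "k \<subseteq> R" "s \<in> R" "\<forall>x\<in>k. D x = 0" "D s = 1" by blast
  obtain R' D' where "derivation_on R' D'" "R \<subseteq> R'" "K \<subseteq> R'" "\<forall>x\<in>R. D' x = D x"
    using derivation_extend_finite[OF assms(2) R(1)] by blast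
  then show ?thesis using R by (intro exI[of _ R'] exI[of _ D']) auto
qed

section \<open>Projective closed sets and chains\<close>

definition proj_zeros :: "('n::finite, complex) mpoly set \<Rightarrow> (complex ^ 'n) set set" where
  "proj_zeros S = {proj_point x | x. x \<noteq> 0 \<and> (\<forall>p\<in>S. poly_eval p x = 0)}"

lemma proj_closed_iff: "proj_closed Z \<longleftrightarrow> (\<exists>S. (\<forall>p\<in>S. homogeneous p) \<and> Z = proj_zeros S)"
  by (simp add: proj_closed_def proj_zeros_def)

lemma mono_eval_scale:
  "mono_eval m (c *s x) = c ^ (\<Sum>i\<in>UNIV. Poly_Mapping.lookup m i) * mono_eval m (x :: 'a::comm_semiring_1 ^ 'n::finite)"
  by (simp add: mono_eval_def power_mult_distrib prod.distrib power_sum)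

lemma homogeneous_scale:
  fixes p :: "('n::finite, complex) mpoly"
  assumes "homogeneous p"
  shows "\<exists>k. \<forall>c x. poly_eval p (c *s x) = c ^ k * poly_eval p x"
proof -
  obtain k where k: "\<forall>m\<in>Poly_Mapping.keys p. (\<Sum>i\<in>UNIV. Poly_Mapping.lookup m i) = k"
    using assms by (auto simp: homogeneous_def)
  have "poly_eval p (c *s x) = c ^ k * poly_eval p x" for c x
    unfolding poly_eval_superset[OF finite_keys order_refl] sum_distrib_left
    by (intro sum.cong refl) (use k in \<open>simp add: mono_eval_scale\<close>)
  then show ?thesis by blast
qed

lemma proj_point_eqD:
  assumes "proj_point x = proj_point y" "y \<noteq> 0"
  shows "\<exists>c. c \<noteq> 0 \<and> y = c *s x"
proof -
  have "y \<in> proj_point y" unfolding proj_point_def by (rule range_eqI[of _ _ 1]) simp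
  then obtain c where "y = c *s x" using assms(1) by (auto simp: proj_point_def)
  then show ?thesis using assms(2) by (intro exI[of _ c]) auto
qed

text \<open>Rescaling multiplies a homogeneous polynomial by a power of the scalar, so vanishing
  does not depend on the representative.\<close>

lemma mem_proj_zeros:
  assumes "\<forall>p\<in>S. homogeneous p" "x \<noteq> 0"
  shows "proj_point x \<in> proj_zeros S \<longleftrightarrow> (\<forall>p\<in>S. poly_eval p x = 0)"
proof
  assume "proj_point x \<in> proj_zeros S"
  then obtain x' where x': "x' \<noteq> 0" "\<forall>p\<in>S. poly_eval p x' = 0" "proj_point x' = proj_point x"
    unfolding proj_zeros_def by force
  then obtain c where "x = c *s x'" using proj_point_eqD[OF x'(3) assms(2)] by blast
  then show "\<forall>p\<in>S. poly_eval p x = 0"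
    using homogeneous_scale assms(1) x'(2) by (metis mult_zero_right)
next
  assume "\<forall>p\<in>S. poly_eval p x = 0"
  then show "proj_point x \<in> proj_zeros S" using assms(2) unfolding proj_zeros_def by blast
qed

lemma proj_closedE:
  assumes "proj_closed Z"
  obtains S where "\<forall>p\<in>S. homogeneous p" "Z = proj_zeros S"
    "\<And>x. x \<noteq> 0 \<Longrightarrow> proj_point x \<in> Z \<longleftrightarrow> (\<forall>p\<in>S. poly_eval p x = 0)"
  using assms unfolding proj_closed_iff by (metis mem_proj_zeros)

lemma proj_closed_pointE:
  assumes "proj_closed Z" "P \<in> Z"
  obtains x where "x \<noteq> 0" "P = proj_point x"
  using assms unfolding proj_closed_def by blast

lemma proj_closed_subsetI:
  assumes "proj_closed Z" "\<And>x. x \<noteq> 0 \<Longrightarrow> proj_point x \<in> Z \<Longrightarrow> proj_point x \<in> Z'"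
  shows "Z \<subseteq> Z'"
proof
  fix P assume "P \<in> Z"
  moreover from this obtain x where "x \<noteq> 0" "P = proj_point x" by (rule proj_closed_pointE[OF assms(1)])
  ultimately show "P \<in> Z'" using assms(2) by simp
qed

lemma homogeneous_mult:
  fixes p q :: "('n::finite, complex) mpoly"
  assumes "homogeneous p" "homogeneous q" shows "homogeneous (p * q)"
proof -
  obtain k l where k: "\<forall>m\<in>Poly_Mapping.keys p. (\<Sum>i\<in>UNIV. Poly_Mapping.lookup m i) = k"
    and l: "\<forall>m\<in>Poly_Mapping.keys q. (\<Sum>i\<in>UNIV. Poly_Mapping.lookup m i) = l"
    using assms by (auto simp: homogeneous_def)
  have "(\<Sum>i\<in>UNIV. Poly_Mapping.lookup m i) = k + l" if m: "m \<in> Poly_Mapping.keys (p * q)" for m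
  proof -
    obtain a b where "m = a + b" "a \<in> Poly_Mapping.keys p" "b \<in> Poly_Mapping.keys q"
      using subsetD[OF keys_mult m] by auto
    then show ?thesis using k l by (simp add: lookup_add sum.distrib)
  qed
  then show ?thesis unfolding homogeneous_def by blast
qed

lemma proj_closed_Un:
  assumes "proj_closed A" "proj_closed B" shows "proj_closed (A \<union> B)"
proof -
  obtain S where S: "\<forall>p\<in>S. homogeneous p" "A = proj_zeros S"
    "\<And>x. x \<noteq> 0 \<Longrightarrow> proj_point x \<in> A \<longleftrightarrow> (\<forall>p\<in>S. poly_eval p x = 0)" by (rule proj_closedE[OF assms(1)]) (rule that; blast)
  obtain T where T: "\<forall>p\<in>T. homogeneous p" "B = proj_zeros T"
    "\<And>x. x \<noteq> 0 \<Longrightarrow> proj_point x \<in> B \<longleftrightarrow> (\<forall>p\<in>T. poly_eval p x = 0)" by (rule proj_closedE[OF assms(2)]) (rule that; blast)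
  define R where "R = {p * q | p q. p \<in> S \<and> q \<in> T}"
  have R: "\<forall>p\<in>R. homogeneous p" using S(1) T(1) homogeneous_mult unfolding R_def by blast
  have eqv: "proj_point x \<in> A \<union> B \<longleftrightarrow> (\<forall>p\<in>R. poly_eval p x = 0)" if x: "x \<noteq> 0" for x
  proof
    show "proj_point x \<in> A \<union> B \<Longrightarrow> \<forall>p\<in>R. poly_eval p x = 0"
      using S(3)[OF x] T(3)[OF x] by (auto simp: R_def poly_eval_mult)
    assume R0: "\<forall>p\<in>R. poly_eval p x = 0"
    show "proj_point x \<in> A \<union> B"
    proof (rule ccontr)
      assume "proj_point x \<notin> A \<union> B"
      then obtain p q where "p \<in> S" "q \<in> T" "poly_eval p x \<noteq> 0" "poly_eval q x \<noteq> 0"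
        using S(3)[OF x] T(3)[OF x] by blast
      moreover have "poly_eval (p * q) x = 0" using R0 calculation(1,2) by (auto simp: R_def)
      ultimately show False by (simp add: poly_eval_mult)
    qed
  qed
  have "A \<union> B = proj_zeros R"
  proof (rule equalityI)
    show "proj_zeros R \<subseteq> A \<union> B" using eqv unfolding proj_zeros_def by blast
    have "A \<subseteq> proj_zeros R" "B \<subseteq> proj_zeros R"
      by (rule proj_closed_subsetI[OF assms(1)] proj_closed_subsetI[OF assms(2)];
          use eqv mem_proj_zeros[OF R] in blast)+
    then show "A \<union> B \<subseteq> proj_zeros R" by blast
  qed
  then show ?thesis unfolding proj_closed_iff using R by (intro exI[of _ R]) auto
qed

lemma proj_closed_Int:
  assumes "proj_closed A" "proj_closed B" shows "proj_closed (A \<inter> B)"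
proof -
  obtain S where S: "\<forall>p\<in>S. homogeneous p" "A = proj_zeros S"
    "\<And>x. x \<noteq> 0 \<Longrightarrow> proj_point x \<in> A \<longleftrightarrow> (\<forall>p\<in>S. poly_eval p x = 0)" by (rule proj_closedE[OF assms(1)]) (rule that; blast)
  obtain T where T: "\<forall>p\<in>T. homogeneous p" "B = proj_zeros T"
    "\<And>x. x \<noteq> 0 \<Longrightarrow> proj_point x \<in> B \<longleftrightarrow> (\<forall>p\<in>T. poly_eval p x = 0)" by (rule proj_closedE[OF assms(2)]) (rule that; blast)
  have "A \<inter> B = proj_zeros (S \<union> T)"
  proof (rule equalityI; rule subsetI)
    fix P assume P: "P \<in> A \<inter> B"
    then obtain x where x: "x \<noteq> 0" "P = proj_point x" by (auto elim: proj_closed_pointE[OF assms(1)])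
    have "\<forall>p\<in>S. poly_eval p x = 0" "\<forall>p\<in>T. poly_eval p x = 0"
      using P S(3)[OF x(1)] T(3)[OF x(1)] unfolding x(2) by simp_all
    then show "P \<in> proj_zeros (S \<union> T)"
      unfolding proj_zeros_def x(2) using x(1) by (intro CollectI exI[of _ x]) auto
  next
    fix P assume "P \<in> proj_zeros (S \<union> T)"
    then obtain x where "x \<noteq> 0" "P = proj_point x" "\<forall>p\<in>S \<union> T. poly_eval p x = 0"
      unfolding proj_zeros_def by blast
    then show "P \<in> A \<inter> B" using S(3) T(3) by auto
  qed
  then show ?thesis unfolding proj_closed_iff using S(1) T(1) by (intro exI[of _ "S \<union> T"]) auto
qed

lemma proj_closed_empty: "proj_closed ({} :: (complex ^ 'n::finite) set set)"
proof -
  have "homogeneous (1 :: ('n, complex) mpoly)" by (auto simp: homogeneous_def)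
  moreover have "{} = proj_zeros {1 :: ('n, complex) mpoly}" by (auto simp: proj_zeros_def)
  ultimately show ?thesis unfolding proj_closed_iff by blast
qed

lemma proj_closed_Union: "finite F \<Longrightarrow> (\<And>Y. Y \<in> F \<Longrightarrow> proj_closed Y) \<Longrightarrow> proj_closed (\<Union>F)"
  by (induction F rule: finite_induct) (auto intro: proj_closed_empty proj_closed_Un)

section \<open>Linear subspaces and points as projective closed sets\<close>

definition linear_mpoly :: "complex ^ 'n::finite \<Rightarrow> ('n, complex) mpoly" where
  "linear_mpoly a = (\<Sum>i\<in>UNIV. Poly_Mapping.single (Poly_Mapping.single i 1) (a $ i))"

lemma poly_eval_linear_mpoly: "poly_eval (linear_mpoly a) x = (\<Sum>i\<in>UNIV. a $ i * x $ i)"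
  by (simp add: linear_mpoly_def poly_eval_sum poly_eval_single)

lemma keys_sum_subset: "Poly_Mapping.keys (sum f A) \<subseteq> (\<Union>a\<in>A. Poly_Mapping.keys (f a))"
proof (induction A rule: infinite_finite_induct)
  case (insert a A)
  then show ?case using keys_add[of "f a" "sum f A"] by auto
qed auto

lemma homogeneous_linear_mpoly: "homogeneous (linear_mpoly a)"
  unfolding homogeneous_def
proof (intro exI[of _ 1] ballI)
  fix m assume "m \<in> Poly_Mapping.keys (linear_mpoly a)"
  then obtain i where "m \<in> Poly_Mapping.keys (Poly_Mapping.single (Poly_Mapping.single i (1::nat)) (a $ i))"
    unfolding linear_mpoly_def by (rule UN_E[OF subsetD[OF keys_sum_subset]])
  then have "m = Poly_Mapping.single i 1" by (auto split: if_splits)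
  then show "(\<Sum>i\<in>UNIV. Poly_Mapping.lookup m i) = 1" by (simp add: lookup_single when_def)
qed

lemma proj_closed_linear:
  "proj_closed {proj_point x | x. x \<noteq> 0 \<and> (\<forall>a\<in>L. (\<Sum>i\<in>UNIV. a $ i * x $ i) = 0)}"
  unfolding proj_closed_def
  by (rule exI[of _ "linear_mpoly ` L"]) (auto simp: homogeneous_linear_mpoly poly_eval_linear_mpoly)

lemma proj_irreducible_point:
  fixes x :: "complex ^ 'n::finite"
  assumes "x \<noteq> 0" shows "proj_irreducible {proj_point x}"
proof -
  \<comment> \<open>These forms are the 2 by 2 minors of the pair \<open>x\<close>,
    \<open>y\<close>; their common zeros are the multiples of \<open>x\<close>.\<close>
  let ?L = "range (\<lambda>(i, j). x $ j *s axis i 1 - x $ i *s axis j 1) :: (complex ^ 'n) set"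
  have ev: "(\<Sum>k\<in>UNIV. (x $ j * axis i 1 $ k - x $ i * axis j 1 $ k) * y $ k) = x $ j * y $ i - x $ i * y $ j"
    for i j and y :: "complex ^ 'n"
  proof -
    have "(\<Sum>k\<in>UNIV. (x $ j * axis i 1 $ k - x $ i * axis j 1 $ k) * y $ k) =
      (\<Sum>k\<in>UNIV. (if k = i then x $ j * y $ i else 0) - (if k = j then x $ i * y $ j else 0))"
      by (intro sum.cong) (auto simp: axis_def)
    then show ?thesis by (simp add: sum_subtractf)
  qed
  have "{proj_point x} = {proj_point y | y. y \<noteq> 0 \<and> (\<forall>a\<in>?L. (\<Sum>i\<in>UNIV. a $ i * y $ i) = 0)}" (is "_ = ?R")
  proof (rule equalityI; rule subsetI)
    fix P assume "P \<in> {proj_point x}"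
    then have "P = proj_point x" by simp
    then show "P \<in> ?R" using assms by (intro CollectI exI[of _ x]) (auto simp: ev)
  next
    fix P assume "P \<in> ?R"
    then obtain y where y: "y \<noteq> 0" "P = proj_point y" "\<And>i j. x $ j * y $ i - x $ i * y $ j = 0"
      by (auto simp: ev)
    obtain j where j: "x $ j \<noteq> 0" using assms by (auto simp: vec_eq_iff)
    define c where "c = y $ j / x $ j"
    have yc: "y = c *s x" using y(3)[of j] j by (auto simp: vec_eq_iff c_def field_simps)
    then have "c \<noteq> 0" using y(1) by auto
    have "proj_point y = proj_point x"
    proof (rule equalityI; rule subsetI)
      fix w assume "w \<in> proj_point y"
      then show "w \<in> proj_point x" unfolding proj_point_def yc by (auto simp: vector_smult_assoc)
    next
      fix w assume "w \<in> proj_point x"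
      then obtain b where "w = b *s x" by (auto simp: proj_point_def)
      then have "w = (b / c) *s y" using \<open>c \<noteq> 0\<close> by (simp add: yc vector_smult_assoc)
      then show "w \<in> proj_point y" by (auto simp: proj_point_def)
    qed
    then show "P \<in> {proj_point x}" using y(2) by simp
  qed
  then have "proj_closed {proj_point x}" using proj_closed_linear[of ?L] by simp
  moreover have irr: "{proj_point x} = A \<or> {proj_point x} = B" if "{proj_point x} = A \<union> B" for A B
  proof -
    have "A = {} \<or> A = {proj_point x}" "B = {} \<or> B = {proj_point x}"
      by (rule subset_singletonD, subst that, simp)+
    then show ?thesis using that by auto
  qed
  ultimately show ?thesis unfolding proj_irreducible_def
    by (intro conjI allI impI) (assumption, rule insert_not_empty, elim conjE, rule irr)
qed

text \<open>A descending sequence of closed sets has ascending vanishing ideals. By Hilbert's basis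
  theorem these become stationary, and a closed set is recovered from the polynomials that vanish on
  it.\<close>

lemma proj_closed_dcc: "wf {(Z, Z'). proj_closed Z \<and> proj_closed Z' \<and> Z \<subset> (Z' :: (complex ^ 'n::finite) set set)}"
  unfolding wf_iff_no_infinite_down_chain
proof
  assume "\<exists>f. \<forall>i. (f (Suc i), f i) \<in> {(Z, Z'). proj_closed Z \<and> proj_closed Z' \<and> Z \<subset> (Z' :: (complex ^ 'n) set set)}"
  then obtain f :: "nat \<Rightarrow> (complex ^ 'n) set set"
    where "\<forall>i. (f (Suc i), f i) \<in> {(Z, Z'). proj_closed Z \<and> proj_closed Z' \<and> Z \<subset> Z'}" ..
  then have f: "proj_closed (f i)" "f (Suc i) \<subset> f i" for i by auto
  define I where "I k = {p. \<forall>x. x \<noteq> 0 \<and> proj_point x \<in> f k \<longrightarrow> poly_eval p x = 0}" for k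
  have Iid: "ideal_of UNIV (I k)" for k
    by (auto simp: ideal_of_def I_def poly_eval_add poly_eval_mult)
  have mono: "I j \<subseteq> I k" if "j \<le> k" for j k
  proof -
    have "f k \<subseteq> f j" using lift_Suc_antimono_le[of f j k] f(2) that by (meson psubset_imp_subset)
    then show ?thesis unfolding I_def by blast
  qed
  have "ideal_of UNIV (\<Union>k. I k)"
    unfolding ideal_of_def
  proof (intro conjI ballI)
    show "0 \<in> (\<Union>k. I k)" using ideal_ofD(2)[OF Iid] by blast
    fix x y assume "x \<in> (\<Union>k. I k)" "y \<in> (\<Union>k. I k)"
    then obtain j k where "x \<in> I j" "y \<in> I k" by auto
    then have "x \<in> I (max j k)" "y \<in> I (max j k)" using mono[of j "max j k"] mono[of k "max j k"] by auto
    then show "x + y \<in> (\<Union>k. I k)" using ideal_ofD(3)[OF Iid] by blast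
  next
    fix a x assume "x \<in> (\<Union>k. I k)"
    then show "a * x \<in> (\<Union>k. I k)" using ideal_ofD(4)[OF Iid] by blast
  qed auto
  then obtain S where S: "S \<subseteq> (\<Union>k. I k)" "finite S" "\<forall>J. ideal_of UNIV J \<and> S \<subseteq> J \<longrightarrow> (\<Union>k. I k) \<subseteq> J"
    using noetherian_mpoly unfolding noetherian_def by meson
  have "\<exists>k. S \<subseteq> I k"
    using S(2,1)
  proof (induction S rule: finite_induct)
    case (insert s S)
    then obtain j k where "s \<in> I j" "S \<subseteq> I k" by auto
    then show ?case using mono[of j "max j k"] mono[of k "max j k"] by (intro exI[of _ "max j k"]) auto
  qed auto
  then obtain k where "S \<subseteq> I k" by blast
  then have sub: "I (Suc k) \<subseteq> I k" using S(3) Iid[of k] by blast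
  obtain T where T: "\<forall>p\<in>T. homogeneous p" "f (Suc k) = proj_zeros T"
    "\<And>x. x \<noteq> 0 \<Longrightarrow> proj_point x \<in> f (Suc k) \<longleftrightarrow> (\<forall>p\<in>T. poly_eval p x = 0)"
    by (rule proj_closedE[OF f(1)]) (rule that; blast)
  have "T \<subseteq> I (Suc k)" using T(3) by (auto simp: I_def)
  then have "T \<subseteq> I k" using sub by blast
  then have "f k \<subseteq> f (Suc k)"
    using T(3) by (intro proj_closed_subsetI[OF f(1)]) (auto simp: I_def)
  then show False using f(2)[of k] by blast
qed

text \<open>Noetherian induction: a reducible closed set is a union of two strictly smaller closed
  sets.\<close>

lemma proj_irreducible_decomposition:
  fixes Z :: "(complex ^ 'n::finite) set set"
  assumes "proj_closed Z"
  shows "\<exists>F. finite F \<and> (\<forall>Y\<in>F. proj_irreducible Y) \<and> Z = \<Union>F"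
  using assms
proof (induction Z rule: wf_induct_rule[OF proj_closed_dcc])
  case (1 Z)
  show ?case
  proof (cases "Z = {} \<or> proj_irreducible Z")
    case True
    then show ?thesis by (auto intro: exI[of _ "{}"] exI[of _ "{Z}"])
  next
    case False
    then obtain A B where AB: "proj_closed A" "proj_closed B" "Z = A \<union> B" "Z \<noteq> A" "Z \<noteq> B"
      using 1(2) unfolding proj_irreducible_def by blast
    then have "A \<subset> Z" "B \<subset> Z" by auto
    then obtain F G where "finite F" "\<forall>Y\<in>F. proj_irreducible Y" "A = \<Union>F"
      "finite G" "\<forall>Y\<in>G. proj_irreducible Y" "B = \<Union>G"
      using 1(1)[of A] 1(1)[of B] 1(2) AB(1,2) by auto
    then show ?thesis using AB(3) by (intro exI[of _ "F \<union> G"]) auto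
  qed
qed

lemma proj_irreducible_subset_Union:
  assumes "proj_irreducible C" "finite F" "\<forall>Y\<in>F. proj_closed Y" "C \<subseteq> \<Union>F"
  shows "\<exists>Y\<in>F. C \<subseteq> Y"
  using assms(2,3,4)
proof (induction F rule: finite_induct)
  case empty
  then show ?case using assms(1) by (auto simp: proj_irreducible_def)
next
  case (insert Y F)
  have C: "proj_closed C" using assms(1) by (simp add: proj_irreducible_def)
  have "proj_closed (C \<inter> Y)" "proj_closed (C \<inter> \<Union>F)"
    using insert by (auto intro!: proj_closed_Int C proj_closed_Union)
  moreover have "C = (C \<inter> Y) \<union> (C \<inter> \<Union>F)" using insert by auto
  ultimately have "C = C \<inter> Y \<or> C = C \<inter> \<Union>F" using assms(1) unfolding proj_irreducible_def by blast
  then have "C \<subseteq> Y \<or> C \<subseteq> \<Union>F" by blast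
  then show ?case using insert.IH insert.prems by auto
qed

text \<open>For a linear form \<open>h\<close> this says that the part of \<open>X\<close> off
  \<open>h = 0\<close> has Krull dimension less than \<open>r\<close>; testing the smallest member
  of a chain suffices, since the larger ones contain it. With the strict inequality,
  \<open>r = 0\<close> means that this part is empty.\<close>

definition chain_bound :: "(complex ^ 'n::finite) set set \<Rightarrow> (complex ^ 'n \<Rightarrow> complex) \<Rightarrow> nat \<Rightarrow> bool" where
  "chain_bound X h r \<longleftrightarrow> (\<forall>k C. (\<forall>i\<le>k. proj_irreducible (C i) \<and> C i \<subseteq> X) \<and> (\<forall>i<k. C i \<subset> C (Suc i)) \<and>
     (\<exists>x. x \<noteq> 0 \<and> proj_point x \<in> C 0 \<and> h x \<noteq> 0) \<longrightarrow> k < r)"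

text \<open>A chain inside the section lies in a component \<open>Y\<close> of \<open>X\<close>, and
  \<open>Y\<close> can be put on top of the chain unless the section contains all of
  \<open>Y\<close>. In that case \<open>c\<close> is the ratio of \<open>g\<close> and
  \<open>h\<close> at any point of \<open>Y\<close> with \<open>h\<close> nonzero, and one such
  ratio per component is placed in \<open>B\<close>.\<close>

lemma chain_bound_cut:
  fixes X :: "(complex ^ 'n::finite) set set"
  assumes X: "proj_closed X" "chain_bound X h r"
  shows "\<exists>B. finite B \<and> (\<forall>c H. c \<notin> B \<and> (\<forall>x. x \<noteq> 0 \<and> proj_point x \<in> H \<longrightarrow> g x = c * h x) \<longrightarrow>
     chain_bound (X \<inter> H) h (r - 1))"
proof -
  obtain F where F: "finite F" "\<forall>Y\<in>F. proj_irreducible Y" "X = \<Union>F"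
    using proj_irreducible_decomposition[OF X(1)] by blast
  define good where "good Y x \<longleftrightarrow> x \<noteq> 0 \<and> proj_point x \<in> Y \<and> h x \<noteq> 0" for Y x
  \<comment> \<open>Components inside \<open>h = 0\<close> have no good point, and \<open>pt\<close>
    is then arbitrary: this only adds a harmless value to \<open>B\<close>. The component used below
    does have one, namely \<open>x0\<close>.\<close>
  define pt where "pt Y = (SOME x. good Y x)" for Y
  define B where "B = (\<lambda>Y. g (pt Y) / h (pt Y)) ` F"
  have "chain_bound (X \<inter> H) h (r - 1)"
    if c: "c \<notin> B" and H: "\<forall>x. x \<noteq> 0 \<and> proj_point x \<in> H \<longrightarrow> g x = c * h x" for c H
    unfolding chain_bound_def
  proof (intro allI impI)
    fix k C
    assume "(\<forall>i\<le>k. proj_irreducible (C i) \<and> C i \<subseteq> X \<inter> H) \<and> (\<forall>i<k. C i \<subset> C (Suc i)) \<and>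
       (\<exists>x. x \<noteq> 0 \<and> proj_point x \<in> C 0 \<and> h x \<noteq> 0)"
    then have C: "\<And>i. i \<le> k \<Longrightarrow> proj_irreducible (C i)" "\<And>i. i \<le> k \<Longrightarrow> C i \<subseteq> X \<inter> H"
      "\<And>i. i < k \<Longrightarrow> C i \<subset> C (Suc i)" and "\<exists>x. good (C 0) x" by (auto simp: good_def)
    then obtain x0 where x0: "good (C 0) x0" by blast
    obtain Y where Y: "Y \<in> F" "C k \<subseteq> Y"
      using proj_irreducible_subset_Union[OF C(1)[of k] F(1)] F(2,3) C(2)[of k]
      by (auto simp: proj_irreducible_def)
    have "C i \<subseteq> C k" if "i \<le> k" for i
      using that
    proof (induction rule: inc_induct)
      case (step i)
      then show ?case using C(3)[of i] by auto
    qed simp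
    then have "good Y x0" using x0 Y(2) by (auto simp: good_def)
    then have pt: "good Y (pt Y)" unfolding pt_def by (rule someI)
    have "C k \<noteq> Y"
    proof
      assume "C k = Y"
      then have "proj_point (pt Y) \<in> H" using C(2)[of k] pt by (auto simp: good_def)
      then have "g (pt Y) = c * h (pt Y)" using H pt by (auto simp: good_def)
      then have "c = g (pt Y) / h (pt Y)" using pt by (auto simp: good_def)
      then show False using c Y(1) by (auto simp: B_def)
    qed
    define C' where "C' i = (if i \<le> k then C i else Y)" for i
    have "(\<forall>i\<le>Suc k. proj_irreducible (C' i) \<and> C' i \<subseteq> X) \<and> (\<forall>i<Suc k. C' i \<subset> C' (Suc i)) \<and>
       (\<exists>x. x \<noteq> 0 \<and> proj_point x \<in> C' 0 \<and> h x \<noteq> 0)"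
    proof (intro conjI allI impI)
      fix i assume "i \<le> Suc k"
      show "proj_irreducible (C' i)" using C(1)[of i] Y(1) F(2) by (auto simp: C'_def)
      show "C' i \<subseteq> X" using C(2)[of i] Y(1) F(3) by (auto simp: C'_def)
    next
      fix i assume "i < Suc k"
      then show "C' i \<subset> C' (Suc i)"
        using C(3)[of i] Y(2) \<open>C k \<noteq> Y\<close> by (cases "i = k") (auto simp: C'_def)
    next
      show "\<exists>x. x \<noteq> 0 \<and> proj_point x \<in> C' 0 \<and> h x \<noteq> 0" using x0 by (auto simp: good_def C'_def)
    qed
    then have "Suc k < r" using X(2) unfolding chain_bound_def by blast
    then show "k < r - 1" by simp
  qed
  then show ?thesis using F(1) by (intro exI[of _ B]) (auto simp: B_def)
qed

lemma chain_bound_0: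
  assumes "chain_bound X h 0" "x \<noteq> 0" "proj_point x \<in> X"
  shows "h x = 0"
proof (rule ccontr)
  assume "h x \<noteq> 0"
  then have "(0::nat) < 0"
    using assms proj_irreducible_point[OF assms(2)]
    unfolding chain_bound_def by (elim allE[of _ 0] allE[of _ "\<lambda>_. {proj_point x}"]) auto
  then show False by simp
qed

section \<open>Generic fibres of square-free forms\<close>

lemma chain_bound_mono: "chain_bound X h r \<Longrightarrow> X' \<subseteq> X \<Longrightarrow> chain_bound X' h r"
  unfolding chain_bound_def by (meson subset_trans)

lemma exists_not_in_countable:
  assumes "countable B" shows "\<exists>c::complex. c \<notin> B"
  using assms uncountable_UNIV_complex by (metis UNIV_eq_I)

text \<open>The sections \<open>\<tau> k = c k * \<tau> j0\<close> are imposed one at a time. Every section by a linear form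
  with \<open>k \<in> J\<close> shortens the chains through points with \<open>\<tau> j0 \<noteq> 0\<close>, unless it contains one of the
  finitely many irreducible components, which excludes at most one value of \<open>c k\<close> per component.\<close>

lemma generic_linear_section:
  fixes T S :: "complex ^ 'n::finite ^ 'n"
  assumes inv: "T ** S = mat 1"
    and X: "proj_closed X" "chain_bound X (\<lambda>x. (T *v x) $ j0) (card J)" and J: "j0 \<notin> J"
    and H: "countable H" "\<And>p. p \<in> H \<Longrightarrow> polyfun p \<and> (\<exists>z. p z \<noteq> 0)"
  shows "\<exists>z. (\<forall>p\<in>H. p z \<noteq> 0) \<and>
    (\<forall>x. x \<noteq> 0 \<and> proj_point x \<in> X \<longrightarrow> (\<exists>k\<in>insert j0 J. (T *v x) $ k \<noteq> (T *v z) $ k))"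
proof -
  define \<tau> where "\<tau> k x = (T *v x) $ k" for k x
  have tau_add: "\<tau> k (x + y) = \<tau> k x + \<tau> k y" and tau_smult: "\<tau> k (c *s x) = c * \<tau> k x" for k x y c
    by (simp_all add: \<tau>_def matrix_vector_right_distrib vector_scalar_commute)
  have inv': "S ** T = mat 1" using inv matrix_left_right_inverse by blast
  have TS: "\<tau> k (S *v y) = y $ k" for k y
    by (simp add: \<tau>_def matrix_vector_mul_assoc inv)
  have tau_inj: "x = y" if "\<And>k. \<tau> k x = \<tau> k y" for x y
  proof -
    have "T *v x = T *v y" using that by (simp add: \<tau>_def vec_eq_iff)
    then have "S *v (T *v x) = S *v (T *v y)" by simp
    then show ?thesis by (simp add: matrix_vector_mul_assoc inv')
  qed
  \<comment> \<open>The linear space on which the sections with indices in \<open>K\<close> hold;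
    \<open>PW\<close> is its projectivisation, used to cut \<open>X\<close>.\<close>
  define W where "W K c = {x. \<forall>k\<in>K. \<tau> k x = c k * \<tau> j0 x}" for K c
  define PW where "PW K c = {proj_point x | x. x \<noteq> 0 \<and> x \<in> W K c}" for K c
  have W_add: "x + t *s y \<in> W K c" if "x \<in> W K c" "y \<in> W K c" for x y t K c
    using that by (auto simp: W_def tau_add tau_smult algebra_simps)
  have PW_closed: "proj_closed (PW K c)" for K c
  proof -
    have "(\<Sum>i\<in>UNIV. (T $ k - c k *s T $ j0) $ i * x $ i) = \<tau> k x - c k * \<tau> j0 x" for k x
      by (simp add: \<tau>_def matrix_vector_mult_def algebra_simps sum_subtractf sum_distrib_left)
    then have "PW K c = {proj_point x | x. x \<noteq> 0 \<and> (\<forall>a\<in>(\<lambda>k. T $ k - c k *s T $ j0) ` K. (\<Sum>i\<in>UNIV. a $ i * x $ i) = 0)}"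
      by (simp add: PW_def W_def)
    then show ?thesis by (simp only: proj_closed_linear)
  qed
  have PW_D: "x \<in> W K c" if x: "x \<noteq> 0" "proj_point x \<in> PW K c" for x K c
  proof -
    obtain y where y: "proj_point y = proj_point x" "y \<in> W K c" using x(2) by (auto simp: PW_def)
    then obtain b where "x = b *s y" using proj_point_eqD[OF y(1) x(1)] by blast
    then show ?thesis using y(2) by (auto simp: W_def tau_smult)
  qed
  have PW_I: "proj_point x \<in> PW K c" if "x \<noteq> 0" "x \<in> W K c" for x K c
    using that by (auto simp: PW_def)
  \<comment> \<open>Move the witness inside \<open>W K c\<close> until \<open>\<tau> j0\<close> is
    nonzero. From there the direction \<open>v\<close> changes only \<open>\<tau> k\<close> and
    meets the next section for every \<open>b\<close>, at a parameter that is affine and injective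
    in \<open>b\<close>. Since \<open>p\<close> has finitely many zeros on this line, few
    \<open>b\<close> are bad.\<close>
  have avoid: "finite {b. \<forall>x\<in>W K c. \<tau> k x = b * \<tau> j0 x \<longrightarrow> p x = 0}"
    if p: "polyfun p" "w \<in> W K c" "p w \<noteq> 0" and k: "k \<notin> K" "k \<noteq> j0" "j0 \<notin> K" for p w K c k
  proof -
    define v0 where "v0 = S *v (\<chi> l. if l = j0 then 1 else if l \<in> K then c l else 0)"
    have v0: "v0 \<in> W K c" "\<tau> j0 v0 = 1" using k(3) by (auto simp: W_def v0_def TS)
    define v where "v = S *v axis k 1"
    have v: "v \<in> W K c" "\<tau> j0 v = 0" "\<tau> k v = 1" using k by (auto simp: W_def v_def TS axis_def)
    have "finite {t. p (w + t *s v0) = 0}"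
      by (rule polyfun_line_finite[OF p(1), where s = 0]) (use p(3) in simp)
    then have "finite (insert (- \<tau> j0 w) {t. p (w + t *s v0) = 0})" by simp
    then obtain t where t: "t \<notin> insert (- \<tau> j0 w) {t. p (w + t *s v0) = 0}"
      using ex_new_if_finite[OF infinite_UNIV_char_0] by blast
    define w' where "w' = w + t *s v0"
    have w': "w' \<in> W K c" "p w' \<noteq> 0" "\<tau> j0 w' \<noteq> 0"
      using t W_add[OF p(2) v0(1)] v0(2) by (auto simp: w'_def tau_add tau_smult add_eq_0_iff)
    have fin: "finite {s. p (w' + s *s v) = 0}"
      by (rule polyfun_line_finite[OF p(1), where s = 0]) (use w'(2) in simp)
    let ?\<phi> = "\<lambda>b. b * \<tau> j0 w' - \<tau> k w'"
    have "?\<phi> ` {b. \<forall>x\<in>W K c. \<tau> k x = b * \<tau> j0 x \<longrightarrow> p x = 0} \<subseteq> {s. p (w' + s *s v) = 0}"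
    proof (rule image_subsetI)
      fix b assume "b \<in> {b. \<forall>x\<in>W K c. \<tau> k x = b * \<tau> j0 x \<longrightarrow> p x = 0}"
      moreover have "\<tau> k (w' + ?\<phi> b *s v) = b * \<tau> j0 (w' + ?\<phi> b *s v)"
        by (simp only: tau_add tau_smult v) simp
      ultimately show "?\<phi> b \<in> {s. p (w' + s *s v) = 0}" using W_add[OF w'(1) v(1)] by blast
    qed
    then have "finite (?\<phi> ` {b. \<forall>x\<in>W K c. \<tau> k x = b * \<tau> j0 x \<longrightarrow> p x = 0})"
      using fin by (rule finite_subset)
    then show ?thesis by (rule finite_imageD) (use w'(3) in \<open>auto simp: inj_on_def\<close>)
  qed
  \<comment> \<open>Two invariants: each section with index in \<open>J\<close> lowers the chain
    bound by one, and no \<open>p\<close> in \<open>H\<close> vanishes on all of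
    \<open>W K c\<close>. Sections with index outside \<open>J\<close> only position the parameter
    and are not imposed on \<open>X\<close>.\<close>
  define Q where "Q K c \<longleftrightarrow> chain_bound (X \<inter> PW (K \<inter> J) c) (\<tau> j0) (card J - card (K \<inter> J)) \<and>
    (\<forall>p\<in>H. \<exists>x\<in>W K c. p x \<noteq> 0)" for K c
  have "\<exists>c. Q K c" if "finite K" "j0 \<notin> K" for K
    using that
  proof (induction K rule: finite_induct)
    case empty
    have "chain_bound (X \<inter> PW {} c) (\<tau> j0) (card J)" for c
      by (rule chain_bound_mono[OF X(2)[folded \<tau>_def]]) auto
    then show ?case using H(2) by (auto simp: Q_def W_def)
  next
    case (insert k K)
    then obtain c where c: "Q K c" by auto
    have k: "k \<notin> K" "k \<noteq> j0" "j0 \<notin> K" using insert by auto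
    obtain B where B: "finite B" "\<And>b H. b \<notin> B \<Longrightarrow> (\<forall>x. x \<noteq> 0 \<and> proj_point x \<in> H \<longrightarrow> \<tau> k x = b * \<tau> j0 x) \<Longrightarrow>
        chain_bound (X \<inter> PW (K \<inter> J) c \<inter> H) (\<tau> j0) (card J - card (K \<inter> J) - 1)"
      using chain_bound_cut[OF proj_closed_Int[OF X(1) PW_closed], of "K \<inter> J" c "\<tau> j0" "card J - card (K \<inter> J)" "\<tau> k"] c
      unfolding Q_def by blast
    define D where "D p = {b. \<forall>x\<in>W K c. \<tau> k x = b * \<tau> j0 x \<longrightarrow> p x = 0}" for p :: "complex ^ 'n \<Rightarrow> complex"
    have "countable (D p)" if p: "p \<in> H" for p
    proof -
      obtain w where "w \<in> W K c" "p w \<noteq> 0" using c p by (auto simp: Q_def)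
      then have "finite (D p)" unfolding D_def using avoid k H(2)[OF p] by blast
      then show ?thesis by (rule countable_finite)
    qed
    then have "countable (B \<union> (\<Union>p\<in>H. D p))" using H(1) B(1) by (simp add: countable_finite)
    then obtain b where b: "b \<notin> B" "\<And>p. p \<in> H \<Longrightarrow> b \<notin> D p"
      using exists_not_in_countable by blast
    define c' where "c' = c(k := b)"
    have W': "W (insert k K') c' = {x\<in>W K' c. \<tau> k x = b * \<tau> j0 x}" if "k \<notin> K'" for K'
      using that by (auto simp: W_def c'_def)
    have W'': "W K' c' = W K' c" if "k \<notin> K'" for K'
      using that by (auto simp: W_def c'_def)
    have "chain_bound (X \<inter> PW (insert k K \<inter> J) c') (\<tau> j0) (card J - card (insert k K \<inter> J))"
    proof (cases "k \<in> J")
      case False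
      then have "insert k K \<inter> J = K \<inter> J" by auto
      moreover have "PW (K \<inter> J) c' = PW (K \<inter> J) c" using W''[of "K \<inter> J"] k by (simp add: PW_def)
      ultimately show ?thesis using c by (simp add: Q_def)
    next
      case True
      have "chain_bound (X \<inter> PW (K \<inter> J) c \<inter> PW {k} c') (\<tau> j0) (card J - card (K \<inter> J) - 1)"
      proof (rule B(2)[OF b(1)], intro allI impI)
        fix x assume "x \<noteq> 0 \<and> proj_point x \<in> PW {k} c'"
        then have "x \<in> W {k} c'" using PW_D by blast
        then show "\<tau> k x = b * \<tau> j0 x" by (simp add: W_def c'_def)
      qed
      moreover have "X \<inter> PW (insert k K \<inter> J) c' \<subseteq> X \<inter> PW (K \<inter> J) c \<inter> PW {k} c'"
      proof (rule Int_greatest)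
        have "W (insert k K \<inter> J) c' = {x\<in>W (K \<inter> J) c. \<tau> k x = b * \<tau> j0 x}"
          using W'[of "K \<inter> J"] k True by simp
        then show "X \<inter> PW (insert k K \<inter> J) c' \<subseteq> X \<inter> PW (K \<inter> J) c"
          "X \<inter> PW (insert k K \<inter> J) c' \<subseteq> PW {k} c'"
          by (auto simp: PW_def W_def c'_def)
      qed
      moreover have "card J - card (K \<inter> J) - 1 = card J - card (insert k K \<inter> J)"
        using True k insert.hyps by simp
      ultimately show ?thesis using chain_bound_mono by metis
    qed
    moreover have "\<exists>x\<in>W (insert k K) c'. p x \<noteq> 0" if "p \<in> H" for p
      using b(2)[OF that] W'[OF k(1)] by (auto simp: D_def)
    ultimately show ?case unfolding Q_def by blast
  qed
  from this[of "UNIV - {j0}"] obtain c where c: "Q (UNIV - {j0}) c" by auto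
  \<comment> \<open>With all ratios to \<open>\<tau> j0\<close> prescribed, what is left is the line
    through \<open>w\<close>, on which every \<open>p\<close> in \<open>H\<close> has finitely many
    zeros.\<close>
  define w where "w = S *v (\<chi> k. if k = j0 then 1 else c k)"
  have Tw: "\<tau> k w = (if k = j0 then 1 else c k)" for k by (simp add: w_def TS)
  have "finite {s. p (s *s w) = 0}" if p: "p \<in> H" for p
  proof -
    obtain x where x: "x \<in> W (UNIV - {j0}) c" "p x \<noteq> 0" using c p by (auto simp: Q_def)
    have "x = \<tau> j0 x *s w" by (rule tau_inj) (use x(1) in \<open>auto simp: W_def tau_smult Tw\<close>)
    then have "p (0 + \<tau> j0 x *s w) \<noteq> 0" using x(2) by simp
    then have "finite {s. p (0 + s *s w) = 0}" using H(2)[OF p] by (intro polyfun_line_finite) auto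
    then show ?thesis by simp
  qed
  then have "countable ({0} \<union> (\<Union>p\<in>H. {s. p (s *s w) = 0}))" using H(1) by (simp add: countable_finite)
  \<comment> \<open>Excluding 0 keeps \<open>\<tau> j0\<close> nonzero at the parameter. A point of
    \<open>X\<close> with the same coordinates would lie in all sections, where the exhausted chain
    bound forces \<open>\<tau> j0\<close> to vanish.\<close>
  then obtain s where s: "s \<notin> {0} \<union> (\<Union>p\<in>H. {s. p (s *s w) = 0})" using exists_not_in_countable by blast
  show ?thesis
  proof (intro exI[of _ "s *s w"] conjI allI impI ballI)
    fix p assume "p \<in> H" then show "p (s *s w) \<noteq> 0" using s by auto
  next
    fix x assume x: "x \<noteq> 0 \<and> proj_point x \<in> X"
    show "\<exists>k\<in>insert j0 J. (T *v x) $ k \<noteq> (T *v (s *s w)) $ k"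
    proof (rule ccontr)
      assume "\<not> ?thesis"
      then have eq: "\<tau> k x = \<tau> k (s *s w)" if "k \<in> insert j0 J" for k
        using that unfolding \<tau>_def by blast
      have x0: "\<tau> j0 x = s" using eq[of j0] by (simp add: tau_smult Tw)
      have "\<tau> k x = c k * \<tau> j0 x" if "k \<in> J" for k
        using eq[of k] that J x0 by (auto simp: tau_smult Tw)
      then have "proj_point x \<in> X \<inter> PW J c" using x PW_I[of x J c] by (simp add: W_def)
      moreover have "chain_bound (X \<inter> PW J c) (\<tau> j0) 0"
      proof -
        have "(UNIV - {j0}) \<inter> J = J" using J by auto
        then show ?thesis using c by (simp add: Q_def)
      qed
      ultimately have "\<tau> j0 x = 0" using chain_bound_0 x by blast
      then show False using x0 s by simp
    qed
  qed
qed

text \<open>Coefficients come from the ring generated by \<open>C\<close>, variables from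
  \<open>V\<close>. Differences in place of sums match the closure conditions of
  \<open>subring_set\<close>.\<close>

inductive poly_over :: "complex set \<Rightarrow> 'n set \<Rightarrow> (complex ^ 'n::finite \<Rightarrow> complex) \<Rightarrow> bool" for C V where
  const: "c \<in> C \<Longrightarrow> poly_over C V (\<lambda>x. c)"
| var: "i \<in> V \<Longrightarrow> poly_over C V (\<lambda>x. x $ i)"
| diff: "poly_over C V f \<Longrightarrow> poly_over C V g \<Longrightarrow> poly_over C V (\<lambda>x. f x - g x)"
| mult: "poly_over C V f \<Longrightarrow> poly_over C V g \<Longrightarrow> poly_over C V (\<lambda>x. f x * g x)"

lemma poly_over_polyfun: "poly_over C V f \<Longrightarrow> polyfun f"
  by (induction rule: poly_over.induct) (auto intro: polyfun.intros polyfun_diff)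

lemma poly_over_mono: "poly_over C V f \<Longrightarrow> V \<subseteq> V' \<Longrightarrow> poly_over C V' f"
  by (induction rule: poly_over.induct) (auto intro: poly_over.intros)

lemma poly_over_cong: "poly_over C V f \<Longrightarrow> (\<And>i. i \<in> V \<Longrightarrow> x $ i = y $ i) \<Longrightarrow> f x = f y"
  by (induction rule: poly_over.induct) auto

text \<open>Stratifies \<open>poly_over\<close> by nesting depth, so that countability follows from
  a countable union of countable stages.\<close>

primrec poly_stage :: "complex set \<Rightarrow> nat \<Rightarrow> (complex ^ 'n::finite \<Rightarrow> complex) set" where
  "poly_stage C 0 = (\<lambda>c x. c) ` C \<union> range (\<lambda>i x. x $ i)"
| "poly_stage C (Suc n) = poly_stage C n \<union>
     (\<lambda>(f, g) x. f x - g x) ` (poly_stage C n \<times> poly_stage C n) \<union>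
     (\<lambda>(f, g) x. f x * g x) ` (poly_stage C n \<times> poly_stage C n)"

lemma countable_poly_over:
  assumes "countable C"
  shows "countable {f :: complex ^ 'n::finite \<Rightarrow> complex. poly_over C UNIV f}"
proof -
  let ?S = "poly_stage C :: nat \<Rightarrow> (complex ^ 'n \<Rightarrow> complex) set"
  have cnt: "countable (?S n)" for n
    by (induction n) (use assms in \<open>auto intro!: countable_image countable_SIGMA\<close>)
  have mono: "?S m \<subseteq> ?S n" if "m \<le> n" for m n
    by (rule lift_Suc_mono_le[OF _ that]) auto
  have "\<exists>n. f \<in> ?S n" if "poly_over C UNIV f" for f
    using that
  proof induction
    case (const c)
    then show ?case by (intro exI[of _ 0]) auto
  next
    case (var i)
    then show ?case by (intro exI[of _ 0]) auto
  next
    case (diff f g)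
    then obtain m n where "f \<in> ?S m" "g \<in> ?S n" by blast
    then have "(f, g) \<in> ?S (max m n) \<times> ?S (max m n)" using mono[of m "max m n"] mono[of n "max m n"] by auto
    then show ?case by (intro exI[of _ "Suc (max m n)"]) (force simp del: max.bounded_iff)
  next
    case (mult f g)
    then obtain m n where "f \<in> ?S m" "g \<in> ?S n" by blast
    then have "(f, g) \<in> ?S (max m n) \<times> ?S (max m n)" using mono[of m "max m n"] mono[of n "max m n"] by auto
    then show ?case by (intro exI[of _ "Suc (max m n)"]) (force simp del: max.bounded_iff)
  qed
  then have "{f. poly_over C UNIV f} \<subseteq> (\<Union>n. ?S n)" by blast
  then show ?thesis by (rule countable_subset) (use cnt in auto)
qed

lemma poly_over_subring:
  assumes "1 \<in> C"
  shows "subring_set {f z | f. poly_over C V f}"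
  unfolding subring_set_def
proof (intro conjI ballI)
  show "1 \<in> {f z | f. poly_over C V f}" using poly_over.const[OF assms] by force
  fix x y assume "x \<in> {f z | f. poly_over C V f}" "y \<in> {f z | f. poly_over C V f}"
  then obtain f g where fg: "poly_over C V f" "poly_over C V g" "x = f z" "y = g z" by blast
  show "x - y \<in> {f z | f. poly_over C V f}"
    using poly_over.diff[OF fg(1,2)] fg(3,4) by (intro CollectI exI[of _ "\<lambda>x. f x - g x"]) auto
  show "x * y \<in> {f z | f. poly_over C V f}"
    using poly_over.mult[OF fg(1,2)] fg(3,4) by (intro CollectI exI[of _ "\<lambda>x. f x * g x"]) auto
qed

lemma poly_over_sum:
  assumes "1 \<in> C" "\<And>i. i \<in> I \<Longrightarrow> poly_over C V (f i)"
  shows "poly_over C V (\<lambda>x. \<Sum>i\<in>I. f i x)"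
proof -
  have zero: "poly_over C V (\<lambda>x. 0)" using poly_over.diff[OF poly_over.const poly_over.const, OF assms(1,1)] by simp
  have add: "poly_over C V (\<lambda>x. f x + g x)" if "poly_over C V f" "poly_over C V g" for f g
    using poly_over.diff[OF that(1) poly_over.diff[OF zero that(2)]] by simp
  show ?thesis using assms(2)
    by (induction I rule: infinite_finite_induct) (auto intro: zero add)
qed

lemma poly_over_power:
  assumes "1 \<in> C" "poly_over C V f"
  shows "poly_over C V (\<lambda>x. f x ^ n)"
  by (induction n) (auto intro: poly_over.intros assms)

text \<open>A relation for \<open>z $ j\<close> over the other coordinates is the vanishing at
  \<open>z\<close> of a polynomial function over \<open>C\<close>, which is then identically zero.
  Varying the \<open>j\<close>-th coordinate alone leaves the coefficients fixed, so
  \<open>p\<close> vanishes everywhere.\<close>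

lemma generic_transcendental:
  fixes z :: "complex ^ 'n::finite"
  assumes C: "1 \<in> C" and gen: "\<And>h. poly_over C UNIV h \<Longrightarrow> h z = 0 \<Longrightarrow> h = (\<lambda>_. 0)"
    and p: "\<forall>i. coeff p i \<in> {h z | h. poly_over C (UNIV - {j}) h}" "poly p (z $ j) = 0"
  shows "p = 0"
proof -
  have "\<forall>i. \<exists>h. poly_over C (UNIV - {j}) h \<and> coeff p i = h z" using p(1) by blast
  from choice[OF this] obtain h where h: "\<And>i. poly_over C (UNIV - {j}) (h i)" "\<And>i. coeff p i = h i z" by blast
  define P where "P x = (\<Sum>i\<le>degree p. h i x * x $ j ^ i)" for x
  have "poly_over C UNIV P" unfolding P_def
    by (intro poly_over_sum poly_over.mult poly_over_power poly_over.var C poly_over_mono[OF h(1)]) auto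
  moreover have "P z = 0" using p(2) by (simp add: P_def poly_altdef h(2))
  ultimately have P0: "P = (\<lambda>_. 0)" by (rule gen)
  have "poly p t = 0" for t
  proof -
    define x where "x = (\<chi> i. if i = j then t else z $ i)"
    have "h i x = h i z" for i by (rule poly_over_cong[OF h(1)]) (auto simp: x_def)
    then have "poly p t = P x" by (simp add: P_def poly_altdef h(2) x_def)
    then show ?thesis using P0 by simp
  qed
  then show ?thesis using poly_all_0_iff_0 by blast
qed

text \<open>The universal adjoint has this shape, with \<open>G\<close> the complements of the ray
  sets of the maximal cones; \<open>sqfree_grad\<close> gives its formal partial
  derivatives.\<close>

definition sqfree_form :: "'n set set \<Rightarrow> ('n set \<Rightarrow> complex) \<Rightarrow> complex ^ 'n::finite \<Rightarrow> complex" where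
  "sqfree_form G a x = (\<Sum>s\<in>G. a s * (\<Prod>i\<in>s. x $ i))"

definition sqfree_grad :: "'n set set \<Rightarrow> ('n set \<Rightarrow> complex) \<Rightarrow> 'n \<Rightarrow> complex ^ 'n::finite \<Rightarrow> complex" where
  "sqfree_grad G a k x = (\<Sum>s\<in>G. if k \<in> s then a s * (\<Prod>i\<in>s - {k}. x $ i) else 0)"

lemma polyfun_sqfree_form: "polyfun (sqfree_form G a)"
  unfolding sqfree_form_def[abs_def]
  by (intro polyfun_sum polyfun.mult polyfun.const polyfun_prod polyfun.var)

lemma polyfun_sqfree_grad: "polyfun (sqfree_grad G a k)"
proof -
  have "polyfun (\<lambda>x. if k \<in> s then a s * (\<Prod>i\<in>s - {k}. x $ i) else 0)" for s
  proof (cases "k \<in> s")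
    case True
    show ?thesis unfolding if_P[OF True] by (intro polyfun.mult polyfun.const polyfun_prod polyfun.var)
  qed (simp add: polyfun.const)
  then show ?thesis unfolding sqfree_grad_def[abs_def] by (intro polyfun_sum)
qed

text \<open>Apply a derivation with \<open>D (z $ j) = 1\<close> that kills all other \<open>z $ i\<close> to the equation
  \<open>f (U y + z) = 0\<close>: the contribution of the unknown values \<open>D (y $ i)\<close> vanishes by criticality
  along the fibre.\<close>

lemma generic_fibre_critical:
  fixes U :: "complex ^ 'd::finite ^ 'n::finite"
  assumes C: "1 \<in> C" "\<And>i j. U $ i $ j \<in> C" "\<And>s. s \<in> G \<Longrightarrow> a s \<in> C"
    and gen: "\<And>h. poly_over C UNIV h \<Longrightarrow> h z = 0 \<Longrightarrow> h = (\<lambda>_. 0)"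
    and crit: "sqfree_form G a (U *v y + z) = 0"
      "\<And>i. (\<Sum>k\<in>UNIV. U $ k $ i * sqfree_grad G a k (U *v y + z)) = 0"
  shows "sqfree_grad G a j (U *v y + z) = 0"
proof -
  define R0 where "R0 = {h z | h. poly_over C (UNIV - {j}) h}"
  have "\<exists>R D. derivation_on R D \<and> R0 \<subseteq> R \<and> z $ j \<in> R \<and> range (($) y) \<subseteq> R \<and> (\<forall>x\<in>R0. D x = 0) \<and> D (z $ j) = 1"
    unfolding R0_def
    by (rule transcendental_derivation[OF poly_over_subring[OF C(1)]])
      (auto intro: generic_transcendental[OF C(1) gen])
  then obtain R D where D: "derivation_on R D" "R0 \<subseteq> R" "z $ j \<in> R" "range (($) y) \<subseteq> R"
    "\<And>x. x \<in> R0 \<Longrightarrow> D x = 0" "D (z $ j) = 1" by blast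
  note sub = derivation_onD(1)[OF D(1)]
  note RD = subring_setD[OF sub]
  have CR0: "c \<in> R0" if "c \<in> C" for c unfolding R0_def
    by (intro CollectI exI[of _ "\<lambda>_. c"] conjI refl poly_over.const that)
  have zR0: "z $ i \<in> R0" if "i \<noteq> j" for i
    unfolding R0_def by (intro CollectI exI[of _ "\<lambda>x. x $ i"] conjI refl poly_over.var) (use that in simp)
  have zR: "z $ i \<in> R" for i using zR0[of i] D(2,3) by (cases "i = j") auto
  have yR: "y $ i \<in> R" for i using D(4) by auto
  have CR: "c \<in> R" if "c \<in> C" for c using CR0[OF that] D(2) by auto
  have Dcm: "D (c * x) = c * D x" if "c \<in> C" "x \<in> R" for c x
    using derivation_onD(3)[OF D(1) CR[OF that(1)] that(2)] D(5)[OF CR0[OF that(1)]] by simp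
  define x where "x = U *v y + z"
  have xk: "x $ k = (\<Sum>i\<in>UNIV. U $ k $ i * y $ i) + z $ k" for k
    by (simp add: x_def matrix_vector_mult_def)
  have sR: "(\<Sum>i\<in>UNIV. U $ k $ i * y $ i) \<in> R" for k
    by (intro subring_set_sum[OF sub] RD CR C(2) yR)
  have xR: "x $ k \<in> R" for k unfolding xk by (intro RD sR zR)
  \<comment> \<open>\<open>D\<close> kills the entries of \<open>U\<close> and all
    \<open>z $ k\<close> except for \<open>k = j\<close>, which leaves the unknown
    \<open>D (y $ i)\<close> and a Kronecker delta.\<close>
  have Dx: "D (x $ k) = (\<Sum>i\<in>UNIV. U $ k $ i * D (y $ i)) + (if k = j then 1 else 0)" for k
  proof -
    have "D (x $ k) = D (\<Sum>i\<in>UNIV. U $ k $ i * y $ i) + D (z $ k)"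
      unfolding xk by (rule derivation_onD(2)[OF D(1) sR zR])
    also have "D (\<Sum>i\<in>UNIV. U $ k $ i * y $ i) = (\<Sum>i\<in>UNIV. D (U $ k $ i * y $ i))"
      by (intro derivation_sum[OF D(1)] RD CR C(2) yR)
    also have "\<dots> = (\<Sum>i\<in>UNIV. U $ k $ i * D (y $ i))"
      by (intro sum.cong refl Dcm C(2) yR)
    also have "D (z $ k) = (if k = j then 1 else 0)" using D(5,6) zR0[of k] by auto
    finally show ?thesis .
  qed
  have pR: "(\<Prod>i\<in>s. x $ i) \<in> R" for s by (intro subring_set_prod[OF sub] xR)
  have "D (sqfree_form G a x) = (\<Sum>s\<in>G. D (a s * (\<Prod>i\<in>s. x $ i)))"
    unfolding sqfree_form_def by (rule derivation_sum[OF D(1)]) (intro RD CR C(3) pR)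
  also have "\<dots> = (\<Sum>s\<in>G. a s * (\<Sum>k\<in>s. D (x $ k) * (\<Prod>i\<in>s - {k}. x $ i)))"
  proof (rule sum.cong[OF refl])
    fix s assume "s \<in> G"
    then have "D (a s * (\<Prod>i\<in>s. x $ i)) = a s * D (\<Prod>i\<in>s. x $ i)" by (intro Dcm C(3) pR)
    also have "D (\<Prod>i\<in>s. x $ i) = (\<Sum>k\<in>s. D (x $ k) * (\<Prod>i\<in>s - {k}. x $ i))"
      by (subst derivation_prod[OF D(1)]) (auto simp: xR derivation_one[OF D(1)])
    finally show "D (a s * (\<Prod>i\<in>s. x $ i)) = a s * (\<Sum>k\<in>s. D (x $ k) * (\<Prod>i\<in>s - {k}. x $ i))" .
  qed
  also have "\<dots> = (\<Sum>s\<in>G. \<Sum>k\<in>UNIV. D (x $ k) * (if k \<in> s then a s * (\<Prod>i\<in>s - {k}. x $ i) else 0))"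
  proof (rule sum.cong[OF refl])
    fix s
    have "(\<Sum>k\<in>UNIV. D (x $ k) * (if k \<in> s then a s * (\<Prod>i\<in>s - {k}. x $ i) else 0)) =
        (\<Sum>k\<in>s. D (x $ k) * (a s * (\<Prod>i\<in>s - {k}. x $ i)))"
      by (rule sum.mono_neutral_cong_right) auto
    then show "a s * (\<Sum>k\<in>s. D (x $ k) * (\<Prod>i\<in>s - {k}. x $ i)) =
        (\<Sum>k\<in>UNIV. D (x $ k) * (if k \<in> s then a s * (\<Prod>i\<in>s - {k}. x $ i) else 0))"
      by (simp add: sum_distrib_left ac_simps)
  qed
  also have "\<dots> = (\<Sum>k\<in>UNIV. D (x $ k) * sqfree_grad G a k x)"
    unfolding sqfree_grad_def sum_distrib_left by (rule sum.swap)
  also have "\<dots> = (\<Sum>k\<in>UNIV. (\<Sum>i\<in>UNIV. D (y $ i) * (U $ k $ i * sqfree_grad G a k x)) +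
      (if k = j then sqfree_grad G a k x else 0))"
    by (intro sum.cong refl) (simp add: Dx algebra_simps sum_distrib_left)
  also have "\<dots> = (\<Sum>i\<in>UNIV. D (y $ i) * (\<Sum>k\<in>UNIV. U $ k $ i * sqfree_grad G a k x)) + sqfree_grad G a j x"
    by (simp add: sum.distrib sum_distrib_left) (rule sum.swap)
  also have "\<dots> = sqfree_grad G a j x" using crit(2) by (simp add: x_def)
  finally show ?thesis using crit(1) derivation_onD(4)[OF D(1)] by (simp add: x_def)
qed

text \<open>All monomials of the form have degree \<open>r\<close>, so each gradient component is
  homogeneous of degree \<open>r - 1\<close>.\<close>

lemma proj_closed_sqfree_sing:
  assumes "\<And>s. s \<in> G \<Longrightarrow> card s = r"
  shows "proj_closed {proj_point x | x. x \<noteq> 0 \<and> (\<forall>k. sqfree_grad G a k x = 0)}"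
proof -
  define e where "e s = (\<Sum>i\<in>s. Poly_Mapping.single i (1::nat))" for s :: "'a set"
  define M where "M k = (\<Sum>s\<in>G. if k \<in> s then Poly_Mapping.single (e (s - {k})) (a s) else 0)" for k
  have mono_e: "mono_eval (e s) x = (\<Prod>i\<in>s. x $ i)" for s and x :: "complex ^ 'a"
  proof -
    have "finite s" by simp
    then show ?thesis unfolding e_def
      by (induction s rule: finite_induct) (auto simp: mono_eval_add)
  qed
  have ev: "poly_eval (M k) x = sqfree_grad G a k x" for k x
    unfolding M_def sqfree_grad_def poly_eval_sum
    by (intro sum.cong refl) (simp add: poly_eval_single mono_e)
  have deg_e: "(\<Sum>j\<in>UNIV. Poly_Mapping.lookup (e s) j) = card s" for s
    unfolding e_def lookup_sum by (subst sum.swap) (simp add: lookup_single when_def)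
  have "homogeneous (M k)" for k
    unfolding homogeneous_def
  proof (intro exI[of _ "r - 1"] ballI)
    fix m assume m: "m \<in> Poly_Mapping.keys (M k)"
    then obtain s where "s \<in> G" "m \<in> Poly_Mapping.keys (if k \<in> s then Poly_Mapping.single (e (s - {k})) (a s) else 0)"
      unfolding M_def by (rule UN_E[OF subsetD[OF keys_sum_subset]])
    then have "s \<in> G" "k \<in> s" "m = e (s - {k})" by (auto split: if_splits)
    then show "(\<Sum>i\<in>UNIV. Poly_Mapping.lookup m i) = r - 1" using assms[of s] by (simp add: deg_e)
  qed
  then show ?thesis
    unfolding proj_closed_def by (intro exI[of _ "range M"]) (auto simp: ev)
qed

text \<open>For \<open>k\<close> outside \<open>I\<close> the functional sending \<open>x\<close> to
  \<open>x $ k\<close> minus the sum of the \<open>N k i * x $ i\<close> kills the column space of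
  \<open>U\<close>, so it takes the same value at \<open>z\<close> and at \<open>U *v y + z\<close>.
  One of these functionals, \<open>j0\<close>, is the denominator; the other n - card I - 1 provide
  exactly as many sections as the chain bound allows.\<close>

theorem generic_fibre_smooth:
  fixes U :: "complex ^ 'd::finite ^ 'n::finite"
  assumes card_G: "finite G" "\<And>s. s \<in> G \<Longrightarrow> card s = r"
    and I: "card I < CARD('n)" "\<And>j. j \<notin> I \<Longrightarrow> U $ j = (\<Sum>i\<in>I. N j i *s U $ i)"
    and bound: "\<And>h. chain_bound {proj_point x | x. x \<noteq> 0 \<and> (\<forall>k. sqfree_grad G a k x = 0)} h (CARD('n) - card I - 1)"
  shows "\<exists>g. polyfun g \<and> (\<exists>z. g z \<noteq> 0) \<and>
    (\<forall>z y. sqfree_form G a (U *v y + z) = 0 \<and>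
      (\<forall>i. (\<Sum>k\<in>UNIV. U $ k $ i * sqfree_grad G a k (U *v y + z)) = 0) \<longrightarrow> g z = 0)"
proof -
  let ?X = "{proj_point x | x. x \<noteq> 0 \<and> (\<forall>k. sqfree_grad G a k x = 0)}"
  \<comment> \<open>The option type joins the form and its derivatives along the fibre into one
    finite system in \<open>y\<close>.\<close>
  define F where "F i z y = (case i of None \<Rightarrow> sqfree_form G a (U *v y + z)
      | Some i \<Rightarrow> (\<Sum>k\<in>UNIV. U $ k $ i * sqfree_grad G a k (U *v y + z)))" for i :: "'d option" and z y
  have Uyz: "polyfun (\<lambda>y. (U *v y + z) $ k)" "polyfun (\<lambda>z. (U *v y + z) $ k)" for y z k
    unfolding vector_add_component
    by (intro polyfun.add polyfun_matrix_vector polyfun.var polyfun.const)+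
  have "\<exists>g. polyfun g \<and> (\<exists>z. g z \<noteq> 0) \<and> (\<forall>z y. (\<forall>i. F i z y = 0) \<longrightarrow> g z = 0)"
  proof (rule generic_unsolvability)
    show "polyfun (F i z)" for i z
      by (cases i) (auto simp: F_def[abs_def] intro!: polyfun_sum polyfun.mult[OF polyfun.const]
        polyfun_compose[OF polyfun_sqfree_form] polyfun_compose[OF polyfun_sqfree_grad] Uyz)
    show "polyfun (\<lambda>z. F i z y)" for i y
      by (cases i) (auto simp: F_def[abs_def] intro!: polyfun_sum polyfun.mult[OF polyfun.const]
        polyfun_compose[OF polyfun_sqfree_form] polyfun_compose[OF polyfun_sqfree_grad] Uyz)
    fix H :: "(complex ^ 'n \<Rightarrow> complex) set"
    assume H: "countable H" "\<And>p. p \<in> H \<Longrightarrow> polyfun p \<and> (\<exists>z. p z \<noteq> 0)"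
    define C where "C = insert 1 ((\<Union>i j. {U $ i $ j}) \<union> a ` G)"
    have C: "1 \<in> C" "\<And>i j. U $ i $ j \<in> C" "\<And>s. s \<in> G \<Longrightarrow> a s \<in> C" by (auto simp: C_def)
    have "countable C" using card_G(1) by (simp add: C_def countable_finite)
    obtain j0 where j0: "j0 \<notin> I" using I(1) by (metis UNIV_eq_I less_irrefl)
    define J where "J = - I - {j0}"
    have cardJ: "card J = CARD('n) - card I - 1"
      using j0 by (simp add: J_def card_Diff_singleton Compl_eq_Diff_UNIV card_Diff_subset)
    \<comment> \<open>For \<open>k\<close> outside \<open>I\<close>, row \<open>k\<close> of
      \<open>T\<close> is the functional above. \<open>T\<close> is unipotent with one off-diagonal
      block, and flipping the sign of that block gives its inverse \<open>S\<close>.\<close>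
    define T where "T = ((\<chi> j i. (if j = i then 1 else 0) - (if j \<notin> I \<and> i \<in> I then N j i else 0)) :: complex ^ 'n ^ 'n)"
    define S where "S = ((\<chi> j i. (if j = i then 1 else 0) + (if j \<notin> I \<and> i \<in> I then N j i else 0)) :: complex ^ 'n ^ 'n)"
    \<comment> \<open>Avoiding every nonzero polynomial over \<open>C\<close> makes the coordinates
      of \<open>z\<close> algebraically independent over the data; avoiding
      \<open>\<tau> j0 = 0\<close> makes \<open>U *v y + z\<close> nonzero, hence a projective
      point.\<close>
    define H' where "H' = insert (\<lambda>z. (T *v z) $ j0) (H \<union> {h. poly_over C UNIV h \<and> h \<noteq> (\<lambda>_. 0)})"
    have "countable {h :: complex ^ 'n \<Rightarrow> complex. poly_over C UNIV h \<and> h \<noteq> (\<lambda>_. 0)}"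
      by (rule countable_subset[OF _ countable_poly_over[OF \<open>countable C\<close>]]) auto
    then have cnt: "countable H'" using H(1) by (simp add: H'_def)
    have T0: "polyfun (\<lambda>z. (T *v z) $ j0)" by (intro polyfun_matrix_vector polyfun.var)
    moreover have "(T *v axis j0 1) $ j0 = 1" using j0 
      by (simp add: T_def matrix_vector_mult_def axis_def if_distrib[of "\<lambda>x. _ * x"] cong: if_cong)
    then have "\<exists>z. (T *v z) $ j0 \<noteq> 0" by (metis zero_neq_one)
    have H': "polyfun p \<and> (\<exists>z. p z \<noteq> 0)" if "p \<in> H'" for p
    proof -
      consider "p = (\<lambda>z. (T *v z) $ j0)" | "p \<in> H" | "poly_over C UNIV p" "p \<noteq> (\<lambda>_. 0)"
        using \<open>p \<in> H'\<close> by (auto simp: H'_def)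
      then show ?thesis
      proof cases
        case 1
        then show ?thesis using T0 \<open>\<exists>z. (T *v z) $ j0 \<noteq> 0\<close> by simp
      next
        case 2
        then show ?thesis by (rule H(2))
      next
        case 3
        then show ?thesis by (auto simp: fun_eq_iff intro: poly_over_polyfun)
      qed
    qed
    have "T ** S = mat 1"
    proof -
      have "(T ** S) $ j $ i = (mat 1 :: complex ^ 'n ^ 'n) $ j $ i" for j i
      proof -
        have "(T ** S) $ j $ i = (\<Sum>k\<in>UNIV. ((if j = k then 1 else 0) - (if j \<notin> I \<and> k \<in> I then N j k else 0)) *
            ((if k = i then 1 else 0) + (if k \<notin> I \<and> i \<in> I then N k i else 0)))"
          by (simp add: matrix_matrix_mult_def T_def S_def)
        also have "\<dots> = (\<Sum>k\<in>UNIV. (if k = j then (if k = i then 1 else 0) + (if k \<notin> I \<and> i \<in> I then N k i else 0) else 0)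
            - (if k = i then (if j \<notin> I \<and> k \<in> I then N j k else 0) else 0))"
          by (intro sum.cong) auto
        also have "\<dots> = (mat 1 :: complex ^ 'n ^ 'n) $ j $ i"
          by (auto simp: sum_subtractf mat_def)
        finally show ?thesis .
      qed
      then show ?thesis by (simp add: vec_eq_iff)
    qed
    moreover have "proj_closed ?X" by (rule proj_closed_sqfree_sing[OF card_G(2)])
    moreover have "chain_bound ?X (\<lambda>x. (T *v x) $ j0) (card J)" unfolding cardJ by (rule bound)
    moreover have "j0 \<notin> J" by (simp add: J_def)
    ultimately obtain z where z: "\<And>p. p \<in> H' \<Longrightarrow> p z \<noteq> 0"
      "\<And>x. x \<noteq> 0 \<Longrightarrow> proj_point x \<in> ?X \<Longrightarrow> \<exists>k\<in>insert j0 J. (T *v x) $ k \<noteq> (T *v z) $ k"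
      using generic_linear_section[of T S ?X j0 J H'] cnt H' by blast
    have gen: "h = (\<lambda>_. 0)" if "poly_over C UNIV h" "h z = 0" for h
      using z(1)[of h] that by (auto simp: H'_def)
    have TU: "(T *v (U *v y)) $ k = 0" if "k \<notin> I" for k y
    proof -
      have "(T *v (U *v y)) $ k = (\<Sum>i\<in>UNIV. (if k = i then (U *v y) $ i else 0) - (if i \<in> I then N k i * (U *v y) $ i else 0))"
        unfolding matrix_vector_mult_def[of T] using that by (simp add: T_def left_diff_distrib) (intro sum.cong; auto)
      also have "\<dots> = (U *v y) $ k - (\<Sum>i\<in>I. N k i * (U *v y) $ i)"
        by (simp add: sum_subtractf sum.If_cases)
      also have "(U *v y) $ k = (\<Sum>l\<in>UNIV. U $ k $ l * y $ l)" by (simp add: matrix_vector_mult_def)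
      also have "\<dots> = (\<Sum>l\<in>UNIV. \<Sum>i\<in>I. N k i * (U $ i $ l * y $ l))"
        by (subst I(2)[OF that]) (simp add: sum_distrib_right mult.assoc)
      also have "\<dots> = (\<Sum>i\<in>I. N k i * (U *v y) $ i)"
        by (subst sum.swap) (simp add: matrix_vector_mult_def sum_distrib_left)
      finally show ?thesis by simp
    qed
    have "\<nexists>y. \<forall>i. F i z y = 0"
    proof
      assume "\<exists>y. \<forall>i. F i z y = 0"
      then obtain y where y: "\<And>i. F i z y = 0" by blast
      define x where "x = U *v y + z"
      have "sqfree_grad G a j x = 0" for j unfolding x_def
      proof (rule generic_fibre_critical[OF C gen])
        show "sqfree_form G a (U *v y + z) = 0" using y[of None] by (simp add: F_def)
        show "(\<Sum>k\<in>UNIV. U $ k $ i * sqfree_grad G a k (U *v y + z)) = 0" for i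
          using y[of "Some i"] by (simp add: F_def)
      qed
      have Tx: "(T *v x) $ k = (T *v z) $ k" if "k \<notin> I" for k
        using TU[OF that, of y] by (simp add: x_def matrix_vector_right_distrib)
      have "x \<noteq> 0"
      proof
        assume "x = 0"
        then have "(T *v z) $ j0 = 0" using Tx[OF j0] by simp
        then show False using z(1)[of "\<lambda>z. (T *v z) $ j0"] by (simp add: H'_def)
      qed
      then have "\<exists>k\<in>insert j0 J. (T *v x) $ k \<noteq> (T *v z) $ k"
        using \<open>\<And>j. sqfree_grad G a j x = 0\<close> by (intro z(2)) auto
      then show False using Tx j0 by (auto simp: J_def)
    qed
    then show "\<exists>z. (\<forall>p\<in>H. p z \<noteq> 0) \<and> (\<nexists>y. \<forall>i. F i z y = 0)"
      using z(1) by (intro exI[of _ z]) (auto simp: H'_def)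
  qed
  then obtain g where g: "polyfun g" "\<exists>z. g z \<noteq> 0" "\<And>z y. (\<forall>i. F i z y = 0) \<Longrightarrow> g z = 0" by blast
  have "g z = 0" if "sqfree_form G a (U *v y + z) = 0"
    "\<forall>i. (\<Sum>k\<in>UNIV. U $ k $ i * sqfree_grad G a k (U *v y + z)) = 0" for z y
    by (rule g(3)[of z y]) (use that in \<open>auto simp: F_def split: option.split\<close>)
  then show ?thesis using g(1,2) by blast
qed

section \<open>Volumes of simplices\<close>

text \<open>The library computes the Lebesgue measure of linear images only for index types that are
  well-ordered; a copy of the index type with an arbitrary order removes this restriction.\<close>

datatype 'a ordered_copy = Copy (uncopy: 'a)

definition copy_rank :: "'a::finite ordered_copy \<Rightarrow> nat" where
  "copy_rank x = (SOME f :: 'a \<Rightarrow> nat. inj f) (uncopy x)"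

lemma inj_copy_rank: "inj copy_rank"
proof -
  have "\<exists>f :: 'a \<Rightarrow> nat. inj f" using finite_imp_inj_to_nat_seg[of "UNIV :: 'a set"] by auto
  then have "inj (SOME f :: 'a \<Rightarrow> nat. inj f)" by (rule someI_ex)
  then show ?thesis by (intro injI ordered_copy.expand) (unfold copy_rank_def, erule injD)
qed

instantiation ordered_copy :: (finite) "{finite, wellorder}"
begin

definition less_eq_ordered_copy :: "'a ordered_copy \<Rightarrow> 'a ordered_copy \<Rightarrow> bool" where
  "less_eq_ordered_copy x y \<longleftrightarrow> copy_rank x \<le> copy_rank y"

definition less_ordered_copy :: "'a ordered_copy \<Rightarrow> 'a ordered_copy \<Rightarrow> bool" where
  "less_ordered_copy x y \<longleftrightarrow> copy_rank x < copy_rank y"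

instance
proof
  have "(UNIV :: 'a ordered_copy set) = range Copy" by (metis surjI ordered_copy.collapse)
  then show "finite (UNIV :: 'a ordered_copy set)" by (metis finite finite_imageI)
next
  fix x y z :: "'a ordered_copy"
  show "(x < y) = (x \<le> y \<and> \<not> y \<le> x)" by (auto simp: less_eq_ordered_copy_def less_ordered_copy_def)
  show "x \<le> x" by (simp add: less_eq_ordered_copy_def)
  show "x \<le> y \<Longrightarrow> y \<le> z \<Longrightarrow> x \<le> z" by (simp add: less_eq_ordered_copy_def)
  show "x \<le> y \<Longrightarrow> y \<le> x \<Longrightarrow> x = y"
    using inj_copy_rank by (auto simp: less_eq_ordered_copy_def inj_on_def)
  show "x \<le> y \<or> y \<le> x" by (auto simp: less_eq_ordered_copy_def)
next
  fix P :: "'a ordered_copy \<Rightarrow> bool" and a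
  assume "\<And>x. (\<And>y. y < x \<Longrightarrow> P y) \<Longrightarrow> P x"
  then show "P a" unfolding less_ordered_copy_def by (rule measure_induct_rule)
qed

end

lemma bij_Copy: "bij Copy"
  by (rule bij_betw_byWitness[where f' = uncopy]) auto

text \<open>Conjugation by the renaming is a sign-preserving bijection between the permutations in
  the two Leibniz formulas.\<close>

lemma det_ordered_copy:
  fixes A :: "real ^ 'n::finite ^ 'n"
  shows "det ((\<chi> i j. A $ uncopy i $ uncopy j) :: real ^ 'n ordered_copy ^ 'n ordered_copy) = det A"
proof -
  have perm: "Copy \<circ> p \<circ> uncopy permutes (UNIV :: 'n ordered_copy set)" if "p permutes UNIV" for p :: "'n \<Rightarrow> 'n"
  proof -
    have "bij (Copy \<circ> p \<circ> uncopy)"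
      using permutes_bij[OF that] bij_Copy
      by (intro bij_comp) (auto intro: bij_betw_byWitness[where f' = Copy])
    then show ?thesis by (simp add: permutes_def bij_iff)
  qed
  have perm': "uncopy \<circ> p \<circ> Copy permutes (UNIV :: 'n set)" if "p permutes UNIV" for p :: "'n ordered_copy \<Rightarrow> 'n ordered_copy"
  proof -
    have "bij (uncopy \<circ> p \<circ> Copy)"
      using permutes_bij[OF that] bij_Copy
      by (intro bij_comp) (auto intro: bij_betw_byWitness[where f' = Copy])
    then show ?thesis by (simp add: permutes_def bij_iff)
  qed
  have sign: "sign (Copy \<circ> p \<circ> uncopy) = sign p" if "p permutes UNIV" for p :: "'n \<Rightarrow> 'n"
  proof -
    have "map_permutation UNIV Copy p = Copy \<circ> p \<circ> uncopy"
    proof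
      fix x :: "'n ordered_copy"
      show "map_permutation UNIV Copy p x = (Copy \<circ> p \<circ> uncopy) x"
        using map_permutation_apply[of Copy UNIV "uncopy x" p] by (simp add: inj_on_def)
    qed
    then show ?thesis using sign_map_permutation[of Copy UNIV p] that by (simp add: inj_on_def)
  qed
  have "det ((\<chi> i j. A $ uncopy i $ uncopy j) :: real ^ 'n ordered_copy ^ 'n ordered_copy) =
    (\<Sum>p | p permutes (UNIV :: 'n ordered_copy set). of_int (sign p) * (\<Prod>i\<in>UNIV. A $ uncopy i $ uncopy (p i)))"
    by (simp add: det_def)
  also have "\<dots> = (\<Sum>p | p permutes (UNIV :: 'n set). of_int (sign p) * (\<Prod>i\<in>UNIV. A $ i $ p i))"
  proof (rule sum.reindex_bij_witness[where i = "\<lambda>p. Copy \<circ> p \<circ> uncopy" and j = "\<lambda>p. uncopy \<circ> p \<circ> Copy"])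
    fix p :: "'n ordered_copy \<Rightarrow> 'n ordered_copy" assume p: "p \<in> {p. p permutes UNIV}"
    show "Copy \<circ> (uncopy \<circ> p \<circ> Copy) \<circ> uncopy = p" by (simp add: fun_eq_iff)
    then have "sign p = sign (uncopy \<circ> p \<circ> Copy)" using sign[OF perm'[of p]] p by simp
    moreover have "(\<Prod>i\<in>UNIV. A $ i $ (uncopy \<circ> p \<circ> Copy) i) = (\<Prod>i\<in>UNIV. A $ uncopy i $ uncopy (p i))"
      by (rule prod.reindex_bij_witness[where i = uncopy and j = Copy]) auto
    ultimately show "of_int (sign (uncopy \<circ> p \<circ> Copy)) * (\<Prod>i\<in>UNIV. A $ i $ (uncopy \<circ> p \<circ> Copy) i) =
        of_int (sign p) * (\<Prod>i\<in>UNIV. A $ uncopy i $ uncopy (p i))" by simp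
  qed (use perm perm' in \<open>auto simp: fun_eq_iff\<close>)
  finally show ?thesis by (simp add: det_def)
qed

lemma prod_Basis_vec: "(\<Prod>b\<in>Basis. v \<bullet> b) = (\<Prod>i\<in>UNIV. (v :: real ^ 'n::finite) $ i)"
proof -
  have "(Basis :: (real ^ 'n) set) = range (\<lambda>i. axis i 1)" by (auto simp: Basis_vec_def)
  then show ?thesis
    by (subst prod.reindex_bij_betw[of "\<lambda>i. axis i 1" UNIV Basis, symmetric])
      (auto simp: bij_betw_def inj_on_def axis_eq_axis inner_axis)
qed

definition to_copy :: "real ^ 'n::finite \<Rightarrow> real ^ 'n ordered_copy" where
  "to_copy x = (\<chi> i. x $ uncopy i)"

definition from_copy :: "real ^ 'n ordered_copy \<Rightarrow> real ^ 'n::finite" where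
  "from_copy x = (\<chi> i. x $ Copy i)"

lemma copy_inverse [simp]: "to_copy (from_copy x) = x" "from_copy (to_copy y) = y"
  by (simp_all add: to_copy_def from_copy_def vec_eq_iff)

lemma linear_to_copy: "linear to_copy"
  by (auto intro!: linearI simp: to_copy_def vec_eq_iff)

text \<open>Lebesgue measure is determined by boxes, whose volume is a product over the coordinates
  and so does not see their names.\<close>

lemma measure_to_copy:
  fixes A :: "(real ^ 'n::finite) set"
  assumes "compact A"
  shows "measure lebesgue (to_copy ` A) = measure lebesgue A"
proof -
  have cont: "continuous_on S to_copy" for S :: "(real ^ 'n) set"
    by (rule linear_continuous_on[OF linear_conv_bounded_linear[THEN iffD1, OF linear_to_copy]])
  have meas: "to_copy \<in> borel_measurable (lborel :: (real ^ 'n) measure)"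
    using borel_measurable_continuous_onI[OF cont] by simp
  have "lborel = distr (lborel :: (real ^ 'n) measure) borel to_copy"
  proof (rule lborel_eqI)
    fix l u :: "real ^ 'n ordered_copy" assume lu: "\<And>b. b \<in> Basis \<Longrightarrow> l \<bullet> b \<le> u \<bullet> b"
    have le: "l $ i \<le> u $ i" for i using lu[of "axis i 1"] by (simp add: inner_axis)
    have "to_copy -` box l u = box (from_copy l) (from_copy u)"
      by (auto simp: mem_box_cart to_copy_def from_copy_def) (metis ordered_copy.sel ordered_copy.collapse)+
    then have "emeasure (distr lborel borel to_copy) (box l u) = emeasure lborel (box (from_copy l) (from_copy u))"
      by (subst emeasure_distr[OF meas]) auto
    also have "\<dots> = (\<Prod>b\<in>Basis. (from_copy u - from_copy l) \<bullet> b)"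
    proof (rule emeasure_lborel_box)
      fix b :: "real ^ 'n" assume "b \<in> Basis"
      then obtain i where "b = axis i 1" by (auto simp: Basis_vec_def)
      then show "from_copy l \<bullet> b \<le> from_copy u \<bullet> b" using le by (simp add: inner_axis from_copy_def)
    qed
    also have "(\<Prod>b\<in>Basis. (from_copy u - from_copy l) \<bullet> b) = (\<Prod>b\<in>Basis. (u - l) \<bullet> b)"
      unfolding prod_Basis_vec
      by (rule prod.reindex_bij_witness[where i = uncopy and j = Copy]) (auto simp: from_copy_def)
    finally show "emeasure (distr lborel borel to_copy) (box l u) = ennreal (\<Prod>b\<in>Basis. (u - l) \<bullet> b)" .
  qed simp
  moreover have cA: "compact (to_copy ` A)" using compact_continuous_image[OF cont assms] .
  ultimately have "measure lborel (to_copy ` A) = measure (lborel :: (real ^ 'n) measure) (to_copy -` to_copy ` A \<inter> space lborel)"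
    by (metis measure_distr[OF meas] borel_compact)
  moreover have "to_copy -` to_copy ` A = A" by (auto simp: image_iff) (metis copy_inverse(2))
  ultimately show ?thesis
    using borel_compact[OF assms] borel_compact[OF cA] by (simp add: measure_completion)
qed

lemma measure_compact_linear_image:
  fixes A :: "(real ^ 'n::finite) set"
  assumes "compact A"
  shows "measure lebesgue ((*v) M ` A) = \<bar>det M\<bar> * measure lebesgue A"
proof -
  define M' where "M' = ((\<chi> i j. M $ uncopy i $ uncopy j) :: real ^ 'n ordered_copy ^ 'n ordered_copy)"
  have M': "M' *v to_copy x = to_copy (M *v x)" for x
  proof -
    have "(\<Sum>j\<in>UNIV. M $ uncopy i $ uncopy j * x $ uncopy j) = (\<Sum>j\<in>UNIV. M $ uncopy i $ j * x $ j)" for i :: "'n ordered_copy"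
      by (rule sum.reindex_bij_witness[where i = Copy and j = uncopy]) auto
    then show ?thesis by (simp add: vec_eq_iff matrix_vector_mult_def M'_def to_copy_def)
  qed
  have cont: "continuous_on S to_copy" for S :: "(real ^ 'n) set"
    by (rule linear_continuous_on[OF linear_conv_bounded_linear[THEN iffD1, OF linear_to_copy]])
  have cA: "compact (to_copy ` A)" using compact_continuous_image[OF cont assms] .
  have "compact ((*v) M ` A)"
    by (intro compact_continuous_image assms linear_continuous_on) (simp add: matrix_vector_mul_bounded_linear)
  then have "measure lebesgue ((*v) M ` A) = measure lebesgue (to_copy ` (*v) M ` A)"
    by (simp add: measure_to_copy)
  also have "to_copy ` (*v) M ` A = (*v) M' ` to_copy ` A" by (simp add: image_image M')
  also have "measure lebesgue \<dots> = \<bar>det (matrix ((*v) M'))\<bar> * measure lebesgue (to_copy ` A)"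
    using cA compact_imp_bounded lmeasurable_compact
    by (intro measure_lebesgue_linear_transformation) (auto simp: fmeasurableD)
  also have "det (matrix ((*v) M')) = det M" by (simp add: M'_def det_ordered_copy matrix_of_matrix_vector_mul)
  finally show ?thesis by (simp add: measure_to_copy assms)
qed

text \<open>The set is the simplex with vertices 0 and the rows of \<open>B\<close>: the image under
  the transpose of \<open>B\<close> of the standard simplex, which has volume 1/d!.\<close>

lemma measure_simplex_cone:
  fixes B :: "real ^ 'n::finite ^ 'n"
  shows "compact {\<Sum>j\<in>UNIV. c j *\<^sub>R B $ j | c. (\<forall>j. c j \<ge> 0) \<and> sum c UNIV \<le> 1}"
    and "measure lebesgue {\<Sum>j\<in>UNIV. c j *\<^sub>R B $ j | c. (\<forall>j. c j \<ge> 0) \<and> sum c UNIV \<le> 1} =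
      \<bar>det B\<bar> / fact CARD('n)"
proof -
  define A where "A = convex hull (insert 0 Basis :: (real ^ 'n) set)"
  have A: "A = {x. (\<forall>j. x $ j \<ge> 0) \<and> (\<Sum>j\<in>UNIV. x $ j) \<le> 1}"
  proof -
    have "(Basis :: (real ^ 'n) set) = range (\<lambda>i. axis i 1)" by (auto simp: Basis_vec_def)
    moreover from this have "sum ((\<bullet>) x) Basis = (\<Sum>j\<in>UNIV. x $ j)" for x :: "real ^ 'n"
      by (subst sum.reindex_bij_betw[of "\<lambda>i. axis i 1" UNIV Basis, symmetric])
        (auto simp: bij_betw_def inj_on_def axis_eq_axis inner_axis)
    moreover have "(\<forall>i\<in>Basis. 0 \<le> x \<bullet> i) \<longleftrightarrow> (\<forall>j. x $ j \<ge> 0)" for x :: "real ^ 'n"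
      unfolding calculation(1) by (simp add: inner_axis)
    ultimately show ?thesis unfolding A_def std_simplex by (simp only:)
  qed
  have cA: "compact A" unfolding A_def by (intro compact_convex_hull finite_imp_compact) simp
  have eq: "{\<Sum>j\<in>UNIV. c j *\<^sub>R B $ j | c. (\<forall>j. c j \<ge> 0) \<and> sum c UNIV \<le> 1} = (*v) (transpose B) ` A"
  proof -
    have tr: "transpose B *v x = (\<Sum>j\<in>UNIV. x $ j *\<^sub>R B $ j)" for x
      by (simp add: vec_eq_iff matrix_vector_mult_def transpose_def mult.commute)
    show ?thesis
    proof (rule equalityI; rule subsetI)
      fix w assume "w \<in> {\<Sum>j\<in>UNIV. c j *\<^sub>R B $ j | c. (\<forall>j. c j \<ge> 0) \<and> sum c UNIV \<le> 1}"
      then obtain c where "w = (\<Sum>j\<in>UNIV. c j *\<^sub>R B $ j)" "\<forall>j. c j \<ge> 0" "sum c UNIV \<le> 1" by blast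
      then show "w \<in> (*v) (transpose B) ` A" by (intro image_eqI[of _ _ "\<chi> j. c j"], unfold tr) (auto simp: A)
    next
      fix w assume "w \<in> (*v) (transpose B) ` A"
      then obtain x where "w = (\<Sum>j\<in>UNIV. x $ j *\<^sub>R B $ j)" "x \<in> A" by (auto simp only: tr image_iff)
      then show "w \<in> {\<Sum>j\<in>UNIV. c j *\<^sub>R B $ j | c. (\<forall>j. c j \<ge> 0) \<and> sum c UNIV \<le> 1}"
        by (intro CollectI exI[of _ "($) x"]) (simp add: A)
    qed
  qed
  show "compact {\<Sum>j\<in>UNIV. c j *\<^sub>R B $ j | c. (\<forall>j. c j \<ge> 0) \<and> sum c UNIV \<le> 1}"
    unfolding eq by (intro compact_continuous_image cA linear_continuous_on) (simp add: matrix_vector_mul_bounded_linear)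
  have "measure lebesgue A = 1 / fact CARD('n)"
    using content_std_simplex[where 'a = "real ^ 'n"] borel_compact[OF cA]
    by (simp add: A_def[symmetric] measure_completion)
  then show "measure lebesgue {\<Sum>j\<in>UNIV. c j *\<^sub>R B $ j | c. (\<forall>j. c j \<ge> 0) \<and> sum c UNIV \<le> 1} = \<bar>det B\<bar> / fact CARD('n)"
    unfolding eq measure_compact_linear_image[OF cA] by (simp add: det_transpose)
qed

section \<open>Simplicial fans and deformed polytopes\<close>

definition gen_cone :: "real ^ 'd::finite ^ 'n::finite \<Rightarrow> 'n set \<Rightarrow> (real ^ 'd) set" where
  "gen_cone U K = {\<Sum>i\<in>K. c i *\<^sub>R U $ i | c. \<forall>i\<in>K. c i \<ge> 0}"

lemma gen_coneI: "(\<And>i. i \<in> K \<Longrightarrow> c i \<ge> 0) \<Longrightarrow> (\<Sum>i\<in>K. c i *\<^sub>R U $ i) \<in> gen_cone U K"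
  unfolding gen_cone_def by blast

lemma gen_coneE:
  assumes "u \<in> gen_cone U K"
  obtains c where "\<And>i. i \<in> K \<Longrightarrow> c i \<ge> 0" "u = (\<Sum>i\<in>K. c i *\<^sub>R U $ i)"
  using assms unfolding gen_cone_def by blast

lemma gen_cone_mono:
  assumes "K \<subseteq> L" shows "gen_cone U K \<subseteq> gen_cone U L"
proof
  fix u assume "u \<in> gen_cone U K"
  then obtain c where c: "\<And>i. i \<in> K \<Longrightarrow> c i \<ge> 0" "u = (\<Sum>i\<in>K. c i *\<^sub>R U $ i)" by (rule gen_coneE) blast
  have "u = (\<Sum>i\<in>L. (if i \<in> K then c i else 0) *\<^sub>R U $ i)"
    unfolding c(2) using assms by (intro sum.mono_neutral_cong_left) auto
  then show "u \<in> gen_cone U L" using c(1) by (simp only:) (rule gen_coneI, simp)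
qed

lemma gen_cone_singleton: "gen_cone U {i} = ray U i"
proof -
  have "gen_cone U {i} = {c *\<^sub>R U $ i | c. c \<ge> 0}"
  proof (rule equalityI; rule subsetI)
    fix x assume "x \<in> {c *\<^sub>R U $ i | c. c \<ge> 0}"
    then obtain c where "x = c *\<^sub>R U $ i" "c \<ge> 0" by blast
    then show "x \<in> gen_cone U {i}" using gen_coneI[of "{i}" "\<lambda>_. c" U] by simp
  qed (auto elim!: gen_coneE)
  then show ?thesis unfolding ray_def cone_hull_expl by auto
qed

lemma gen_cone_generator: "i \<in> K \<Longrightarrow> U $ i \<in> gen_cone U K"
  using gen_cone_mono[of "{i}" K U] gen_coneI[of "{i}" "\<lambda>_. 1" U] by auto

lemma mem_deformed_polytope: "y \<in> deformed_polytope U z \<longleftrightarrow> (\<forall>i. U $ i \<bullet> y + z $ i \<ge> 0)"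
proof -
  have "(U *v y) $ i = U $ i \<bullet> y" for i by (simp add: matrix_vector_mult_def inner_vec_def)
  then show ?thesis by (simp add: deformed_polytope_def)
qed

lemma polyhedron_deformed_polytope: "polyhedron (deformed_polytope U z)"
proof -
  have *: "0 \<le> a + b \<longleftrightarrow> - b \<le> a" for a b :: real by linarith
  have "deformed_polytope U z = \<Inter> (range (\<lambda>i. {y. U $ i \<bullet> y \<ge> - z $ i}))"
    by (auto simp: mem_deformed_polytope *)
  also have "polyhedron \<dots>" by (intro polyhedron_Inter) (auto simp: polyhedron_halfspace_ge)
  finally show ?thesis .
qed

lemma convex_deformed_polytope: "convex (deformed_polytope U z)"
  by (rule polyhedron_imp_convex[OF polyhedron_deformed_polytope])

text \<open>Active constraints do not decrease along \<open>w\<close>, and the slack of the finitely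
  many others survives a small step.\<close>

lemma feasible_step:
  assumes y: "y \<in> deformed_polytope U z" and w: "\<And>i. U $ i \<bullet> y + z $ i = 0 \<Longrightarrow> U $ i \<bullet> w \<ge> 0"
  shows "\<exists>e>0. y + e *\<^sub>R w \<in> deformed_polytope U z"
proof -
  have "\<forall>\<^sub>F e in at_right (0::real). 0 \<le> U $ i \<bullet> (y + e *\<^sub>R w) + z $ i" for i
  proof (cases "U $ i \<bullet> y + z $ i = 0")
    case True
    have "0 \<le> U $ i \<bullet> (y + e *\<^sub>R w) + z $ i" if "e > 0" for e
    proof -
      have "U $ i \<bullet> (y + e *\<^sub>R w) + z $ i = e * (U $ i \<bullet> w)" using True by (simp add: inner_add_right)
      then show ?thesis using w[OF True] that by simp
    qed
    then show ?thesis by (auto simp: eventually_at_right_less intro: eventually_mono[OF eventually_at_right_less])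
  next
    case False
    then have pos: "0 < U $ i \<bullet> y + z $ i" using y by (simp add: mem_deformed_polytope less_le)
    have "((\<lambda>e. U $ i \<bullet> (y + e *\<^sub>R w) + z $ i) \<longlongrightarrow> U $ i \<bullet> (y + 0 *\<^sub>R w) + z $ i) (at_right 0)"
      by (intro tendsto_intros)
    then have "\<forall>\<^sub>F e in at_right 0. 0 < U $ i \<bullet> (y + e *\<^sub>R w) + z $ i"
      by (rule order_tendstoD) (use pos in simp)
    then show ?thesis by (rule eventually_mono) simp
  qed
  then have "\<forall>\<^sub>F e in at_right (0::real). \<forall>i. 0 \<le> U $ i \<bullet> (y + e *\<^sub>R w) + z $ i"
    by (simp add: eventually_all_finite)
  moreover have "\<forall>\<^sub>F e in at_right (0::real). 0 < e" by (rule eventually_at_right_less)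
  ultimately have "\<forall>\<^sub>F e in at_right (0::real). 0 < e \<and> y + e *\<^sub>R w \<in> deformed_polytope U z"
    by eventually_elim (simp add: mem_deformed_polytope)
  then have "\<exists>e::real. 0 < e \<and> y + e *\<^sub>R w \<in> deformed_polytope U z"
    by (rule eventually_happens'[rotated]) simp
  then show ?thesis by blast
qed

text \<open>The combinatorics of a complete simplicial fan: \<open>V\<close> is the set of index sets of the maximal
  cones, and \<open>q I\<close> is the basis dual to the generators of the cone \<open>I\<close>.\<close>

locale simplicial_fan =
  fixes U :: "real ^ 'd::finite ^ 'n::finite" and V :: "'n set set" and q :: "'n set \<Rightarrow> 'n \<Rightarrow> real ^ 'd"
  assumes card_V: "I \<in> V \<Longrightarrow> card I = CARD('d)"
    and dual: "I \<in> V \<Longrightarrow> i \<in> I \<Longrightarrow> k \<in> I \<Longrightarrow> U $ i \<bullet> q I k = (if i = k then 1 else 0)"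
    and expand: "I \<in> V \<Longrightarrow> u = (\<Sum>i\<in>I. (u \<bullet> q I i) *\<^sub>R U $ i)"
    and cover: "\<exists>I\<in>V. u \<in> gen_cone U I"
    and cover_index: "\<exists>I\<in>V. i \<in> I"
    and nonzero: "U $ i \<noteq> 0"
begin

text \<open>The point at which all constraints of \<open>I\<close> are tight. It is linear in
  \<open>z\<close> and defined for every \<open>z\<close>, even when it lies outside the deformed
  polytope.\<close>

definition vert :: "'n set \<Rightarrow> real ^ 'n \<Rightarrow> real ^ 'd" where
  "vert I z = - (\<Sum>k\<in>I. z $ k *\<^sub>R q I k)"

text \<open>Finitely many linear inequalities in \<open>z\<close>: at the candidate vertex of each
  maximal cone all other constraints are slack. This turns out to describe the interior of the
  deformation cone, and \<open>weak\<close> the cone itself.\<close>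

definition strict :: "real ^ 'n \<Rightarrow> bool" where
  "strict z \<longleftrightarrow> (\<forall>I\<in>V. \<forall>j. j \<notin> I \<longrightarrow> U $ j \<bullet> vert I z + z $ j > 0)"

definition weak :: "real ^ 'n \<Rightarrow> bool" where
  "weak z \<longleftrightarrow> (\<forall>I\<in>V. \<forall>j. j \<notin> I \<longrightarrow> U $ j \<bullet> vert I z + z $ j \<ge> 0)"

lemma strict_imp_weak: "strict z \<Longrightarrow> weak z"
  unfolding strict_def weak_def by (meson less_imp_le)

lemma V_nonempty: "V \<noteq> {}" using cover by auto

lemma inner_vert:
  assumes "I \<in> V" "i \<in> I" shows "U $ i \<bullet> vert I z = - z $ i"
proof -
  have "U $ i \<bullet> (\<Sum>k\<in>I. z $ k *\<^sub>R q I k) = (\<Sum>k\<in>I. if k = i then z $ k else 0)"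
    unfolding inner_sum_right by (intro sum.cong refl) (use assms dual in auto)
  then show ?thesis using assms by (simp add: vert_def)
qed

lemma inner_ext:
  assumes "I \<in> V" "\<And>i. i \<in> I \<Longrightarrow> U $ i \<bullet> x = U $ i \<bullet> y" shows "x = y"
proof -
  have "u \<bullet> x = u \<bullet> y" for u
    by (subst (1 2) expand[OF assms(1), of u]) (simp add: inner_sum_left assms(2))
  then show ?thesis by (metis inner_eq_zero_iff inner_diff_right right_minus_eq)
qed

lemma vert_mem:
  assumes "weak z" "I \<in> V" shows "vert I z \<in> deformed_polytope U z"
  unfolding mem_deformed_polytope
proof
  fix i
  show "U $ i \<bullet> vert I z + z $ i \<ge> 0"
    using assms inner_vert[of I i z] by (cases "i \<in> I") (auto simp: weak_def)
qed

text \<open>The difference of the two values of \<open>u\<close> is the sum of the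
  \<open>c i\<close> times the slacks of \<open>y\<close>, all nonnegative.\<close>

lemma vert_minimal:
  assumes "I \<in> V" "u = (\<Sum>i\<in>I. c i *\<^sub>R U $ i)" "\<And>i. i \<in> I \<Longrightarrow> c i \<ge> 0" "y \<in> deformed_polytope U z"
  shows "u \<bullet> vert I z \<le> u \<bullet> y"
    and "u \<bullet> y = u \<bullet> vert I z \<longleftrightarrow> (\<forall>i\<in>I. c i \<noteq> 0 \<longrightarrow> U $ i \<bullet> y = - z $ i)"
proof -
  have "u \<bullet> y - u \<bullet> vert I z = (\<Sum>i\<in>I. c i * (U $ i \<bullet> y + z $ i))"
    unfolding assms(2) inner_sum_left sum_subtractf[symmetric]
    by (intro sum.cong refl) (simp add: inner_vert[OF assms(1)] algebra_simps)
  moreover have nn: "\<And>i. i \<in> I \<Longrightarrow> 0 \<le> c i * (U $ i \<bullet> y + z $ i)"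
    using assms(3,4) by (simp add: mem_deformed_polytope)
  ultimately show "u \<bullet> vert I z \<le> u \<bullet> y" using sum_nonneg[of I "\<lambda>i. c i * (U $ i \<bullet> y + z $ i)"] by simp
  have "u \<bullet> y = u \<bullet> vert I z \<longleftrightarrow> (\<Sum>i\<in>I. c i * (U $ i \<bullet> y + z $ i)) = 0"
    using \<open>u \<bullet> y - u \<bullet> vert I z = _\<close> by auto
  also have "\<dots> \<longleftrightarrow> (\<forall>i\<in>I. c i * (U $ i \<bullet> y + z $ i) = 0)"
    by (rule sum_nonneg_eq_0_iff) (use nn in auto)
  also have "\<dots> \<longleftrightarrow> (\<forall>i\<in>I. c i \<noteq> 0 \<longrightarrow> U $ i \<bullet> y = - z $ i)" by (auto simp: add_eq_0_iff2)
  finally show "u \<bullet> y = u \<bullet> vert I z \<longleftrightarrow> (\<forall>i\<in>I. c i \<noteq> 0 \<longrightarrow> U $ i \<bullet> y = - z $ i)" .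
qed

lemma gen_cone_vert_minimal:
  assumes "I \<in> V" "u \<in> gen_cone U I" "y \<in> deformed_polytope U z"
  shows "u \<bullet> vert I z \<le> u \<bullet> y"
  using assms(2)
proof (rule gen_coneE)
  fix c assume "\<And>i. i \<in> I \<Longrightarrow> 0 \<le> c i" "u = (\<Sum>i\<in>I. c i *\<^sub>R U $ i)"
  then show ?thesis using vert_minimal(1)[OF assms(1) _ _ assms(3)] by blast
qed

section \<open>Faces, normal fan and deformation cone of a deformed polytope\<close>

definition act_face :: "real ^ 'n \<Rightarrow> 'n set \<Rightarrow> (real ^ 'd) set" where
  "act_face z K = {y \<in> deformed_polytope U z. \<forall>i\<in>K. U $ i \<bullet> y = - z $ i}"

lemma vert_mem_act_face: "weak z \<Longrightarrow> I \<in> V \<Longrightarrow> K \<subseteq> I \<Longrightarrow> vert I z \<in> act_face z K"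
  by (auto simp: act_face_def vert_mem inner_vert)

text \<open>By strictness only the constraints of \<open>I\<close> are active at
  \<open>vert I z\<close>, so a short step along a dual vector \<open>q I k\<close> is feasible.
  Minimality of \<open>u\<close> makes its \<open>k\<close>-th coefficient nonnegative; for
  \<open>k\<close> outside \<open>K\<close> the step stays in the face, and the coefficient is
  zero.\<close>

lemma normal_cone_act_face:
  assumes z: "strict z" and I: "I \<in> V" "K \<subseteq> I"
  shows "normal_cone (deformed_polytope U z) (act_face z K) = gen_cone U K"
proof (rule equalityI; rule subsetI)
  fix u assume "u \<in> gen_cone U K"
  then obtain c where c: "\<And>i. i \<in> K \<Longrightarrow> c i \<ge> 0" "u = (\<Sum>i\<in>K. c i *\<^sub>R U $ i)" by (rule gen_coneE) blast
  show "u \<in> normal_cone (deformed_polytope U z) (act_face z K)"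
    unfolding normal_cone_def
  proof (intro CollectI ballI)
    fix x y assume x: "x \<in> act_face z K" and y: "y \<in> deformed_polytope U z"
    show "u \<bullet> x \<le> u \<bullet> y" unfolding c(2) inner_sum_left
    proof (rule sum_mono)
      fix i assume i: "i \<in> K"
      have "U $ i \<bullet> x = - z $ i" "0 \<le> U $ i \<bullet> y + z $ i"
        using x y i by (simp_all add: act_face_def mem_deformed_polytope)
      then have "U $ i \<bullet> x \<le> U $ i \<bullet> y" by simp
      then show "c i *\<^sub>R U $ i \<bullet> x \<le> c i *\<^sub>R U $ i \<bullet> y" using c(1)[OF i] by (simp add: mult_left_mono)
    qed
  qed
next
  fix u assume u: "u \<in> normal_cone (deformed_polytope U z) (act_face z K)"
  let ?v = "vert I z"
  have v: "?v \<in> act_face z K" "?v \<in> deformed_polytope U z"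
    using vert_mem_act_face vert_mem strict_imp_weak[OF z] I by blast+
  have active: "U $ i \<bullet> ?v + z $ i = 0 \<Longrightarrow> i \<in> I" for i using z I(1) by (force simp: strict_def)
  have step: "\<exists>e>0. ?v + e *\<^sub>R q I k \<in> deformed_polytope U z" if "k \<in> I" for k
    by (rule feasible_step[OF v(2)]) (use active dual I(1) that in auto)
  have nonneg: "u \<bullet> q I k \<ge> 0" if k: "k \<in> I" for k
  proof -
    obtain e where e: "e > 0" "?v + e *\<^sub>R q I k \<in> deformed_polytope U z" using step[OF k] by blast
    then have "u \<bullet> ?v \<le> u \<bullet> (?v + e *\<^sub>R q I k)" using u v(1) unfolding normal_cone_def by blast
    then show ?thesis using e(1) by (simp add: inner_add_right zero_le_mult_iff)
  qed
  have zero: "u \<bullet> q I k = 0" if k: "k \<in> I" "k \<notin> K" for k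
  proof -
    obtain e where e: "e > 0" "?v + e *\<^sub>R q I k \<in> deformed_polytope U z" using step[OF k(1)] by blast
    have "?v + e *\<^sub>R q I k \<in> act_face z K"
      unfolding act_face_def
    proof (intro CollectI conjI ballI e(2))
      fix i assume "i \<in> K"
      then have "i \<in> I" "i \<noteq> k" using I(2) k(2) by auto
      then show "U $ i \<bullet> (?v + e *\<^sub>R q I k) = - z $ i"
        using dual[OF I(1) _ k(1)] by (simp add: inner_add_right inner_vert[OF I(1)])
    qed
    then have "u \<bullet> (?v + e *\<^sub>R q I k) \<le> u \<bullet> ?v" using u v(2) unfolding normal_cone_def by blast
    then have "e * (u \<bullet> q I k) \<le> 0" by (simp add: inner_add_right)
    then show ?thesis using e(1) nonneg[OF k(1)] by (simp add: mult_le_0_iff)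
  qed
  have "(\<Sum>i\<in>I. (u \<bullet> q I i) *\<^sub>R U $ i) = (\<Sum>i\<in>K. (u \<bullet> q I i) *\<^sub>R U $ i)"
    by (rule sum.mono_neutral_right) (use I(2) zero in auto)
  then have eq: "u = (\<Sum>i\<in>K. (u \<bullet> q I i) *\<^sub>R U $ i)" by (rule trans[OF expand[OF I(1)]])
  have "(\<Sum>i\<in>K. (u \<bullet> q I i) *\<^sub>R U $ i) \<in> gen_cone U K"
    by (rule gen_coneI) (use nonneg I(2) in auto)
  then show "u \<in> gen_cone U K" by (simp only: eq[symmetric])
qed

text \<open>A nonempty face is exposed by some \<open>a\<close>; the inner normal \<open>- a\<close>
  lies in a cone \<open>I\<close>, and its nonzero coefficients name the constraints tight on the
  face. Conversely the sum of the generators in \<open>K\<close> exposes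
  \<open>act_face z K\<close>.\<close>

lemma normal_fan_deformed_polytope:
  assumes z: "strict z"
  shows "normal_fan (deformed_polytope U z) = {gen_cone U K | K I. I \<in> V \<and> K \<subseteq> I}"
proof (rule equalityI; rule subsetI)
  let ?P = "deformed_polytope U z"
  fix \<sigma> assume "\<sigma> \<in> normal_fan ?P"
  then obtain F where F: "\<sigma> = normal_cone ?P F" "F face_of ?P" "F \<noteq> {}" unfolding normal_fan_def by blast
  then obtain a b where ab: "?P \<subseteq> {x. a \<bullet> x \<le> b}" "F = ?P \<inter> {x. a \<bullet> x = b}"
    using exposed_face_of_polyhedron[OF polyhedron_deformed_polytope, of F U z] unfolding exposed_face_of_def by blast
  obtain I where I: "I \<in> V" "- a \<in> gen_cone U I" using cover by blast
  obtain c where c: "\<And>i. i \<in> I \<Longrightarrow> c i \<ge> 0" "- a = (\<Sum>i\<in>I. c i *\<^sub>R U $ i)" using I(2) by (rule gen_coneE) blast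
  define K where "K = {i\<in>I. c i \<noteq> 0}"
  obtain y0 where y0: "y0 \<in> F" using F(3) by blast
  have vm: "vert I z \<in> ?P" by (rule vert_mem[OF strict_imp_weak[OF z] I(1)])
  have "- a \<bullet> vert I z \<le> - a \<bullet> y0" using vert_minimal(1)[OF I(1) c(2) c(1)] y0 ab(2) by blast
  then have av: "a \<bullet> vert I z = b" using vm ab y0 by force
  have "F = act_face z K"
  proof -
    have "a \<bullet> y = b \<longleftrightarrow> (\<forall>i\<in>K. U $ i \<bullet> y = - z $ i)" if "y \<in> ?P" for y
      using vert_minimal(2)[OF I(1) c(2) c(1) that] av by (auto simp: K_def)
    then show ?thesis unfolding ab(2) act_face_def by blast
  qed
  then have "\<sigma> = gen_cone U K" using normal_cone_act_face[OF z I(1), of K] F(1) by (auto simp: K_def)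
  then show "\<sigma> \<in> {gen_cone U K | K I. I \<in> V \<and> K \<subseteq> I}" using I(1) K_def by blast
next
  let ?P = "deformed_polytope U z"
  fix \<sigma> assume "\<sigma> \<in> {gen_cone U K | K I. I \<in> V \<and> K \<subseteq> I}"
  then obtain K I where K: "\<sigma> = gen_cone U K" "I \<in> V" "K \<subseteq> I" by blast
  define u where "u = (\<Sum>i\<in>I. (if i \<in> K then 1 else 0 :: real) *\<^sub>R U $ i)"
  have min: "u \<bullet> vert I z \<le> u \<bullet> y" "u \<bullet> y = u \<bullet> vert I z \<longleftrightarrow> (\<forall>i\<in>K. U $ i \<bullet> y = - z $ i)" if "y \<in> ?P" for y
    using vert_minimal[OF K(2) u_def _ that] K(3) by (auto split: if_splits)
  have "act_face z K = ?P \<inter> {x. u \<bullet> x = u \<bullet> vert I z}" unfolding act_face_def using min(2) by blast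
  then have "act_face z K face_of ?P"
    using face_of_Int_supporting_hyperplane_ge[OF convex_deformed_polytope min(1)] by simp
  moreover have "act_face z K \<noteq> {}" using vert_mem_act_face[OF strict_imp_weak[OF z] K(2,3)] by blast
  ultimately show "\<sigma> \<in> normal_fan ?P"
    unfolding normal_fan_def K(1) using normal_cone_act_face[OF z K(2,3)] by blast
qed

text \<open>If \<open>U $ j\<close> lies in the cone of \<open>I\<close>, then
  \<open>vert I z\<close> minimises it over the polytope. The minimum is at most
  \<open>- z $ j\<close>, attained at the vertex of any cone containing \<open>j\<close>, so
  constraint \<open>j\<close> is active at \<open>vert I z\<close>.\<close>

lemma generator_in_cone:
  assumes z: "strict z" and I: "I \<in> V" "U $ j \<in> gen_cone U I"
  shows "j \<in> I"
proof (rule ccontr)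
  assume "j \<notin> I"
  then have "U $ j \<bullet> vert I z + z $ j > 0" using z I(1) by (simp add: strict_def)
  moreover obtain J where J: "J \<in> V" "j \<in> J" using cover_index by blast
  have "U $ j \<bullet> vert I z \<le> U $ j \<bullet> vert J z"
    by (rule gen_cone_vert_minimal[OF I vert_mem[OF strict_imp_weak[OF z] J(1)]])
  then have "U $ j \<bullet> vert I z \<le> - z $ j" using inner_vert[OF J] by simp
  ultimately show False by simp
qed

lemma generator_in_ray:
  assumes z: "strict z" and "U $ j \<in> gen_cone U {i}"
  shows "j = i"
proof -
  obtain I where I: "I \<in> V" "i \<in> I" using cover_index by blast
  then have j: "j \<in> I" using generator_in_cone[OF z I(1)] gen_cone_mono[of "{i}" I U] assms(2) by blast
  obtain c where "U $ j = (\<Sum>k\<in>{i}. c k *\<^sub>R U $ k)" using assms(2) by (rule gen_coneE) blast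
  then have "U $ j = c i *\<^sub>R U $ i" by simp
  then have "U $ j \<bullet> q I j = c i * (U $ i \<bullet> q I j)" by simp
  then show ?thesis using dual[OF I(1)] j I(2) by (auto split: if_splits)
qed

text \<open>Once every constraint is known to be tight somewhere, the face whose normal cone is
  \<open>gen_cone U I\<close> satisfies all constraints of \<open>I\<close> with equality and so is
  the point \<open>vert I z\<close>. A further constraint active there would put its normal into
  that cone, contrary to \<open>generator_in_cone\<close> for \<open>z0\<close>.\<close>

lemma strict_if_same_fan:
  assumes z0: "strict z0" and fan: "normal_fan (deformed_polytope U z) = normal_fan (deformed_polytope U z0)"
  shows "strict z"
proof -
  let ?P = "deformed_polytope U z"
  have cones: "\<exists>F. F face_of ?P \<and> F \<noteq> {} \<and> normal_cone ?P F = gen_cone U K" if "I \<in> V" "K \<subseteq> I" for I K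
  proof -
    have "gen_cone U K \<in> normal_fan ?P"
      unfolding fan normal_fan_deformed_polytope[OF z0] using that by blast
    then show ?thesis unfolding normal_fan_def by blast
  qed
  text \<open>Every inequality defines a nonempty face: in the relative interior of the face with normal
    cone \<open>ray U i\<close>, no inequality other than the \<open>i\<close>-th can be active.\<close>
  have tight: "\<exists>y\<in>?P. U $ i \<bullet> y = - z $ i" for i
  proof -
    obtain I where I: "I \<in> V" "i \<in> I" using cover_index by blast
    then obtain G where G: "G face_of ?P" "G \<noteq> {}" "normal_cone ?P G = gen_cone U {i}"
      using cones[of I "{i}"] by auto
    have GP: "G \<subseteq> ?P" by (rule face_of_imp_subset[OF G(1)])
    have cG: "convex G" by (rule face_of_imp_convex[OF G(1)])
    then obtain y where y: "y \<in> rel_interior G" using rel_interior_eq_empty[OF cG] G(2) by blast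
    then have yP: "y \<in> ?P" "y \<in> G" using GP rel_interior_subset by auto
    have act: "j = i" if "U $ j \<bullet> y + z $ j = 0" for j
    proof -
      have min: "U $ j \<bullet> y \<le> U $ j \<bullet> x" if "x \<in> ?P" for x
      proof -
        have "U $ j \<bullet> x + z $ j \<ge> 0" using that by (simp add: mem_deformed_polytope)
        then show ?thesis using \<open>U $ j \<bullet> y + z $ j = 0\<close> by simp
      qed
      \<comment> \<open>A point of \<open>G\<close> with a larger value could be reflected slightly
        beyond \<open>y\<close>, which is relatively interior, giving a value below the
        minimum.\<close>
      have const: "U $ j \<bullet> g \<le> U $ j \<bullet> y" if g: "g \<in> G" for g
      proof -
        obtain e where e: "e > 1" "(1 - e) *\<^sub>R g + e *\<^sub>R y \<in> G"
          using y g convex_rel_interior_iff[OF cG G(2)] by blast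
        then have "U $ j \<bullet> y \<le> U $ j \<bullet> ((1 - e) *\<^sub>R g + e *\<^sub>R y)" using min GP by blast
        then have "(e - 1) * (U $ j \<bullet> g) \<le> (e - 1) * (U $ j \<bullet> y)" by (simp add: inner_add_right algebra_simps)
        then show ?thesis using e(1) by simp
      qed
      have "U $ j \<in> normal_cone ?P G" unfolding normal_cone_def using min const by (force intro: order_trans)
      then show ?thesis using generator_in_ray[OF z0] G(3) by simp
    qed
    \<comment> \<open>Otherwise no constraint is active at \<open>y\<close>, and a short step
      against \<open>U $ i\<close> lowers a functional that is minimal on \<open>G\<close>.\<close>
    have "U $ i \<bullet> y + z $ i = 0"
    proof (rule ccontr)
      assume "U $ i \<bullet> y + z $ i \<noteq> 0"
      then have "U $ j \<bullet> y + z $ j \<noteq> 0" for j using act by blast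
      then obtain e where e: "e > 0" "y + e *\<^sub>R (- U $ i) \<in> ?P" using feasible_step[OF yP(1), of "- U $ i"] by blast
      have "U $ i \<in> normal_cone ?P G" unfolding G(3) by (rule gen_cone_generator) simp
      then have "U $ i \<bullet> y \<le> U $ i \<bullet> (y + e *\<^sub>R (- U $ i))" using yP(2) e(2) unfolding normal_cone_def by blast
      then have "e * (U $ i \<bullet> U $ i) \<le> 0" by (simp add: inner_diff_right)
      moreover have "e * (U $ i \<bullet> U $ i) > 0" using e(1) nonzero[of i] by simp
      ultimately show False by simp
    qed
    then show ?thesis using yP(1) by (auto simp: add_eq_0_iff2)
  qed
  show ?thesis unfolding strict_def
  proof (intro ballI allI impI)
    fix I j assume I: "I \<in> V" and j: "j \<notin> I"
    obtain F where F: "F face_of ?P" "F \<noteq> {}" "normal_cone ?P F = gen_cone U I" using cones[OF I] by blast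
    have Feq: "y = vert I z" if y: "y \<in> F" for y
    proof (rule inner_ext[OF I])
      fix i assume i: "i \<in> I"
      obtain x where x: "x \<in> ?P" "U $ i \<bullet> x = - z $ i" using tight by blast
      have "U $ i \<in> normal_cone ?P F" unfolding F(3) using i by (rule gen_cone_generator)
      then have "U $ i \<bullet> y \<le> - z $ i" using y x unfolding normal_cone_def by force
      moreover have "y \<in> ?P" using y face_of_imp_subset[OF F(1)] by blast
      then have "U $ i \<bullet> y + z $ i \<ge> 0" by (simp add: mem_deformed_polytope)
      ultimately show "U $ i \<bullet> y = U $ i \<bullet> vert I z" using inner_vert[OF I i] by simp
    qed
    then have Fv: "F = {vert I z}" using F(2) by blast
    then have v: "vert I z \<in> ?P" using face_of_imp_subset[OF F(1)] by blast
    then have ge: "U $ j \<bullet> vert I z + z $ j \<ge> 0" by (simp add: mem_deformed_polytope)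
    have "U $ j \<bullet> vert I z + z $ j \<noteq> 0"
    proof
      assume 0: "U $ j \<bullet> vert I z + z $ j = 0"
      have "U $ j \<bullet> vert I z \<le> U $ j \<bullet> y" if "y \<in> ?P" for y
      proof -
        have "U $ j \<bullet> y + z $ j \<ge> 0" using that by (simp add: mem_deformed_polytope)
        then show ?thesis using 0 by simp
      qed
      then have "U $ j \<in> normal_cone ?P F" unfolding Fv normal_cone_def by simp
      then show False using generator_in_cone[OF z0 I] F(3) j by simp
    qed
    then show "U $ j \<bullet> vert I z + z $ j > 0" using ge by simp
  qed
qed

lemma strict_iff_same_fan:
  assumes "strict z0"
  shows "strict z \<longleftrightarrow> normal_fan (deformed_polytope U z) = normal_fan (deformed_polytope U z0)"
proof
  assume "strict z"
  then show "normal_fan (deformed_polytope U z) = normal_fan (deformed_polytope U z0)"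
    using assms by (simp only: normal_fan_deformed_polytope)
qed (rule strict_if_same_fan[OF assms])

text \<open>On the cone of \<open>I\<close> the function has to be minus the inner product with
  \<open>vert I z\<close>. Convexity makes it dominate this linear function at every other
  generator, which is the inequality in \<open>weak\<close>. Conversely the maximum of these linear
  functions, which is minus the minimum of \<open>u\<close> over the polytope, is convex and linear
  on cones.\<close>

lemma deformation_cone_iff_weak:
  assumes z0: "strict z0"
  shows "z \<in> deformation_cone (normal_fan (deformed_polytope U z0)) U \<longleftrightarrow> weak z"
proof
  assume "z \<in> deformation_cone (normal_fan (deformed_polytope U z0)) U"
  then obtain \<phi> where \<phi>: "\<forall>\<sigma>\<in>normal_fan (deformed_polytope U z0). \<exists>f. linear f \<and> (\<forall>x\<in>\<sigma>. \<phi> x = f x)"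
    "\<forall>i. \<phi> (U $ i) = z $ i" "convex_on UNIV \<phi>" unfolding deformation_cone_def by blast
  show "weak z" unfolding weak_def
  proof (intro ballI allI impI)
    fix I j assume I: "I \<in> V" and j: "j \<notin> I"
    have "gen_cone U I \<in> normal_fan (deformed_polytope U z0)"
      unfolding normal_fan_deformed_polytope[OF z0] using I by blast
    then obtain f where f: "linear f" "\<forall>x\<in>gen_cone U I. \<phi> x = f x" using \<phi>(1) by blast
    have fi: "f (U $ i) = z $ i" if "i \<in> I" for i using f(2) gen_cone_generator[OF that] \<phi>(2) by metis
    have feq: "f x = - (x \<bullet> vert I z)" for x
    proof -
      have "f x = (\<Sum>i\<in>I. (x \<bullet> q I i) * z $ i)"
        by (subst expand[OF I, of x]) (simp add: linear_sum[OF f(1)] linear_cmul[OF f(1)] fi)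
      then show ?thesis by (simp add: vert_def inner_sum_right mult.commute)
    qed
    \<comment> \<open>All coefficients of \<open>x0\<close> are 1, so a short step from it towards
      any \<open>x\<close> stays inside the cone, where convexity can be compared with the linear
      function.\<close>
    define x0 where "x0 = (\<Sum>i\<in>I. 1 *\<^sub>R U $ i)"
    have x0: "x0 \<in> gen_cone U I" unfolding x0_def by (rule gen_coneI) simp
    define x where "x = U $ j"
    have "\<forall>\<^sub>F t in at_right (0::real). 0 < (1 - t) * 1 + t * (x \<bullet> q I i)" for i
    proof (rule order_tendstoD)
      show "((\<lambda>t. (1 - t) * 1 + t * (x \<bullet> q I i)) \<longlongrightarrow> (1 - 0) * 1 + 0 * (x \<bullet> q I i)) (at_right 0)"
        by (intro tendsto_intros)
    qed simp
    then have "\<forall>\<^sub>F t in at_right (0::real). \<forall>i. 0 < (1 - t) * 1 + t * (x \<bullet> q I i)"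
      by (simp add: eventually_all_finite)
    moreover have "\<forall>\<^sub>F t in at_right (0::real). t \<in> {0<..<1}" by (rule eventually_at_right_real) simp
    ultimately have "\<forall>\<^sub>F t in at_right (0::real). t \<in> {0<..<1} \<and> (\<forall>i. 0 < (1 - t) * 1 + t * (x \<bullet> q I i))"
      by (rule eventually_conj[rotated])
    then obtain t where t: "0 < t" "t < 1" "\<And>i. 0 < (1 - t) * 1 + t * (x \<bullet> q I i)"
      using eventually_happens'[of "at_right (0::real)"] by (metis (no_types, lifting) greaterThanLessThan_iff trivial_limit_at_right_real)
    have "(1 - t) *\<^sub>R x0 + t *\<^sub>R x = (\<Sum>i\<in>I. ((1 - t) * 1 + t * (x \<bullet> q I i)) *\<^sub>R U $ i)"
      unfolding x0_def by (subst expand[OF I, of x]) (simp add: scaleR_sum_right scaleR_left_distrib sum.distrib)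
    then have mem: "(1 - t) *\<^sub>R x0 + t *\<^sub>R x \<in> gen_cone U I"
      by (simp only:) (rule gen_coneI, rule less_imp_le[OF t(3)])
    have "\<phi> ((1 - t) *\<^sub>R x0 + t *\<^sub>R x) \<le> (1 - t) * \<phi> x0 + t * \<phi> x"
      using convex_onD[OF \<phi>(3), of t x0 x] t by simp
    moreover have "\<phi> ((1 - t) *\<^sub>R x0 + t *\<^sub>R x) = (1 - t) * f x0 + t * f x"
      using f(2) mem by (simp add: linear_add[OF f(1)] linear_cmul[OF f(1)])
    moreover have "\<phi> x0 = f x0" using f(2) x0 by blast
    ultimately have "t * f x \<le> t * \<phi> x" by simp
    then have "f x \<le> \<phi> x" using t(1) by simp
    then show "U $ j \<bullet> vert I z + z $ j \<ge> 0" using \<phi>(2) by (simp add: feq x_def)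
  qed
next
  assume w: "weak z"
  define \<phi> where "\<phi> u = Max ((\<lambda>I. - (u \<bullet> vert I z)) ` V)" for u
  have ge: "- (u \<bullet> vert I z) \<le> \<phi> u" if "I \<in> V" for u I
    unfolding \<phi>_def by (rule Max_ge) (use that in auto)
  have eq: "\<phi> u = - (u \<bullet> vert I z)" if I: "I \<in> V" "u \<in> gen_cone U I" for u I
  proof (rule antisym)
    show "\<phi> u \<le> - (u \<bullet> vert I z)" unfolding \<phi>_def
    proof (rule Max.boundedI)
      fix a assume "a \<in> (\<lambda>I. - (u \<bullet> vert I z)) ` V"
      then obtain J where J: "J \<in> V" "a = - (u \<bullet> vert J z)" by blast
      then show "a \<le> - (u \<bullet> vert I z)" using gen_cone_vert_minimal[OF I vert_mem[OF w J(1)]] by simp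
    qed (use V_nonempty in auto)
  qed (rule ge[OF I(1)])
  have lin: "linear (\<lambda>u. - (u \<bullet> vert I z))" for I
    by (rule linearI) (auto simp: inner_add_left)
  show "z \<in> deformation_cone (normal_fan (deformed_polytope U z0)) U"
    unfolding deformation_cone_def
  proof (rule CollectI, rule exI[of _ \<phi>], intro conjI ballI allI)
    fix \<sigma> assume "\<sigma> \<in> normal_fan (deformed_polytope U z0)"
    then obtain K I where K: "\<sigma> = gen_cone U K" "I \<in> V" "K \<subseteq> I"
      unfolding normal_fan_deformed_polytope[OF z0] by blast
    then have "\<forall>x\<in>\<sigma>. \<phi> x = - (x \<bullet> vert I z)" using eq[OF K(2)] gen_cone_mono[OF K(3), of U] by blast
    then show "\<exists>f. linear f \<and> (\<forall>x\<in>\<sigma>. \<phi> x = f x)" using lin[of I] by (intro exI[of _ "\<lambda>u. - (u \<bullet> vert I z)"]) simp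
  next
    fix i
    obtain I where I: "I \<in> V" "i \<in> I" using cover_index by blast
    then show "\<phi> (U $ i) = z $ i" using eq[OF I(1) gen_cone_generator[OF I(2)]] inner_vert[OF I] by simp
  next
    show "convex_on UNIV \<phi>"
    proof (rule convex_onI)
      fix t :: real and x y assume t: "0 < t" "t < 1"
      show "\<phi> ((1 - t) *\<^sub>R x + t *\<^sub>R y) \<le> (1 - t) * \<phi> x + t * \<phi> y"
        unfolding \<phi>_def[of "(1 - t) *\<^sub>R x + t *\<^sub>R y"]
      proof (rule Max.boundedI)
        fix a assume "a \<in> (\<lambda>I. - (((1 - t) *\<^sub>R x + t *\<^sub>R y) \<bullet> vert I z)) ` V"
        then obtain I where I: "I \<in> V" "a = (1 - t) * - (x \<bullet> vert I z) + t * - (y \<bullet> vert I z)"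
          by (auto simp: inner_add_left)
        then show "a \<le> (1 - t) * \<phi> x + t * \<phi> y"
          using t ge[OF I(1), of x] ge[OF I(1), of y] by (simp only: I(2)) (intro add_mono mult_left_mono; simp)
      qed (use V_nonempty in auto)
    qed simp
  qed
qed

text \<open>\<open>vert I z\<close> reads only the coordinates of \<open>z\<close> in
  \<open>I\<close>, so changing \<open>z $ j\<close> moves this one slack directly.\<close>

lemma slack_add_axis:
  assumes "j \<notin> I"
  shows "U $ j \<bullet> vert I (z + e *\<^sub>R axis j 1) + (z + e *\<^sub>R axis j 1) $ j = U $ j \<bullet> vert I z + z $ j + e"
proof -
  have "vert I (z + e *\<^sub>R axis j 1) = vert I z"
    unfolding vert_def using assms by (intro arg_cong[of _ _ uminus] sum.cong) (auto simp: axis_def)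
  then show ?thesis by (simp add: axis_def)
qed

text \<open>Strict inequalities are open. Conversely, at an interior point one may lower
  \<open>z $ j\<close> by a positive amount and stay weak, so the slack was positive before.\<close>

lemma interior_deformation_cone:
  assumes z0: "strict z0"
  shows "interior (deformation_cone (normal_fan (deformed_polytope U z0)) U) = {z. strict z}"
proof (rule equalityI)
  let ?D = "deformation_cone (normal_fan (deformed_polytope U z0)) U"
  show "{z. strict z} \<subseteq> interior ?D"
  proof (rule interior_maximal)
    show "{z. strict z} \<subseteq> ?D" using deformation_cone_iff_weak[OF z0] strict_imp_weak by blast
    have "{z. strict z} = (\<Inter>I\<in>V. \<Inter>j\<in>- I. {z. 0 < U $ j \<bullet> vert I z + z $ j})" by (auto simp: strict_def)
    also have "open \<dots>"
    proof (intro open_INT finite ballI)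
      fix I j
      show "open {z. 0 < U $ j \<bullet> vert I z + z $ j}"
        unfolding vert_def by (intro open_Collect_less continuous_intros)
    qed
    finally show "open {z. strict z}" .
  qed
  show "interior ?D \<subseteq> {z. strict z}"
  proof (intro subsetI CollectI)
    fix z assume "z \<in> interior ?D"
    then obtain e where e: "e > 0" "ball z e \<subseteq> ?D" unfolding mem_interior by blast
    show "strict z" unfolding strict_def
    proof (intro ballI allI impI)
      fix I j assume I: "I \<in> V" "j \<notin> I"
      have "z + (- (e / 2)) *\<^sub>R axis j 1 \<in> ball z e" using e(1) by (simp add: dist_norm)
      then have "weak (z + (- (e / 2)) *\<^sub>R axis j 1)" using e(2) deformation_cone_iff_weak[OF z0] by blast
      then have "0 \<le> U $ j \<bullet> vert I (z + (- (e / 2)) *\<^sub>R axis j 1) + (z + (- (e / 2)) *\<^sub>R axis j 1) $ j"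
        using I unfolding weak_def by blast
      then have "0 \<le> U $ j \<bullet> vert I z + z $ j + - (e / 2)" unfolding slack_add_axis[OF I(2)] .
      then show "U $ j \<bullet> vert I z + z $ j > 0" using e(1) by simp
    qed
  qed
qed

lemma rays_of_gen_cone:
  assumes z: "strict z" and I: "I \<in> V"
  shows "rays_of U (gen_cone U I) = I"
proof (rule equalityI; rule subsetI)
  fix i assume "i \<in> rays_of U (gen_cone U I)"
  then have "ray U i \<subseteq> gen_cone U I" by (simp add: rays_of_def face_of_imp_subset)
  moreover have "U $ i \<in> ray U i" unfolding gen_cone_singleton[symmetric] by (rule gen_cone_generator) simp
  ultimately show "i \<in> I" using generator_in_cone[OF z I] by blast
next
  fix i assume i: "i \<in> I"
  \<comment> \<open>The inner product with \<open>w\<close> adds up all coefficients except the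
    \<open>i\<close>-th, so it is nonnegative on the cone and vanishes exactly on the ray of
    \<open>i\<close>.\<close>
  define w where "w = (\<Sum>k\<in>I - {i}. q I k)"
  have w: "u \<bullet> w = (\<Sum>k\<in>I - {i}. c k)" if "u = (\<Sum>k\<in>I. c k *\<^sub>R U $ k)" for u c
  proof -
    have "u \<bullet> q I k = c k" if k: "k \<in> I" for k
    proof -
      have "u \<bullet> q I k = (\<Sum>l\<in>I. if l = k then c l else 0)"
        unfolding \<open>u = _\<close> inner_sum_left by (intro sum.cong refl) (use dual[OF I _ k] in auto)
      then show ?thesis using k by simp
    qed
    then show ?thesis unfolding w_def inner_sum_right by (intro sum.cong) auto
  qed
  have cvx: "convex (gen_cone U I)"
    unfolding convex_def
  proof (intro ballI allI impI)
    fix x y and a b :: real assume "x \<in> gen_cone U I" "y \<in> gen_cone U I" and ab: "0 \<le> a" "0 \<le> b" "a + b = 1"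
    then obtain c d where cd: "\<And>k. k \<in> I \<Longrightarrow> c k \<ge> 0" "x = (\<Sum>k\<in>I. c k *\<^sub>R U $ k)"
      "\<And>k. k \<in> I \<Longrightarrow> d k \<ge> 0" "y = (\<Sum>k\<in>I. d k *\<^sub>R U $ k)" by (elim gen_coneE) blast
    have "a *\<^sub>R x + b *\<^sub>R y = (\<Sum>k\<in>I. (a * c k + b * d k) *\<^sub>R U $ k)"
      unfolding cd(2,4) by (simp add: scaleR_sum_right scaleR_left_distrib sum.distrib)
    also have "\<dots> \<in> gen_cone U I" by (rule gen_coneI) (use cd(1,3) ab in simp)
    finally show "a *\<^sub>R x + b *\<^sub>R y \<in> gen_cone U I" .
  qed
  have "gen_cone U I \<inter> {x. w \<bullet> x = 0} face_of gen_cone U I"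
  proof (rule face_of_Int_supporting_hyperplane_ge[OF cvx])
    fix x assume "x \<in> gen_cone U I"
    then obtain c where c: "\<And>k. k \<in> I \<Longrightarrow> c k \<ge> 0" "x = (\<Sum>k\<in>I. c k *\<^sub>R U $ k)" by (rule gen_coneE) blast
    have "0 \<le> (\<Sum>k\<in>I - {i}. c k)" by (rule sum_nonneg) (use c(1) in auto)
    then show "0 \<le> w \<bullet> x" using w[OF c(2)] by (simp add: inner_commute)
  qed
  moreover have "gen_cone U I \<inter> {x. w \<bullet> x = 0} = ray U i"
  proof (rule equalityI; rule subsetI)
    fix x assume x: "x \<in> gen_cone U I \<inter> {x. w \<bullet> x = 0}"
    then obtain c where c: "\<And>k. k \<in> I \<Longrightarrow> c k \<ge> 0" "x = (\<Sum>k\<in>I. c k *\<^sub>R U $ k)" by (blast elim: gen_coneE)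
    have "(\<Sum>k\<in>I - {i}. c k) = 0" using x w[OF c(2)] by (simp add: inner_commute)
    then have "\<And>k. k \<in> I - {i} \<Longrightarrow> c k = 0" using c(1) by (subst (asm) sum_nonneg_eq_0_iff) auto
    then have "x = (\<Sum>k\<in>{i}. c k *\<^sub>R U $ k)" unfolding c(2) using i by (intro sum.mono_neutral_right) auto
    also have "\<dots> \<in> gen_cone U {i}" by (rule gen_coneI) (use c(1) i in auto)
    finally show "x \<in> ray U i" by (simp add: gen_cone_singleton)
  next
    fix x assume "x \<in> ray U i"
    then obtain c where c: "c \<ge> 0" "x = c *\<^sub>R U $ i" 
      using gen_coneE[of x U "{i}" thesis] unfolding gen_cone_singleton[symmetric] by auto
    have "x = (\<Sum>k\<in>I. (if k = i then c else 0) *\<^sub>R U $ k)"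
      using i by (simp add: c(2) if_distrib[of "\<lambda>a. a *\<^sub>R _"] cong: if_cong)
    then have "x \<bullet> w = 0" using w by (simp add: sum.neutral)
    moreover have "x \<in> gen_cone U I"
      unfolding \<open>x = (\<Sum>k\<in>I. _)\<close> by (rule gen_coneI) (use c(1) in auto)
    ultimately show "x \<in> gen_cone U I \<inter> {x. w \<bullet> x = 0}" by (simp add: inner_commute)
  qed
  ultimately show "i \<in> rays_of U (gen_cone U I)" by (simp add: rays_of_def)
qed

text \<open>The generators of a maximal cone span the space, while a proper subset of them is too
  small to do so.\<close>

lemma cones_of_dim_full:
  assumes z: "strict z"
  shows "cones_of_dim (normal_fan (deformed_polytope U z)) CARD('d) = gen_cone U ` V"
proof -
  have dim: "aff_dim (gen_cone U K) = int (dim (gen_cone U K))" for K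
  proof (rule aff_dim_zero)
    have "(\<Sum>i\<in>K. 0 *\<^sub>R U $ i) \<in> gen_cone U K" by (rule gen_coneI) simp
    then show "0 \<in> affine hull (gen_cone U K)" by (simp add: hull_inc)
  qed
  have full: "dim (gen_cone U I) = CARD('d)" if I: "I \<in> V" for I
  proof -
    have "u \<in> span (gen_cone U I)" for u
      by (subst expand[OF I, of u]) (intro span_sum span_scale span_base gen_cone_generator)
    then have "span (gen_cone U I) = UNIV" by blast
    then show ?thesis using dim_span[of "gen_cone U I"] by simp
  qed
  have small: "K = I" if I: "I \<in> V" "K \<subseteq> I" "dim (gen_cone U K) = CARD('d)" for I K
  proof -
    have "gen_cone U K \<subseteq> span (($) U ` K)"
    proof
      fix u assume "u \<in> gen_cone U K"
      then obtain c where "u = (\<Sum>i\<in>K. c i *\<^sub>R U $ i)" by (rule gen_coneE) blast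
      then show "u \<in> span (($) U ` K)" by (simp only:) (intro span_sum span_scale span_base imageI)
    qed
    then have "dim (gen_cone U K) \<le> card (($) U ` K)" by (rule dim_le_card) simp
    also have "\<dots> \<le> card K" by (rule card_image_le) simp
    finally have "card I \<le> card K" using I(3) card_V[OF I(1)] by simp
    then show ?thesis using I(2) by (intro card_seteq) auto
  qed
  show ?thesis unfolding cones_of_dim_def normal_fan_deformed_polytope[OF z] dim
  proof (rule equalityI; rule subsetI)
    fix \<sigma> assume "\<sigma> \<in> {\<sigma> \<in> {gen_cone U K |K I. I \<in> V \<and> K \<subseteq> I}. aff_dim \<sigma> = int CARD('d)}"
    then obtain K I where "\<sigma> = gen_cone U K" "I \<in> V" "K \<subseteq> I" "dim (gen_cone U K) = CARD('d)" using dim by auto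
    then show "\<sigma> \<in> gen_cone U ` V" using small[of I K] by blast
  next
    fix \<sigma> assume "\<sigma> \<in> gen_cone U ` V"
    then show "\<sigma> \<in> {\<sigma> \<in> {gen_cone U K |K I. I \<in> V \<and> K \<subseteq> I}. aff_dim \<sigma> = int CARD('d)}"
      using dim full by auto
  qed
qed

lemma inj_on_gen_cone:
  assumes "strict z" shows "inj_on (gen_cone U) V"
  by (rule inj_on_inverseI[where g = "rays_of U"]) (rule rays_of_gen_cone[OF assms])

text \<open>Strictness recovers \<open>I\<close> as the set of constraints active at
  \<open>vert I z\<close>.\<close>

lemma vert_inj:
  assumes z: "strict z" and "I \<in> V" "J \<in> V" "vert I z = vert J z" shows "I = J"
proof -
  have "A \<subseteq> B" if "A \<in> V" "B \<in> V" "vert A z = vert B z" for A B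
  proof
    fix j assume "j \<in> A"
    then have "U $ j \<bullet> vert B z + z $ j = 0" using inner_vert[OF that(1), of j z] that(3) by simp
    then show "j \<in> B" using z that(2) unfolding strict_def by force
  qed
  then show ?thesis using assms by (intro equalityI) auto
qed

section \<open>Interior points and the volume of the polar dual\<close>

lemma interior_slack_pos:
  assumes "y \<in> interior (deformed_polytope U z)"
  shows "U $ i \<bullet> y + z $ i > 0"
proof -
  obtain e where e: "e > 0" "ball y e \<subseteq> deformed_polytope U z" using assms unfolding mem_interior by blast
  define t where "t = e / 2 / norm (U $ i)"
  have t: "t > 0" using e(1) nonzero[of i] by (simp add: t_def)
  have "y - t *\<^sub>R U $ i \<in> ball y e" using e(1) nonzero[of i] by (simp add: dist_norm t_def)
  then have "U $ i \<bullet> (y - t *\<^sub>R U $ i) + z $ i \<ge> 0" using e(2) unfolding mem_deformed_polytope[symmetric]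
    by (metis mem_deformed_polytope subsetD)
  then have "U $ i \<bullet> y + z $ i \<ge> t * (U $ i \<bullet> U $ i)" by (simp add: inner_diff_right)
  moreover have "t * (U $ i \<bullet> U $ i) > 0" using t nonzero[of i] by simp
  ultimately show ?thesis by linarith
qed

lemma interior_nonempty:
  assumes z: "strict z" shows "interior (deformed_polytope U z) \<noteq> {}"
proof -
  obtain I where I: "I \<in> V" using V_nonempty by blast
  let ?S = "{y. \<forall>i. U $ i \<bullet> y + z $ i > 0}"
  have "\<exists>y. y \<in> ?S"
  proof -
    \<comment> \<open>A step along the sum of the dual vectors raises every slack of
      \<open>I\<close> from 0 at unit rate, while the other slacks are positive to begin
      with.\<close>
    define w where "w = (\<Sum>k\<in>I. q I k)"
    have Uw: "U $ i \<bullet> w = 1" if "i \<in> I" for i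
    proof -
      have "U $ i \<bullet> w = (\<Sum>k\<in>I. if k = i then 1 else 0)"
        unfolding w_def inner_sum_right by (intro sum.cong refl) (use dual[OF I that] in auto)
      then show ?thesis using that by simp
    qed
    have "\<forall>\<^sub>F e in at_right (0::real). 0 < U $ i \<bullet> (vert I z + e *\<^sub>R w) + z $ i" for i
    proof (cases "i \<in> I")
      case True
      have "U $ i \<bullet> (vert I z + e *\<^sub>R w) + z $ i = e" for e
        using Uw[OF True] inner_vert[OF I True] by (simp add: inner_add_right)
      then show ?thesis by (simp add: eventually_at_right_less)
    next
      case False
      then have pos: "0 < U $ i \<bullet> vert I z + z $ i" using z I by (simp add: strict_def)
      have "((\<lambda>e. U $ i \<bullet> (vert I z + e *\<^sub>R w) + z $ i) \<longlongrightarrow> U $ i \<bullet> (vert I z + 0 *\<^sub>R w) + z $ i) (at_right 0)"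
        by (intro tendsto_intros)
      then show ?thesis by (rule order_tendstoD) (use pos in simp)
    qed
    then have "\<forall>\<^sub>F e in at_right (0::real). vert I z + e *\<^sub>R w \<in> ?S" by (simp add: eventually_all_finite)
    then have "\<exists>e. vert I z + e *\<^sub>R w \<in> ?S" by (rule eventually_happens'[rotated]) simp
    then show ?thesis by blast
  qed
  moreover have "open ?S"
  proof -
    have "?S = (\<Inter>i. {y. U $ i \<bullet> y + z $ i > 0})" by auto
    also have "open \<dots>" by (intro open_INT finite ballI open_Collect_less continuous_intros)
    finally show ?thesis .
  qed
  then have "?S \<subseteq> interior (deformed_polytope U z)"
    by (intro interior_maximal) (auto simp: mem_deformed_polytope less_imp_le)
  ultimately show ?thesis by blast
qed

text \<open>For \<open>u\<close> in the cone of \<open>I\<close> the minimum over the polytope is at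
  \<open>vert I z\<close>, so membership in the dual is the single inequality that the sum of the
  \<open>c i * l i\<close> is at most 1, with \<open>l\<close> the slacks of \<open>y\<close>. Each
  piece is therefore the simplex with vertices 0 and \<open>U $ i\<close> divided by
  \<open>l i\<close>.\<close>

lemma norm_vol_polar_dual:
  assumes z: "strict z" and y: "y \<in> interior (deformed_polytope U z)"
  shows "norm_vol (polar_dual ((\<lambda>w. w - y) ` deformed_polytope U z)) =
    (\<Sum>I\<in>V. abs_det_sub U (gen_cone U I) * (\<Prod>i\<in>- I. U $ i \<bullet> y + z $ i)) / (\<Prod>i\<in>UNIV. U $ i \<bullet> y + z $ i)"
proof -
  let ?P = "deformed_polytope U z"
  define l where "l i = U $ i \<bullet> y + z $ i" for i
  have l: "l i > 0" for i unfolding l_def by (rule interior_slack_pos[OF y])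
  define T where "T I = {\<Sum>i\<in>I. c i *\<^sub>R U $ i | c. (\<forall>i\<in>I. c i \<ge> 0) \<and> (\<Sum>i\<in>I. c i * l i) \<le> 1}" for I
  have Tcone: "T I \<subseteq> gen_cone U I" for I by (auto simp: T_def intro!: gen_coneI)
  have polar: "polar_dual ((\<lambda>w. w - y) ` ?P) = (\<Union>I\<in>V. T I)"
  proof -
    have iff: "u \<in> polar_dual ((\<lambda>w. w - y) ` ?P) \<longleftrightarrow> (\<Sum>i\<in>I. c i * l i) \<le> 1"
      if I: "I \<in> V" and c: "\<And>i. i \<in> I \<Longrightarrow> c i \<ge> 0" "u = (\<Sum>i\<in>I. c i *\<^sub>R U $ i)" for u I c
    proof -
      have v: "vert I z \<in> ?P" by (rule vert_mem[OF strict_imp_weak[OF z] I])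
      have uv: "u \<bullet> (vert I z - y) = - (\<Sum>i\<in>I. c i * l i)"
        unfolding c(2) inner_sum_left sum_negf[symmetric]
        by (intro sum.cong refl) (simp add: inner_diff_right inner_vert[OF I] l_def algebra_simps)
      have "u \<in> polar_dual ((\<lambda>w. w - y) ` ?P) \<longleftrightarrow> (\<forall>x\<in>?P. - 1 \<le> u \<bullet> (x - y))"
        by (simp add: polar_dual_def)
      also have "\<dots> \<longleftrightarrow> - 1 \<le> u \<bullet> (vert I z - y)"
      proof
        assume le: "- 1 \<le> u \<bullet> (vert I z - y)"
        show "\<forall>x\<in>?P. - 1 \<le> u \<bullet> (x - y)"
        proof
          fix x assume x: "x \<in> ?P"
          have "u \<bullet> vert I z \<le> u \<bullet> x" by (rule vert_minimal(1)[OF I c(2) _ x]) (rule c(1))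
          then show "- 1 \<le> u \<bullet> (x - y)" using le by (simp add: inner_diff_right)
        qed
      qed (use v in blast)
      finally show ?thesis unfolding uv by simp
    qed
    show ?thesis
    proof (rule equalityI; rule subsetI)
      fix u assume u: "u \<in> polar_dual ((\<lambda>w. w - y) ` ?P)"
      obtain I where I: "I \<in> V" "u \<in> gen_cone U I" using cover by blast
      obtain c where c: "\<And>i. i \<in> I \<Longrightarrow> c i \<ge> 0" "u = (\<Sum>i\<in>I. c i *\<^sub>R U $ i)" using I(2) by (rule gen_coneE) blast
      have "(\<Sum>i\<in>I. c i * l i) \<le> 1" using iff[of I c u, OF I(1) c] u by simp
      then have "u \<in> T I" unfolding T_def using c by blast
      then show "u \<in> (\<Union>I\<in>V. T I)" using I(1) by blast
    next
      fix u assume "u \<in> (\<Union>I\<in>V. T I)"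
      then obtain I c where I: "I \<in> V" and c: "\<forall>i\<in>I. c i \<ge> 0" "(\<Sum>i\<in>I. c i * l i) \<le> 1" "u = (\<Sum>i\<in>I. c i *\<^sub>R U $ i)"
        unfolding T_def by blast
      then show "u \<in> polar_dual ((\<lambda>w. w - y) ` ?P)" using iff[of I c u, OF I _ c(3)] by blast
    qed
  qed
  have TI: "T I \<in> lmeasurable \<and> measure lebesgue (T I) = abs_det_sub U (gen_cone U I) / (\<Prod>i\<in>I. l i) / fact CARD('d)"
    if I: "I \<in> V" for I
  proof -
    define e where "e = (SOME e :: 'd \<Rightarrow> 'n. bij_betw e UNIV (rays_of U (gen_cone U I)))"
    have "\<exists>e :: 'd \<Rightarrow> 'n. bij_betw e UNIV I"
      by (rule finite_same_card_bij) (use card_V[OF I] in auto)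
    then have e: "bij_betw e UNIV I"
      unfolding e_def rays_of_gen_cone[OF z I] by (rule someI_ex)
    define B where "B = ((\<chi> j. (1 / l (e j)) *s U $ e j) :: real ^ 'd ^ 'd)"
    have sum_e: "(\<Sum>i\<in>I. g i) = (\<Sum>j\<in>UNIV. g (e j))" for g :: "'n \<Rightarrow> 'b::comm_monoid_add"
      by (rule sum.reindex_bij_betw[OF e, symmetric])
    have eq: "T I = {\<Sum>j\<in>UNIV. c j *\<^sub>R B $ j | c. (\<forall>j. c j \<ge> 0) \<and> sum c UNIV \<le> 1}"
    proof (rule equalityI; rule subsetI)
      fix u assume "u \<in> T I"
      then obtain c where c: "\<forall>i\<in>I. c i \<ge> 0" "(\<Sum>i\<in>I. c i * l i) \<le> 1" "u = (\<Sum>i\<in>I. c i *\<^sub>R U $ i)"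
        unfolding T_def by blast
      have eI: "e j \<in> I" for j using e by (auto simp: bij_betw_def)
      have "u = (\<Sum>j\<in>UNIV. (c (e j) * l (e j)) *\<^sub>R B $ j)"
        unfolding c(3) sum_e using l by (intro sum.cong refl) (simp add: B_def scalar_mult_eq_scaleR less_imp_neq[symmetric])
      moreover have "\<forall>j. c (e j) * l (e j) \<ge> 0" using c(1) eI l by (simp add: less_imp_le)
      moreover have "(\<Sum>j\<in>UNIV. c (e j) * l (e j)) \<le> 1" using c(2) unfolding sum_e .
      ultimately show "u \<in> {\<Sum>j\<in>UNIV. c j *\<^sub>R B $ j | c. (\<forall>j. c j \<ge> 0) \<and> sum c UNIV \<le> 1}"
        by (intro CollectI exI[of _ "\<lambda>j. c (e j) * l (e j)"]) simp
    next
      fix u assume "u \<in> {\<Sum>j\<in>UNIV. c j *\<^sub>R B $ j | c. (\<forall>j. c j \<ge> 0) \<and> sum c UNIV \<le> 1}"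
      then obtain c where c: "\<forall>j. c j \<ge> 0" "sum c UNIV \<le> 1" "u = (\<Sum>j\<in>UNIV. c j *\<^sub>R B $ j)" by blast
      define d where "d i = c (inv_into UNIV e i) / l i" for i
      have de: "d (e j) = c j / l (e j)" for j
        using e by (simp add: d_def bij_betw_def)
      have "u = (\<Sum>i\<in>I. d i *\<^sub>R U $ i)"
        unfolding c(3) sum_e by (intro sum.cong refl) (simp add: B_def scalar_mult_eq_scaleR de)
      moreover have "\<forall>i\<in>I. d i \<ge> 0" using c(1) l by (simp add: d_def less_imp_le)
      moreover have "(\<Sum>i\<in>I. d i * l i) \<le> 1"
        unfolding sum_e using c(2) l by (simp add: de less_imp_neq[symmetric])
      ultimately show "u \<in> T I" unfolding T_def by blast
    qed
    have "det B = (\<Prod>j\<in>UNIV. 1 / l (e j)) * det ((\<chi> j. U $ e j) :: real ^ 'd ^ 'd)"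
      unfolding B_def by (rule det_rows_mul)
    also have "(\<Prod>j\<in>UNIV. 1 / l (e j)) = 1 / (\<Prod>i\<in>I. l i)"
      using prod.reindex_bij_betw[OF e, of l] by (simp add: prod_dividef)
    finally have "\<bar>det B\<bar> = abs_det_sub U (gen_cone U I) / (\<Prod>i\<in>I. l i)"
      using l by (simp add: abs_mult abs_det_sub_def e_def[symmetric] prod_pos less_imp_le abs_prod)
    then show ?thesis unfolding eq measure_simplex_cone(2)
      using lmeasurable_compact[OF measure_simplex_cone(1)[of B]] by simp
  qed
  have "measure lebesgue (\<Union>(T ` V)) = (\<Sum>I\<in>V. measure lebesgue (T I))"
  proof (rule measure_negligible_finite_Union_image)
    show "pairwise (\<lambda>I J. negligible (T I \<inter> T J)) V"
    proof (rule pairwiseI)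
      \<comment> \<open>A common point of two pieces takes the same minimal value at both vertices,
        so it lies in the hyperplane orthogonal to their difference.\<close>
      fix I J assume IJ: "I \<in> V" "J \<in> V" "I \<noteq> J"
      have "T I \<inter> T J \<subseteq> {u. (vert I z - vert J z) \<bullet> u = 0}"
      proof
        fix u assume "u \<in> T I \<inter> T J"
        then have "u \<in> gen_cone U I" "u \<in> gen_cone U J" using Tcone by auto
        then have "u \<bullet> vert I z = u \<bullet> vert J z"
          using gen_cone_vert_minimal[OF IJ(1), of u "vert J z" z] gen_cone_vert_minimal[OF IJ(2), of u "vert I z" z]
            vert_mem[OF strict_imp_weak[OF z]] IJ by (intro antisym) auto
        then show "u \<in> {u. (vert I z - vert J z) \<bullet> u = 0}"
          by (simp add: inner_commute[of _ u] inner_diff_right)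
      qed
      moreover have "vert I z - vert J z \<noteq> 0" using vert_inj[OF z IJ(1,2)] IJ(3) by auto
      ultimately show "negligible (T I \<inter> T J)" using negligible_hyperplane negligible_subset by blast
    qed
  qed (use TI in auto)
  also have "\<dots> = (\<Sum>I\<in>V. abs_det_sub U (gen_cone U I) / (\<Prod>i\<in>I. l i) / fact CARD('d))"
    using TI by (intro sum.cong) auto
  finally have "norm_vol (polar_dual ((\<lambda>w. w - y) ` ?P)) = (\<Sum>I\<in>V. abs_det_sub U (gen_cone U I) / (\<Prod>i\<in>I. l i))"
    by (simp add: norm_vol_def polar sum_distrib_left)
  also have "\<dots> = (\<Sum>I\<in>V. abs_det_sub U (gen_cone U I) * (\<Prod>i\<in>- I. l i) / (\<Prod>i\<in>UNIV. l i))"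
  proof (rule sum.cong[OF refl])
    fix I
    have "(\<Prod>i\<in>UNIV. l i) = (\<Prod>i\<in>I. l i) * (\<Prod>i\<in>- I. l i)"
      by (subst prod.union_disjoint[symmetric]) (auto simp: Compl_partition)
    moreover have "(\<Prod>i\<in>- I. l i) \<noteq> 0" "(\<Prod>i\<in>I. l i) \<noteq> 0" using l by (auto simp: less_imp_neq[symmetric])
    ultimately show "abs_det_sub U (gen_cone U I) / (\<Prod>i\<in>I. l i) =
        abs_det_sub U (gen_cone U I) * (\<Prod>i\<in>- I. l i) / (\<Prod>i\<in>UNIV. l i)" by simp
  qed
  finally show ?thesis by (simp add: l_def sum_divide_distrib)
qed

end

section \<open>The normal fan of a simple polytope\<close>

lemma cone_hull_singleton_iff: "x \<in> cone hull {w} \<longleftrightarrow> (\<exists>c\<ge>0. x = c *\<^sub>R w)"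
  unfolding cone_hull_expl by auto

lemma mem_cone_hull_singleton: "w \<in> cone hull {w}"
  unfolding cone_hull_singleton_iff by (rule exI[of _ 1]) simp

lemma aff_dim_cone_hull_singleton:
  fixes w :: "'a::euclidean_space"
  assumes "w \<noteq> 0" shows "aff_dim (cone hull {w}) = 1"
proof -
  have "0 \<in> cone hull {w}" unfolding cone_hull_singleton_iff by (rule exI[of _ 0]) simp
  then have "aff_dim (cone hull {w}) = int (dim (cone hull {w}))" by (intro aff_dim_zero) (rule hull_inc)
  moreover have "dim {w} \<le> dim (cone hull {w})"
    by (rule dim_subset) (simp add: mem_cone_hull_singleton)
  moreover have "dim (cone hull {w}) \<le> dim (span {w})"
    by (rule dim_subset) (auto simp: cone_hull_singleton_iff span_base span_scale)
  ultimately show ?thesis using assms by (simp add: dim_singleton)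
qed

text \<open>In full dimension the affine hull of a facet is the entire hyperplane. A functional
  constant on it is a multiple of \<open>w\<close>, and a point of \<open>P\<close> off the facet
  fixes the sign.\<close>

lemma normal_cone_facet:
  fixes P :: "'a::euclidean_space set"
  assumes P: "aff_dim P = DIM('a)" and F: "F facet_of P" "F = P \<inter> {x. w \<bullet> x = b}"
    and w: "w \<noteq> 0" "\<And>x. x \<in> P \<Longrightarrow> w \<bullet> x \<ge> b"
  shows "normal_cone P F = cone hull {w}"
proof (rule equalityI; rule subsetI)
  fix u assume u: "u \<in> normal_cone P F"
  have "F \<noteq> {}" "aff_dim F = DIM('a) - 1" using F(1) P by (auto simp: facet_of_def)
  then obtain f where f: "f \<in> F" by blast
  have "affine hull F = affine hull {x. w \<bullet> x = b}"
    using aff_dim_eq_full_gen[of F "{x. w \<bullet> x = b}"] F(2) \<open>aff_dim F = _\<close> aff_dim_hyperplane[OF w(1), of b] by auto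
  then have hull: "affine hull F = {x. w \<bullet> x = b}" by (simp add: affine_hull_eq affine_hyperplane)
  have "F \<subseteq> {x. u \<bullet> x = u \<bullet> f}"
  proof
    fix x assume "x \<in> F"
    then have "u \<bullet> x \<le> u \<bullet> f" "u \<bullet> f \<le> u \<bullet> x" using u f F(2) unfolding normal_cone_def by blast+
    then show "x \<in> {x. u \<bullet> x = u \<bullet> f}" by simp
  qed
  then have "affine hull F \<subseteq> {x. u \<bullet> x = u \<bullet> f}" by (rule hull_minimal) (rule affine_hyperplane)
  then have const: "u \<bullet> x = u \<bullet> f" if "w \<bullet> x = b" for x using hull that by blast
  have perp: "u \<bullet> v = 0" if "w \<bullet> v = 0" for v
    using const[of "f + v"] that f F(2) by (simp add: inner_add_right)
  define c where "c = (u \<bullet> w) / (w \<bullet> w)"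
  define v where "v = u - c *\<^sub>R w"
  have wv: "w \<bullet> v = 0" using w(1) by (simp add: v_def c_def inner_diff_right inner_commute)
  then have "v \<bullet> v = 0" using perp[OF wv] by (subst v_def) (simp add: inner_diff_left)
  then have uc: "u = c *\<^sub>R w" by (simp add: v_def)
  have "F \<noteq> P" using F(1) facet_of_irrefl by blast
  then obtain x where x: "x \<in> P" "x \<notin> F" using F(2) by blast
  then have "w \<bullet> x > b" using w(2)[of x] F(2) by force
  moreover have "u \<bullet> f \<le> u \<bullet> x" using u f x(1) unfolding normal_cone_def by blast
  then have "0 \<le> c * (w \<bullet> x - b)" using f F(2) by (simp add: uc algebra_simps)
  ultimately have "c \<ge> 0" by (simp add: zero_le_mult_iff)
  then show "u \<in> cone hull {w}" using uc cone_hull_singleton_iff by blast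
next
  fix u assume "u \<in> cone hull {w}"
  then obtain c where c: "c \<ge> 0" "u = c *\<^sub>R w" unfolding cone_hull_singleton_iff by blast
  show "u \<in> normal_cone P F" unfolding normal_cone_def
  proof (intro CollectI ballI)
    fix x y assume "x \<in> F" "y \<in> P"
    then have "w \<bullet> x \<le> w \<bullet> y" using F(2) w(2)[of y] by auto
    then show "u \<bullet> x \<le> u \<bullet> y" using c by (simp add: mult_left_mono)
  qed
qed

lemma facet_normal:
  fixes P :: "'a::euclidean_space set"
  assumes "polyhedron P" "aff_dim P = DIM('a)" "F facet_of P"
  obtains w b where "w \<noteq> 0" "\<And>x. x \<in> P \<Longrightarrow> w \<bullet> x \<ge> b" "F = P \<inter> {x. w \<bullet> x = b}" "normal_cone P F = cone hull {w}"
proof -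
  obtain a b where ab: "a \<noteq> 0" "P \<subseteq> {x. a \<bullet> x \<le> b}" "F = P \<inter> {x. a \<bullet> x = b}"
    using facet_of_polyhedron[OF assms(1,3)] .
  have 1: "- a \<noteq> 0" "\<And>x. x \<in> P \<Longrightarrow> - a \<bullet> x \<ge> - b" "F = P \<inter> {x. - a \<bullet> x = - b}" using ab by auto
  show thesis by (rule that[OF 1 normal_cone_facet[OF assms(2,3) 1(3,1,2)]])
qed

lemma normal_cone_antimono: "F \<subseteq> G \<Longrightarrow> normal_cone P G \<subseteq> normal_cone P F"
  unfolding normal_cone_def by blast

text \<open>The face \<open>G\<close> with this normal cone is not \<open>P\<close>, on which no
  nonzero functional is constant, so it lies in a facet. Normal cones reverse inclusion, hence the
  normal of that facet lies on the ray of \<open>U $ i\<close>.\<close>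

lemma ray_matrix_facet:
  fixes P :: "(real ^ 'd::finite) set" and U :: "real ^ 'd ^ 'n::finite"
  assumes P: "polyhedron P" "aff_dim P = int CARD('d)" and U: "ray_matrix (normal_fan P) U"
  shows "\<exists>b. P \<inter> {x. U $ i \<bullet> x = b} facet_of P \<and> (\<forall>x\<in>P. U $ i \<bullet> x \<ge> b)"
proof -
  have P': "aff_dim P = DIM(real ^ 'd)" using P(2) by simp
  have Ui: "U $ i \<noteq> 0" and "ray U i \<in> cones_of_dim (normal_fan P) 1"
    using U by (auto simp: ray_matrix_def bij_betw_def)
  then obtain G where G: "ray U i = normal_cone P G" "G face_of P" "G \<noteq> {}"
    by (auto simp: cones_of_dim_def normal_fan_def)
  have UG: "U $ i \<in> normal_cone P G" unfolding G(1)[symmetric] ray_def by (rule mem_cone_hull_singleton)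
  have "G \<noteq> P"
  proof
    assume "G = P"
    then obtain p where p: "p \<in> P" using G(3) by blast
    have "P \<subseteq> {x. U $ i \<bullet> x = U $ i \<bullet> p}"
    proof
      fix x assume "x \<in> P"
      then have "U $ i \<bullet> x \<le> U $ i \<bullet> p" "U $ i \<bullet> p \<le> U $ i \<bullet> x"
        using UG p \<open>G = P\<close> unfolding normal_cone_def by blast+
      then show "x \<in> {x. U $ i \<bullet> x = U $ i \<bullet> p}" by simp
    qed
    then have "aff_dim P \<le> aff_dim {x. U $ i \<bullet> x = U $ i \<bullet> p}" by (rule aff_dim_subset)
    then show False using P' aff_dim_hyperplane[OF Ui] by simp
  qed
  then obtain f where f: "f facet_of P" "G \<subseteq> f"
    using face_of_polyhedron_subset_facet[OF P(1) G(2,3)] by blast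
  obtain w b where w: "w \<noteq> 0" "\<And>x. x \<in> P \<Longrightarrow> w \<bullet> x \<ge> b" "f = P \<inter> {x. w \<bullet> x = b}" "normal_cone P f = cone hull {w}"
    by (rule facet_normal[OF P(1) P' f(1)]) (rule that; blast)
  have "w \<in> cone hull {U $ i}"
    using normal_cone_antimono[OF f(2), of P] G(1) w(4) mem_cone_hull_singleton[of w] by (auto simp: ray_def)
  then obtain c where c: "c \<ge> 0" "w = c *\<^sub>R U $ i" unfolding cone_hull_singleton_iff by blast
  have "c > 0" using c w(1) by (cases "c = 0") auto
  have "f = P \<inter> {x. U $ i \<bullet> x = b / c}" unfolding w(3) c(2) using \<open>c > 0\<close> by (auto simp: field_simps)
  moreover have "U $ i \<bullet> x \<ge> b / c" if "x \<in> P" for x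
    using w(2)[OF that] \<open>c > 0\<close> by (simp add: c(2) field_simps)
  ultimately show ?thesis using f(1) by (intro exI[of _ "b / c"]) simp
qed

text \<open>The dual vectors are the columns of the inverse of the matrix with rows
  \<open>U $ i\<close>.\<close>

lemma dual_basis_exists:
  fixes U :: "real ^ 'd::finite ^ 'n::finite"
  assumes I: "card I = CARD('d)" and dim: "dim (($) U ` I) = CARD('d)"
  shows "\<exists>q. (\<forall>i\<in>I. \<forall>k\<in>I. U $ i \<bullet> q k = (if i = k then 1 else 0)) \<and>
    (\<forall>u. u = (\<Sum>i\<in>I. (u \<bullet> q i) *\<^sub>R U $ i))"
proof -
  obtain e :: "'d \<Rightarrow> 'n" where e: "bij_betw e UNIV I" using finite_same_card_bij[of "UNIV :: 'd set" I] I by auto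
  define M where "M = (\<chi> j. U $ e j)"
  have "rows M = ($) U ` I"
    using e by (auto simp: rows_def row_def M_def bij_betw_def vec_lambda_eta)
  then have "span (rows M) = UNIV" using dim dim_eq_full[of "rows M"] by simp
  then obtain M' where M': "M' ** M = mat 1" using matrix_left_invertible_span_rows[of M] by blast
  then have M'': "M ** M' = mat 1" using matrix_left_right_inverse by blast
  define q where "q k = column (inv_into UNIV e k) M'" for k
  have q: "q (e j) = column j M'" for j using e by (simp add: q_def bij_betw_def)
  have sum_e: "(\<Sum>i\<in>I. g i) = (\<Sum>j\<in>UNIV. g (e j))" for g :: "'n \<Rightarrow> real ^ 'd"
    by (rule sum.reindex_bij_betw[OF e, symmetric])
  have "U $ e i \<bullet> q (e k) = (M ** M') $ i $ k" for i k
    by (simp add: q M_def column_def inner_vec_def matrix_matrix_mult_def)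
  then have "U $ e i \<bullet> q (e k) = (if e i = e k then 1 else 0)" for i k
    using e by (auto simp: M'' mat_def bij_betw_def inj_on_def)
  then have "\<forall>i\<in>I. \<forall>k\<in>I. U $ i \<bullet> q k = (if i = k then 1 else 0)"
    using e by (auto simp: bij_betw_def)
  moreover have "u = (\<Sum>i\<in>I. (u \<bullet> q i) *\<^sub>R U $ i)" for u
  proof -
    have "(\<Sum>i\<in>I. (u \<bullet> q i) *\<^sub>R U $ i) $ l = u $ l" for l
    proof -
      have "(\<Sum>i\<in>I. (u \<bullet> q i) *\<^sub>R U $ i) $ l = (\<Sum>j\<in>UNIV. \<Sum>m\<in>UNIV. u $ m * (M' $ m $ j * M $ j $ l))"
        unfolding sum_e by (simp add: q column_def inner_vec_def M_def sum_distrib_right mult.assoc)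
      also have "\<dots> = (\<Sum>m\<in>UNIV. u $ m * (M' ** M) $ m $ l)"
        by (subst sum.swap) (simp add: matrix_matrix_mult_def sum_distrib_left)
      also have "\<dots> = u $ l" by (simp add: M' mat_def if_distrib[of "\<lambda>a. _ * a"] cong: if_cong)
      finally show ?thesis .
    qed
    then show ?thesis by (simp add: vec_eq_iff)
  qed
  ultimately show ?thesis by blast
qed

text \<open>\<open>V\<close> consists of the sets of facets through the vertices. Simplicity gives
  each of them d elements, and extremality makes their normals span. Any \<open>u\<close> attains
  its minimum at a vertex, where short steps along the dual vectors show that its coefficients are
  nonnegative, so the cones cover the space.\<close>

lemma simple_polytope_simplicial_fan:
  fixes P :: "(real ^ 'd::finite) set" and U :: "real ^ 'd ^ 'n::finite"
  assumes simple: "simple_polytope P" and dim: "aff_dim P = int CARD('d)"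
    and ray: "ray_matrix (normal_fan P) U"
  shows "\<exists>V q z0. simplicial_fan U V q \<and> simplicial_fan.strict U V q z0 \<and> P = deformed_polytope U z0"
proof -
  have poly: "polytope P" using simple by (simp add: simple_polytope_def)
  have polyh: "polyhedron P" by (rule polytope_imp_polyhedron[OF poly])
  have dim': "aff_dim P = DIM(real ^ 'd)" using dim by simp
  have compact: "compact P" by (rule polytope_imp_compact[OF poly])
  have convex: "convex P" by (rule polytope_imp_convex[OF poly])
  have "P \<noteq> {}" using dim by auto
  have nonzero: "U $ i \<noteq> 0" for i using ray by (simp add: ray_matrix_def)
  have "\<forall>i. \<exists>b. P \<inter> {x. U $ i \<bullet> x = b} facet_of P \<and> (\<forall>x\<in>P. U $ i \<bullet> x \<ge> b)"
    by (intro allI ray_matrix_facet[OF polyh dim ray])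
  from choice[OF this] obtain b where "\<forall>i. P \<inter> {x. U $ i \<bullet> x = b i} facet_of P \<and> (\<forall>x\<in>P. U $ i \<bullet> x \<ge> b i)" ..
  then have b: "P \<inter> {x. U $ i \<bullet> x = b i} facet_of P" "x \<in> P \<Longrightarrow> U $ i \<bullet> x \<ge> b i" for i x
    by simp_all
  define f where "f i = P \<inter> {x. U $ i \<bullet> x = b i}" for i
  have f: "f i facet_of P" for i using b(1) by (simp add: f_def)
  have ncf: "normal_cone P (f i) = ray U i" for i
    unfolding ray_def by (rule normal_cone_facet[OF dim' f f_def nonzero b(2)])
  have "inj (ray U)" using ray by (simp add: ray_matrix_def bij_betw_def)
  then have inj_f: "inj f" by (intro injI) (metis injD ncf)
  have surj_f: "\<exists>i. F = f i" if F: "F facet_of P" for F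
  proof -
    obtain w c where w: "w \<noteq> 0" "\<And>x. x \<in> P \<Longrightarrow> w \<bullet> x \<ge> c" "F = P \<inter> {x. w \<bullet> x = c}" "normal_cone P F = cone hull {w}"
      by (rule facet_normal[OF polyh dim' F]) (rule that; blast)
    have "cone hull {w} \<in> cones_of_dim (normal_fan P) 1"
      using F w(4) aff_dim_cone_hull_singleton[OF w(1)]
      unfolding cones_of_dim_def normal_fan_def facet_of_def by auto
    moreover have "range (ray U) = cones_of_dim (normal_fan P) 1"
      using ray by (simp add: ray_matrix_def bij_betw_def)
    ultimately obtain i where i: "cone hull {w} = ray U i" by (metis imageE)
    then have "U $ i \<in> cone hull {w}" by (simp add: mem_cone_hull_singleton ray_def)
    then obtain t where t: "t \<ge> 0" "U $ i = t *\<^sub>R w" unfolding cone_hull_singleton_iff by blast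
    have "t > 0" using t nonzero[of i] by (cases "t = 0") auto
    obtain x where x: "x \<in> F" using F by (auto simp: facet_of_def)
    obtain y where y: "y \<in> f i" using f by (force simp: facet_of_def)
    have "t * c \<ge> b i" using b(2)[of x i] x w(3) by (simp add: t(2))
    moreover have "b i \<ge> t * c" using mult_left_mono[OF w(2)[of y], of t] y t(1) by (auto simp: f_def t(2))
    ultimately have "b i = t * c" by simp
    then have "F = f i" unfolding w(3) f_def using \<open>t > 0\<close> by (auto simp: t(2))
    then show ?thesis by blast
  qed
  define z0 where "z0 = (\<chi> i. - b i)"
  have P_sub: "P \<subseteq> deformed_polytope U z0" using b(2) by (auto simp: mem_deformed_polytope z0_def)
  \<comment> \<open>A segment from a relatively interior point of \<open>P\<close> to a point
    outside crosses the frontier in some facet. There the constraint would be strictly positive, as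
    an average with positive weight on the interior point.\<close>
  have P_eq: "P = deformed_polytope U z0"
  proof (rule equalityI[OF P_sub], rule subsetI, rule ccontr)
    fix x assume x: "x \<in> deformed_polytope U z0" "x \<notin> P"
    have hull: "affine hull P = UNIV" using dim' aff_dim_eq_full by blast
    obtain p where p: "p \<in> rel_interior P" using rel_interior_eq_empty[OF convex] \<open>P \<noteq> {}\<close> by blast
    have pP: "p \<in> P" using p rel_interior_subset by blast
    have "closed_segment p x \<inter> frontier P \<noteq> {}"
      by (rule connected_Int_frontier) (use pP x(2) in auto)
    then obtain y where y: "y \<in> closed_segment p x" "y \<in> frontier P" by blast
    have "frontier P = \<Union>{F. F facet_of P}"
      using rel_frontier_of_polyhedron[OF polyh] rel_frontier_frontier[OF hull] by simp
    then obtain F where F: "F facet_of P" "y \<in> F" using y(2) by auto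
    then obtain i where i: "y \<in> f i" using surj_f by blast
    have "f i \<inter> rel_interior P = {}"
      using face_of_disjoint_rel_interior[OF facet_of_imp_face_of[OF f]] f facet_of_irrefl by metis
    then have "U $ i \<bullet> p \<noteq> b i" using p pP by (auto simp: f_def)
    then have pi: "U $ i \<bullet> p > b i" using b(2)[OF pP, of i] by simp
    obtain t where t: "0 \<le> t" "t \<le> 1" "y = (1 - t) *\<^sub>R p + t *\<^sub>R x" using y(1) by (auto simp: in_segment)
    have yi: "U $ i \<bullet> y = b i" "y \<in> P" using i by (auto simp: f_def)
    have xi: "U $ i \<bullet> x \<ge> b i" using x(1) by (auto simp: mem_deformed_polytope z0_def)
    have "t \<noteq> 1" using t(3) yi(2) x(2) by auto
    then have "(1 - t) * (U $ i \<bullet> p) > (1 - t) * b i" using t(2) pi by simp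
    moreover have "t * (U $ i \<bullet> x) \<ge> t * b i" using t(1) xi by (rule mult_left_mono[rotated])
    ultimately have "U $ i \<bullet> y > b i" unfolding t(3) by (simp add: inner_add_right algebra_simps)
    then show False using yi(1) by simp
  qed
  define Iv where "Iv v = {i. v \<in> f i}" for v
  define V where "V = {Iv v | v. v extreme_point_of P}"
  have Iv_iff: "i \<in> Iv v \<longleftrightarrow> U $ i \<bullet> v + z0 $ i = 0" if "v \<in> P" for i v
    using that by (auto simp: Iv_def f_def z0_def)
  have ext_mem: "v \<in> P" if "v extreme_point_of P" for v using that by (simp add: extreme_point_of_def)
  have cardI: "card (Iv v) = CARD('d)" if v: "v extreme_point_of P" for v
  proof -
    have "{F. F facet_of P \<and> v \<in> F} = f ` Iv v" using surj_f f by (auto simp: Iv_def)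
    then have "card {F. F facet_of P \<and> v \<in> F} = card (Iv v)"
      by (simp add: card_image inj_on_subset[OF inj_f])
    then show ?thesis using simple v dim by (simp add: simple_polytope_def)
  qed
  \<comment> \<open>A direction \<open>w\<close> orthogonal to all active normals could be followed
    both ways from \<open>v\<close>, so \<open>v\<close> would not be extreme.\<close>
  have span: "dim (($) U ` Iv v) = CARD('d)" if v: "v extreme_point_of P" for v
  proof (rule ccontr)
    assume "dim (($) U ` Iv v) \<noteq> CARD('d)"
    then have "dim (($) U ` Iv v) < DIM(real ^ 'd)" using dim_subset_UNIV[of "($) U ` Iv v"] by simp
    then obtain w where w: "w \<noteq> 0" "\<And>y. y \<in> span (($) U ` Iv v) \<Longrightarrow> orthogonal w y"
      by (rule orthogonal_to_subspace_exists) (rule that; blast)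
    have vP: "v \<in> deformed_polytope U z0" using ext_mem[OF v] P_eq by simp
    have Uw: "U $ i \<bullet> w = 0" if "U $ i \<bullet> v + z0 $ i = 0" for i
      using w(2)[of "U $ i"] that Iv_iff[OF ext_mem[OF v]] by (auto simp: orthogonal_def inner_commute span_base)
    obtain e1 where e1: "e1 > 0" "v + e1 *\<^sub>R w \<in> P" using feasible_step[OF vP, of w] Uw P_eq by auto
    obtain e2 where e2: "e2 > 0" "v + e2 *\<^sub>R (- w) \<in> P" using feasible_step[OF vP, of "- w"] Uw P_eq by auto
    \<comment> \<open>The weight for which the steps \<open>e1\<close> and \<open>- e2\<close>
      average to zero.\<close>
    define t where "t = e1 / (e1 + e2)"
    have t: "0 < t" "t < 1" "(1 - t) * e1 = t * e2" using e1(1) e2(1) by (auto simp: t_def field_simps)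
    have "(1 - t) *\<^sub>R (v + e1 *\<^sub>R w) + t *\<^sub>R (v + e2 *\<^sub>R (- w)) = v + ((1 - t) * e1 - t * e2) *\<^sub>R w"
      by (simp add: algebra_simps)
    then have "v = (1 - t) *\<^sub>R (v + e1 *\<^sub>R w) + t *\<^sub>R (v + e2 *\<^sub>R (- w))" using t(3) by simp
    moreover have "v + e1 *\<^sub>R w \<noteq> v + e2 *\<^sub>R (- w)"
    proof
      assume "v + e1 *\<^sub>R w = v + e2 *\<^sub>R (- w)"
      then have "(e1 + e2) *\<^sub>R w = 0" by (simp add: scaleR_left_distrib eq_neg_iff_add_eq_0)
      then show False using w(1) e1(1) e2(1) by simp
    qed
    ultimately have "v \<in> open_segment (v + e1 *\<^sub>R w) (v + e2 *\<^sub>R (- w))"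
      unfolding in_segment(2) using t(1,2) by blast
    then show False using v e1(2) e2(2) unfolding extreme_point_of_def by blast
  qed
  have "\<forall>I. \<exists>q. I \<in> V \<longrightarrow> (\<forall>i\<in>I. \<forall>k\<in>I. U $ i \<bullet> q k = (if i = k then 1 else 0)) \<and>
    (\<forall>u. u = (\<Sum>i\<in>I. (u \<bullet> q i) *\<^sub>R U $ i))"
  proof
    fix I
    show "\<exists>q. I \<in> V \<longrightarrow> (\<forall>i\<in>I. \<forall>k\<in>I. U $ i \<bullet> q k = (if i = k then 1 else 0)) \<and>
      (\<forall>u. u = (\<Sum>i\<in>I. (u \<bullet> q i) *\<^sub>R U $ i))"
    proof (cases "I \<in> V")
      case True
      then obtain v where v: "v extreme_point_of P" "I = Iv v" by (auto simp: V_def)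
      then show ?thesis using dual_basis_exists[OF cardI[OF v(1)] span[OF v(1)]] by simp
    qed simp
  qed
  from choice[OF this] obtain q where
    q0: "\<forall>I. I \<in> V \<longrightarrow> (\<forall>i\<in>I. \<forall>k\<in>I. U $ i \<bullet> q I k = (if i = k then 1 else 0)) \<and>
      (\<forall>u. u = (\<Sum>i\<in>I. (u \<bullet> q I i) *\<^sub>R U $ i))" ..
  have dual: "U $ i \<bullet> q I k = (if i = k then 1 else 0)" if "I \<in> V" "i \<in> I" "k \<in> I" for I i k
    using q0 that by simp
  have expand: "u = (\<Sum>i\<in>I. (u \<bullet> q I i) *\<^sub>R U $ i)" if "I \<in> V" for I u
    using q0 that by simp
  have face_vertex: "\<exists>v. v extreme_point_of P \<and> v \<in> G" if G: "G face_of P" "G \<noteq> {}" for G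
  proof -
    obtain v where "v extreme_point_of G"
      using extreme_point_exists_convex[OF face_of_imp_compact[OF convex compact G(1)] face_of_imp_convex[OF G(1)] G(2)] .
    then show ?thesis using extreme_point_of_face[OF G(1)] by blast
  qed
  have cover: "\<exists>I\<in>V. u \<in> gen_cone U I" for u
  proof -
    have "continuous_on P (\<lambda>x. u \<bullet> x)" by (intro continuous_intros)
    then obtain x where x: "x \<in> P" "\<And>y. y \<in> P \<Longrightarrow> u \<bullet> x \<le> u \<bullet> y"
      using continuous_attains_inf[OF compact \<open>P \<noteq> {}\<close>] by metis
    have "P \<inter> {y. u \<bullet> y = u \<bullet> x} face_of P" by (rule face_of_Int_supporting_hyperplane_ge[OF convex x(2)])
    then obtain v where v: "v extreme_point_of P" "u \<bullet> v = u \<bullet> x" using face_vertex x(1) by blast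
    have I: "Iv v \<in> V" using v(1) by (auto simp: V_def)
    have vP: "v \<in> P" by (rule ext_mem[OF v(1)])
    have "u \<bullet> q (Iv v) k \<ge> 0" if k: "k \<in> Iv v" for k
    proof -
      have "\<exists>e>0. v + e *\<^sub>R q (Iv v) k \<in> deformed_polytope U z0"
        by (rule feasible_step) (use vP P_eq Iv_iff[OF vP] dual[OF I _ k] in auto)
      then obtain e where e: "e > 0" "v + e *\<^sub>R q (Iv v) k \<in> P" using P_eq by auto
      then have "u \<bullet> v \<le> u \<bullet> (v + e *\<^sub>R q (Iv v) k)" using x(2) v(2) by simp
      then show ?thesis using e(1) by (simp add: inner_add_right zero_le_mult_iff)
    qed
    then have "(\<Sum>i\<in>Iv v. (u \<bullet> q (Iv v) i) *\<^sub>R U $ i) \<in> gen_cone U (Iv v)" by (rule gen_coneI)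
    then have "u \<in> gen_cone U (Iv v)" by (simp only: expand[OF I, symmetric])
    then show ?thesis using I by blast
  qed
  interpret F: simplicial_fan U V q
  proof
    show "I \<in> V \<Longrightarrow> card I = CARD('d)" for I using cardI by (auto simp: V_def)
    show "\<exists>I\<in>V. i \<in> I" for i
    proof -
      obtain v where "v extreme_point_of P" "v \<in> f i"
        using face_vertex[of "f i"] f[of i] by (auto simp: facet_of_def)
      then show ?thesis by (intro bexI[of _ "Iv v"]) (auto simp: V_def Iv_def)
    qed
    show "U $ i \<bullet> q I k = (if i = k then 1 else 0)" if "I \<in> V" "i \<in> I" "k \<in> I" for I i k
      by (rule dual[OF that])
    show "u = (\<Sum>i\<in>I. (u \<bullet> q I i) *\<^sub>R U $ i)" if "I \<in> V" for I u by (rule expand[OF that])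
    show "\<exists>I\<in>V. u \<in> gen_cone U I" for u by (rule cover)
    show "U $ i \<noteq> 0" for i by (rule nonzero)
  qed
  have "F.strict z0" unfolding F.strict_def
  proof (intro ballI allI impI)
    fix I j assume I: "I \<in> V" "j \<notin> I"
    then obtain v where v: "v extreme_point_of P" "I = Iv v" by (auto simp: V_def)
    have vP: "v \<in> P" by (rule ext_mem[OF v(1)])
    have "F.vert I z0 = v"
    proof (rule F.inner_ext[OF I(1)])
      fix i assume i: "i \<in> I"
      then have "U $ i \<bullet> v + z0 $ i = 0" using Iv_iff[OF vP] v(2) by simp
      then show "U $ i \<bullet> F.vert I z0 = U $ i \<bullet> v" using F.inner_vert[OF I(1) i, of z0] by simp
    qed
    moreover have "U $ j \<bullet> v + z0 $ j \<noteq> 0" using I(2) Iv_iff[OF vP] v(2) by simp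
    moreover have "U $ j \<bullet> v + z0 $ j \<ge> 0" using vP P_sub by (auto simp: mem_deformed_polytope)
    ultimately show "0 < U $ j \<bullet> F.vert I z0 + z0 $ j" by simp
  qed
  then show ?thesis using F.simplicial_fan_axioms P_eq by blast
qed

section \<open>Warren's adjoint\<close>

abbreviation of_real_vec :: "real ^ 'n::finite \<Rightarrow> complex ^ 'n" where
  "of_real_vec x \<equiv> (\<chi> i. complex_of_real (x $ i))"

section \<open>Passing between real and complex polynomials\<close>

lemma poly_eval_complexify:
  "poly_eval (complexify p) (of_real_vec x) = complex_of_real (poly_eval p (x :: real ^ 'n::finite))"
proof -
  have lookup: "Poly_Mapping.lookup (complexify p) m = complex_of_real (Poly_Mapping.lookup p m)" for m
    by (simp add: complexify_def map.rep_eq when_def)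
  have "Poly_Mapping.keys (complexify p) = Poly_Mapping.keys p"
    by (auto simp: in_keys_iff lookup)
  then show ?thesis by (simp add: poly_eval_def lookup)
qed

text \<open>Real vectors form an infinite grid, on which a nonzero polynomial function cannot
  vanish.\<close>

lemma polyfun_eq_of_real:
  fixes f g :: "complex ^ 'n::finite \<Rightarrow> complex"
  assumes "polyfun f" "polyfun g" "\<And>x. f (of_real_vec x) = g (of_real_vec x)"
  shows "f = g"
proof
  fix y
  have "f y - g y = 0"
  proof (rule polyfun_zero_grid[OF polyfun_diff[OF assms(1,2)], of "range complex_of_real"])
    show "infinite (range complex_of_real)"
      using finite_imageD[of complex_of_real UNIV] infinite_UNIV_char_0[where 'a = real] by (auto simp: inj_on_def)
    fix x :: "complex ^ 'n" assume "\<forall>i. x $ i \<in> range complex_of_real"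
    then have "x = of_real_vec (\<chi> i. Re (x $ i))" by (auto simp: vec_eq_iff) (metis Re_complex_of_real rangeE)
    then show "f x - g x = 0" using assms(3) by (metis right_minus_eq)
  qed
  then show "f y = g y" by simp
qed

text \<open>One complex equation becomes two real polynomial equations on real vectors, as the
  definition of \<open>zariski_closed\<close> over the reals requires.\<close>

lemma polyfun_Re_Im:
  assumes "polyfun g"
  shows "\<exists>r s. polyfun r \<and> polyfun s \<and> (\<forall>x :: real ^ 'n::finite. g (of_real_vec x) = Complex (r x) (s x))"
  using assms
proof induction
  case (const c)
  show ?case
    by (intro exI[of _ "\<lambda>_. Re c"] exI[of _ "\<lambda>_. Im c"] conjI polyfun.const allI) simp
next
  case (var i)
  show ?case
    by (intro exI[of _ "\<lambda>x. x $ i"] exI[of _ "\<lambda>_. 0"] conjI polyfun.const polyfun.var allI) (simp add: complex_eq_iff)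
next
  case (add f g)
  then obtain r s r' s' where *: "polyfun r" "polyfun s" "polyfun r'" "polyfun s'"
    "\<forall>x. f (of_real_vec x) = Complex (r x) (s x)" "\<forall>x. g (of_real_vec x) = Complex (r' x) (s' x)" by blast
  show ?case
    by (intro exI[of _ "\<lambda>x. r x + r' x"] exI[of _ "\<lambda>x. s x + s' x"] conjI polyfun.add * allI)
      (simp add: * complex_eq_iff)
next
  case (mult f g)
  then obtain r s r' s' where *: "polyfun r" "polyfun s" "polyfun r'" "polyfun s'"
    "\<forall>x. f (of_real_vec x) = Complex (r x) (s x)" "\<forall>x. g (of_real_vec x) = Complex (r' x) (s' x)" by blast
  show ?case
    by (intro exI[of _ "\<lambda>x. r x * r' x - s x * s' x"] exI[of _ "\<lambda>x. r x * s' x + s x * r' x"] conjI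
        polyfun_diff polyfun.add polyfun.mult * allI)
      (simp add: * complex_eq_iff)
qed

lemma zariski_closed_real_zeros:
  assumes g: "polyfun g" "\<exists>z. g z \<noteq> 0"
  shows "zariski_closed {z :: real ^ 'n::finite. g (of_real_vec z) = 0}"
    and "{z :: real ^ 'n. g (of_real_vec z) = 0} \<noteq> UNIV"
proof -
  obtain r s where rs: "polyfun r" "polyfun s" "\<And>x :: real ^ 'n. g (of_real_vec x) = Complex (r x) (s x)"
    using polyfun_Re_Im[OF g(1)] by blast
  obtain p p' where p: "r = poly_eval p" "s = poly_eval p'" using rs(1,2) unfolding polyfun_iff by blast
  have "{z :: real ^ 'n. g (of_real_vec z) = 0} = {z. \<forall>q\<in>{p, p'}. poly_eval q z = 0}"
    by (auto simp: rs(3) p complex_eq_iff)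
  then show "zariski_closed {z :: real ^ 'n. g (of_real_vec z) = 0}" unfolding zariski_closed_def by blast
  show "{z :: real ^ 'n. g (of_real_vec z) = 0} \<noteq> UNIV"
  proof
    assume "{z :: real ^ 'n. g (of_real_vec z) = 0} = UNIV"
    then have "g (of_real_vec x) = 0" for x by blast
    then have "g = (\<lambda>_. 0)" by (intro polyfun_eq_of_real g(1) polyfun.const)
    then show False using g(2) by simp
  qed
qed

section \<open>Formal and analytic partial derivatives\<close>

lemma sqfree_form_has_field_derivative:
  assumes "\<And>k. ((\<lambda>t. w t $ k) has_field_derivative w' k) (at t0)"
  shows "((\<lambda>t. sqfree_form G a (w t)) has_field_derivative (\<Sum>k\<in>UNIV. w' k * sqfree_grad G a k (w t0))) (at t0)"
proof -
  have "((\<lambda>t. sqfree_form G a (w t)) has_field_derivative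
      (\<Sum>s\<in>G. a s * (\<Sum>k\<in>s. w' k * (\<Prod>i\<in>s - {k}. w t0 $ i)))) (at t0)"
    unfolding sqfree_form_def
    by (intro DERIV_sum DERIV_cmult has_field_derivative_prod assms)
  also have "(\<Sum>s\<in>G. a s * (\<Sum>k\<in>s. w' k * (\<Prod>i\<in>s - {k}. w t0 $ i))) =
      (\<Sum>s\<in>G. \<Sum>k\<in>UNIV. w' k * (if k \<in> s then a s * (\<Prod>i\<in>s - {k}. w t0 $ i) else 0))"
  proof (rule sum.cong[OF refl])
    fix s
    have "(\<Sum>k\<in>UNIV. w' k * (if k \<in> s then a s * (\<Prod>i\<in>s - {k}. w t0 $ i) else 0)) =
        (\<Sum>k\<in>s. w' k * (a s * (\<Prod>i\<in>s - {k}. w t0 $ i)))"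
      by (rule sum.mono_neutral_cong_right) auto
    then show "a s * (\<Sum>k\<in>s. w' k * (\<Prod>i\<in>s - {k}. w t0 $ i)) =
        (\<Sum>k\<in>UNIV. w' k * (if k \<in> s then a s * (\<Prod>i\<in>s - {k}. w t0 $ i) else 0))"
      by (simp add: sum_distrib_left ac_simps)
  qed
  also have "\<dots> = (\<Sum>k\<in>UNIV. w' k * sqfree_grad G a k (w t0))"
    unfolding sqfree_grad_def sum_distrib_left by (rule sum.swap)
  finally show ?thesis .
qed

lemma partial_deriv_sqfree_form: "partial_deriv k (sqfree_form G a) x = sqfree_grad G a k x"
proof -
  have eq: "(\<chi> j. if j = k then x $ k else x $ j) = x" by (simp add: vec_eq_iff)
  have "((\<lambda>t. (\<chi> j. if j = k then t else x $ j) $ i) has_field_derivative (if i = k then 1 else 0)) (at (x $ k))" for i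
    by (cases "i = k") auto
  from sqfree_form_has_field_derivative[OF this, of G a] show ?thesis
    unfolding partial_deriv_def by (simp add: DERIV_imp_deriv eq if_distrib[of "\<lambda>b. b * _"] cong: if_cong)
qed

lemma partial_deriv_sqfree_form_affine:
  "partial_deriv i (\<lambda>y. sqfree_form G a (A *v y + z)) y = (\<Sum>k\<in>UNIV. A $ k $ i * sqfree_grad G a k (A *v y + z))"
proof -
  have eq: "(\<chi> j. if j = i then y $ i else y $ j) = y" by (simp add: vec_eq_iff)
  have "((\<lambda>t. (A *v (\<chi> j. if j = i then t else y $ j) + z) $ k) has_field_derivative A $ k $ i) (at (y $ i))" for k
  proof -
    have "((\<lambda>t. (\<Sum>j\<in>UNIV. A $ k $ j * (if j = i then t else y $ j)) + z $ k) has_field_derivative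
        (\<Sum>j\<in>UNIV. if j = i then A $ k $ i else 0) + 0) (at (y $ i))"
    proof (intro DERIV_add DERIV_sum DERIV_const)
      fix j
      show "((\<lambda>t. A $ k $ j * (if j = i then t else y $ j)) has_field_derivative (if j = i then A $ k $ i else 0)) (at (y $ i))"
        by (cases "j = i") (auto intro!: derivative_eq_intros)
    qed
    then show ?thesis by (simp add: matrix_vector_mult_def)
  qed
  from sqfree_form_has_field_derivative[OF this, of G a] show ?thesis
    unfolding partial_deriv_def by (simp add: DERIV_imp_deriv eq)
qed

context simplicial_fan
begin

text \<open>Indexed by the complement of a cone's rays, because these complements are the supports
  of the monomials in the adjoint.\<close>

definition coef :: "'n set \<Rightarrow> complex" where
  "coef s = complex_of_real (abs_det_sub U (gen_cone U (- s)))"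

definition real_adjoint :: "real ^ 'n \<Rightarrow> real ^ 'd \<Rightarrow> real" where
  "real_adjoint z y = (\<Sum>I\<in>V. abs_det_sub U (gen_cone U I) * (\<Prod>i\<in>- I. U $ i \<bullet> y + z $ i))"

lemma polyfun_real_adjoint: "polyfun (real_adjoint z)"
proof -
  have "polyfun (\<lambda>y. U $ i \<bullet> y + z $ i)" for i
    unfolding inner_vec_def by (intro polyfun.add polyfun_sum) (simp_all add: polyfun.intros)
  then show ?thesis
    unfolding real_adjoint_def[abs_def] by (intro polyfun_sum polyfun.mult polyfun.const polyfun_prod)
qed

lemma universal_adjoint_eq:
  assumes "strict z0"
  shows "universal_adjoint (normal_fan (deformed_polytope U z0)) U = sqfree_form (uminus ` V) coef"
proof
  fix x
  have "universal_adjoint (normal_fan (deformed_polytope U z0)) U x =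
      (\<Sum>I\<in>V. complex_of_real (abs_det_sub U (gen_cone U I)) * (\<Prod>i\<in>- rays_of U (gen_cone U I). x $ i))"
    unfolding universal_adjoint_def cones_of_dim_full[OF assms]
    by (subst sum.reindex[OF inj_on_gen_cone[OF assms]]) simp
  also have "\<dots> = (\<Sum>I\<in>V. complex_of_real (abs_det_sub U (gen_cone U I)) * (\<Prod>i\<in>- I. x $ i))"
    by (intro sum.cong refl) (simp add: rays_of_gen_cone[OF assms])
  also have "\<dots> = sqfree_form (uminus ` V) coef x"
    unfolding sqfree_form_def by (subst sum.reindex) (auto simp: inj_on_def coef_def)
  finally show "universal_adjoint (normal_fan (deformed_polytope U z0)) U x = sqfree_form (uminus ` V) coef x" .
qed

text \<open>The volume formula shows that \<open>real_adjoint z\<close> qualifies. For uniqueness,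
  two candidates agree on the interior, which every line through \<open>y0\<close> meets in
  infinitely many points.\<close>

lemma poly_eval_warren_adjoint:
  assumes z: "strict z"
  shows "poly_eval (warren_adjoint U z) = real_adjoint z"
proof -
  obtain p where p: "real_adjoint z = poly_eval p" using polyfun_real_adjoint[of z] unfolding polyfun_iff by blast
  let ?Q = "\<lambda>p. \<forall>y\<in>interior (deformed_polytope U z).
     norm_vol (polar_dual ((\<lambda>w. w - y) ` deformed_polytope U z)) =
       poly_eval p y / (\<Prod>i\<in>UNIV. U $ i \<bullet> y + z $ i)"
  have "warren_adjoint U z = p"
    unfolding warren_adjoint_def
  proof (rule the_equality)
    show Qp: "?Q p" unfolding p[symmetric] real_adjoint_def
      by (intro ballI norm_vol_polar_dual[OF z])
    fix p' assume p': "?Q p'"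
    obtain y0 where y0: "y0 \<in> interior (deformed_polytope U z)" using interior_nonempty[OF z] by blast
    have eq: "poly_eval p' y = poly_eval p y" if y: "y \<in> interior (deformed_polytope U z)" for y
    proof -
      have "(\<Prod>i\<in>UNIV. U $ i \<bullet> y + z $ i) \<noteq> 0" using interior_slack_pos[OF y] by (auto simp: less_imp_neq[symmetric])
      moreover have "poly_eval p' y / (\<Prod>i\<in>UNIV. U $ i \<bullet> y + z $ i) = poly_eval p y / (\<Prod>i\<in>UNIV. U $ i \<bullet> y + z $ i)"
        using bspec[OF p' y] bspec[OF Qp y] by (rule trans[OF sym])
      ultimately show ?thesis by simp
    qed
    have "poly_eval p' y = poly_eval p y" for y
    proof (rule ccontr)
      assume ne: "poly_eval p' y \<noteq> poly_eval p y"
      have "polyfun (poly_eval (p' - p))" by (auto simp: polyfun_iff)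
      moreover have "poly_eval (p' - p) (y0 + 1 *s (y - y0)) \<noteq> 0" using ne by (simp add: poly_eval_diff)
      ultimately have "finite {t. poly_eval (p' - p) (y0 + t *s (y - y0)) = 0}" by (rule polyfun_line_finite)
      moreover have "\<forall>\<^sub>F t in at_right (0::real). y0 + t *\<^sub>R (y - y0) \<in> interior (deformed_polytope U z)"
      proof -
        have "((\<lambda>t. y0 + t *\<^sub>R (y - y0)) \<longlongrightarrow> y0 + 0 *\<^sub>R (y - y0)) (at_right 0)" by (intro tendsto_intros)
        then show ?thesis by (rule topological_tendstoD[OF _ open_interior]) (use y0 in simp)
      qed
      then obtain e :: real where e: "e > 0" "\<And>t. 0 < t \<Longrightarrow> t < e \<Longrightarrow> y0 + t *\<^sub>R (y - y0) \<in> interior (deformed_polytope U z)"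
        unfolding eventually_at_right_field by auto
      have "{0<..<e} \<subseteq> {t. poly_eval (p' - p) (y0 + t *s (y - y0)) = 0}"
        using e(2) eq by (auto simp: poly_eval_diff scalar_mult_eq_scaleR)
      ultimately have "finite {0<..<e}" by (rule rev_finite_subset)
      then show False using infinite_Ioo[OF e(1)] by blast
    qed
    then show "p' = p" by (rule poly_eval_inj)
  qed
  then show ?thesis using p by simp
qed

abbreviation complex_U :: "complex ^ 'd ^ 'n" where
  "complex_U \<equiv> (\<chi> i j. complex_of_real (U $ i $ j))"

text \<open>Both sides are polynomial, and on real vectors both equal the real adjoint.\<close>

lemma poly_eval_complexify_warren_adjoint:
  assumes z: "strict z"
  shows "poly_eval (complexify (warren_adjoint U z)) =
    (\<lambda>y. sqfree_form (uminus ` V) coef (complex_U *v y + of_real_vec z))"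
proof (rule polyfun_eq_of_real)
  show "polyfun (poly_eval (complexify (warren_adjoint U z)))" by (auto simp: polyfun_iff)
  show "polyfun (\<lambda>y. sqfree_form (uminus ` V) coef (complex_U *v y + of_real_vec z))"
    by (rule polyfun_compose[OF polyfun_sqfree_form])
      (simp only: vector_add_component, intro polyfun.add polyfun_matrix_vector polyfun.var polyfun.const)
  fix y
  have "(complex_U *v of_real_vec y + of_real_vec z) $ i = complex_of_real (U $ i \<bullet> y + z $ i)" for i
    by (simp add: matrix_vector_mult_def inner_vec_def)
  then have "sqfree_form (uminus ` V) coef (complex_U *v of_real_vec y + of_real_vec z) =
      (\<Sum>s\<in>uminus ` V. coef s * (\<Prod>i\<in>s. complex_of_real (U $ i \<bullet> y + z $ i)))"
    by (simp only: sqfree_form_def)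
  also have "\<dots> = complex_of_real (real_adjoint z y)"
    by (subst sum.reindex) (auto simp: inj_on_def coef_def real_adjoint_def)
  finally show "poly_eval (complexify (warren_adjoint U z)) (of_real_vec y) =
      sqfree_form (uminus ` V) coef (complex_U *v of_real_vec y + of_real_vec z)"
    by (simp only: poly_eval_complexify poly_eval_warren_adjoint[OF z])
qed

lemma generic_warren_adjoint_smooth:
  assumes z0: "strict z0"
    and sing: "proj_dim (sing_locus (normal_fan (deformed_polytope U z0)) U) < ereal (real CARD('n) - real CARD('d) - 1)"
  shows "\<exists>Z :: (real ^ 'n) set. zariski_closed Z \<and> Z \<noteq> UNIV \<and>
    (\<forall>z. strict z \<and> z \<notin> Z \<longrightarrow> smooth_hypersurface (poly_eval (complexify (warren_adjoint U z))))"
proof -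
  let ?G = "uminus ` V" and ?S = "sing_locus (normal_fan (deformed_polytope U z0)) U"
  have S: "?S = {proj_point x | x. x \<noteq> 0 \<and> (\<forall>k. sqfree_grad ?G coef k x = 0)}"
    unfolding sing_locus_def universal_adjoint_eq[OF z0] partial_deriv_sqfree_form ..
  obtain I where I: "I \<in> V" using V_nonempty by blast
  \<comment> \<open>The element -1 in the supremum yields n > d even when the singular locus is
    empty, so the natural-number subtraction in the chain bound does not truncate.\<close>
  have "ereal (- 1) \<le> proj_dim ?S" unfolding proj_dim_def by (rule Sup_upper) (simp add: one_ereal_def)
  then have "ereal (- 1) < ereal (real CARD('n) - real CARD('d) - 1)" using sing by (rule le_less_trans)
  then have nd: "CARD('d) < CARD('n)" by simp
  have bound: "chain_bound {proj_point x | x. x \<noteq> 0 \<and> (\<forall>k. sqfree_grad ?G coef k x = 0)} h (CARD('n) - card I - 1)" for h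
    unfolding chain_bound_def S[symmetric]
  proof (intro allI impI)
    fix k C
    assume C: "(\<forall>i\<le>k. proj_irreducible (C i) \<and> C i \<subseteq> ?S) \<and> (\<forall>i<k. C i \<subset> C (Suc i)) \<and>
       (\<exists>x. x \<noteq> 0 \<and> proj_point x \<in> C 0 \<and> h x \<noteq> 0)"
    have "ereal (real k) \<le> proj_dim ?S" unfolding proj_dim_def
      by (rule Sup_upper) (use C in blast)
    then have "ereal (real k) < ereal (real CARD('n) - real CARD('d) - 1)" using sing by (rule le_less_trans)
    then show "k < CARD('n) - card I - 1" using nd card_V[OF I] by simp
  qed
  \<comment> \<open>One maximal cone \<open>I\<close> provides the rows that span all others; the
    dual basis \<open>q I\<close> supplies the coefficients \<open>N\<close>.\<close>
  have "\<exists>g. polyfun g \<and> (\<exists>z. g z \<noteq> 0) \<and>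
    (\<forall>z y. sqfree_form ?G coef (complex_U *v y + z) = 0 \<and>
      (\<forall>i. (\<Sum>k\<in>UNIV. complex_U $ k $ i * sqfree_grad ?G coef k (complex_U *v y + z)) = 0) \<longrightarrow> g z = 0)"
  proof (rule generic_fibre_smooth[where N = "\<lambda>j i. complex_of_real (U $ j \<bullet> q I i)", OF _ _ _ _ bound])
    show "card s = CARD('n) - CARD('d)" if "s \<in> ?G" for s
      using that card_V by (auto simp: Compl_eq_Diff_UNIV card_Diff_subset)
    show "card I < CARD('n)" using nd card_V[OF I] by simp
    fix j
    have "U $ j $ l = (\<Sum>i\<in>I. (U $ j \<bullet> q I i) * U $ i $ l)" for l
      using arg_cong[OF expand[OF I, of "U $ j"], of "\<lambda>u. u $ l"] by simp
    then have "complex_of_real (U $ j $ l) = (\<Sum>i\<in>I. complex_of_real (U $ j \<bullet> q I i) * complex_of_real (U $ i $ l))" for l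
      by (metis (no_types, lifting) of_real_mult of_real_sum sum.cong)
    then show "complex_U $ j = (\<Sum>i\<in>I. complex_of_real (U $ j \<bullet> q I i) *s complex_U $ i)"
      by (simp add: vec_eq_iff)
  qed simp
  then obtain g where g: "polyfun g" "\<exists>z. g z \<noteq> 0"
    "\<And>z y. sqfree_form ?G coef (complex_U *v y + z) = 0 \<Longrightarrow>
      (\<forall>i. (\<Sum>k\<in>UNIV. complex_U $ k $ i * sqfree_grad ?G coef k (complex_U *v y + z)) = 0) \<Longrightarrow> g z = 0"
    by blast
  have "smooth_hypersurface (poly_eval (complexify (warren_adjoint U z)))"
    if "strict z" "g (of_real_vec z) \<noteq> 0" for z
    unfolding smooth_hypersurface_def poly_eval_complexify_warren_adjoint[OF that(1)]
      partial_deriv_sqfree_form_affine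
    using g(3) that(2) by blast
  then show ?thesis
    using zariski_closed_real_zeros[OF g(1,2)] by (intro exI[of _ "{z. g (of_real_vec z) = 0}"]) blast
qed

end

theorem theorem7p13:
  fixes P :: "(real ^ 'd::finite) set" and U :: "real ^ 'd ^ 'n::finite"
  assumes "simple_polytope P"
    and "aff_dim P = int CARD('d)"
    and "ray_matrix (normal_fan P) U"
    and "proj_dim (sing_locus (normal_fan P) U) < ereal (real CARD('n) - real CARD('d) - 1)"
  shows "interior (deformation_cone (normal_fan P) U)
           = {z. normal_fan (deformed_polytope U z) = normal_fan P} \<and>
         (\<exists>Z :: (real ^ 'n) set. zariski_closed Z \<and> Z \<noteq> UNIV \<and>
           (\<forall>z \<in> interior (deformation_cone (normal_fan P) U) - Z.
              smooth_hypersurface (poly_eval (complexify (warren_adjoint U z)))))"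
proof -
  obtain V q z0 where fan: "simplicial_fan U V q" and z0: "simplicial_fan.strict U V q z0"
    and P: "P = deformed_polytope U z0"
    using simple_polytope_simplicial_fan[OF assms(1-3)] by blast
  interpret simplicial_fan U V q by (rule fan)
  have int: "interior (deformation_cone (normal_fan P) U) = {z. strict z}"
    unfolding P by (rule interior_deformation_cone[OF z0])
  obtain Z :: "(real ^ 'n) set" where "zariski_closed Z" "Z \<noteq> UNIV"
    "\<forall>z. strict z \<and> z \<notin> Z \<longrightarrow> smooth_hypersurface (poly_eval (complexify (warren_adjoint U z)))"
    using generic_warren_adjoint_smooth[OF z0 assms(4)[unfolded P]] by blast
  then show ?thesis
    unfolding int using strict_iff_same_fan[OF z0] P by auto
qed

end
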